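(* Let $k = 2\ell$ be an even integer ($\ell \in \mathbb{Z}$) and let $m \ge -\ell$ be an integer. Let $f_{k,m}^{(4)}(z)$ be the unique element of $M_k^\sharp(4)$ with Fourier expansion of the form $f_{k,m}^{(4)}(z) = q^{-m} + \sum_{n=\ell+1}^\infty a_k^{(4)}(m,n) q^n$. If $\ell \geq 0$ and $m \geq 4\ell + 16$, or if $\ell < 0$ and $m \geq 5|\ell| + 16$, then at least $\left\lfloor \frac{\sqrt{2}}{2} m + \frac{k}{4} \right\rfloor$ of the $m + \frac{k}{2}$ nontrivial zeros of $f_{k,m}^{(4)}(z)$ in the fundamental domain for $\Gamma_0(4)$ lie on the lower boundary of the fundamental domain.
   Context: $\Gamma_0(4) = \left\{ \begin{pmatrix} a & b \\ c & d\end{pmatrix} \in \mathrm{SL}_2(\mathbb{Z}) : c \equiv 0 \pmod 4 \right\}$, and $q = e^{2\pi i z}$ for $z$ in the upper half plane $\mathcal{H}$. $M_k^!(4)$ is the space of weakly holomorphic modular forms of weight $k$ for $\Gamma_0(4)$ (holomorphic on $\mathcal{H}$, meromorphic at the cusps), and $M_k^\sharp(4)$ is the subspace of forms that are holomorphic away from the cusp at $\infty$ (that is, holomorphic on $\mathcal{H}$ and at the cusps $0$ and $\frac12$, with a pole permitted only at $\infty$). For each even $k = 2\ell$ and each integer $m \ge -\ell$ there is exactly one form in $M_k^\sharp(4)$ with an expansion $q^{-m} + O(q^{\ell+1})$; this is $f_{k,m}^{(4)}$, and these forms are a basis of $M_k^\sharp(4)$. The fundamental domain for $\Gamma_0(4)$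 used is the region bordered by the lines $\mathrm{Re}(z) = \pm\frac12$ and the semicircles $\pm\frac14 + \frac14 e^{i\theta}$, $\theta \in [0,\pi]$; it meets the real line at $0$ and $\pm\frac12$. The left and right vertical lines are identified by $\begin{pmatrix} 1 & 1 \\ 0 & 1\end{pmatrix}$, and the left and right semicircles are identified by $\begin{pmatrix} 1 & 0 \\ 4 & 1\end{pmatrix}$. The lower boundary is formed by these two semicircles; since they are identified, zeros on it are counted modulo $\Gamma_0(4)$, i.e. on the left arc $-\frac14 + \frac14 e^{i\theta}$, $\theta \in [0,\pi]$. The valence formula for level $4$ is $v_\infty(f) + v_0(f) + v_{1/2}(f) + \sum_{z \in \Gamma_0(4)\backslash\mathcal{H}} v_z(f) = \frac{k}{2}$ for nonzero $f \in M_k^!(4)$. The $m + \frac{k}{2}$ nontrivial zeros of $f_{k,m}^{(4)}$ are the zeros, counted with multiplicity, in the fundamental domain or at the cusps $0$ and $\frac12$ (i.e. all zeros other than at $\infty$, where $f_{k,m}^{(4)}$ has order $-m$). *)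

theory Defs
  imports "HOL-Complex_Analysis.Complex_Analysis"
begin

definition upper_half_plane :: "complex set" where
  "upper_half_plane = {z. Im z > 0}"

definition SL2Z :: "(int ^ 2 ^ 2) set" where
  "SL2Z = {A. det A = 1}"

definition Gamma0 :: "int \<Rightarrow> (int ^ 2 ^ 2) set" where
  "Gamma0 N = {A \<in> SL2Z. N dvd A $ 2 $ 1}"

definition moebius :: "int ^ 2 ^ 2 \<Rightarrow> complex \<Rightarrow> complex" where
  "moebius A z = (of_int (A $ 1 $ 1) * z + of_int (A $ 1 $ 2)) /
                 (of_int (A $ 2 $ 1) * z + of_int (A $ 2 $ 2))"

definition slash :: "int \<Rightarrow> (complex \<Rightarrow> complex) \<Rightarrow> int ^ 2 ^ 2 \<Rightarrow> complex \<Rightarrow> complex" where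
  "slash k f A z =
     (of_int (A $ 2 $ 1) * z + of_int (A $ 2 $ 2)) powi (-k) * f (moebius A z)"

text \<open>\<open>qpow h n z\<close> is \<open>q\<close> to the power \<open>n/h\<close>, where \<open>q = exp (2 \<pi> i z)\<close>.\<close>

definition qpow :: "nat \<Rightarrow> int \<Rightarrow> complex \<Rightarrow> complex" where
  "qpow h n z = exp (2 * of_real pi * \<i> * of_int n * z / of_nat h)"

definition has_Fourier_expansion ::
    "nat \<Rightarrow> int \<Rightarrow> (int \<Rightarrow> complex) \<Rightarrow> (complex \<Rightarrow> complex) \<Rightarrow> bool" where
  "has_Fourier_expansion h N a g \<longleftrightarrow>
     (\<forall>z\<in>upper_half_plane. ((\<lambda>n. a n * qpow h n z) has_sum g z) {N..})"

text \<open>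
  The behaviour of a form \<open>f\<close> for \<open>Gamma0 4\<close> at the cusp \<open>A \<infinity>\<close>, for \<open>A\<close> in \<open>SL2Z\<close>, is read off
  from the expansion of \<open>f\<close> slashed with \<open>A\<close>. Every cusp of \<open>Gamma0 4\<close> has width dividing 4, so
  powers of \<open>q\<close> to the \<open>1/4\<close> suffice at all of them; at a cusp of smaller width the surplus
  coefficients are simply zero.
\<close>

definition meromorphic_at_cusp :: "int \<Rightarrow> (complex \<Rightarrow> complex) \<Rightarrow> int ^ 2 ^ 2 \<Rightarrow> bool" where
  "meromorphic_at_cusp k f A \<longleftrightarrow> (\<exists>N a. has_Fourier_expansion 4 N a (slash k f A))"

definition holomorphic_at_cusp :: "int \<Rightarrow> (complex \<Rightarrow> complex) \<Rightarrow> int ^ 2 ^ 2 \<Rightarrow> bool" where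
  "holomorphic_at_cusp k f A \<longleftrightarrow> (\<exists>a. has_Fourier_expansion 4 0 a (slash k f A))"

definition weakly_holomorphic_forms4 :: "int \<Rightarrow> (complex \<Rightarrow> complex) set" where
  "weakly_holomorphic_forms4 k = {f. f holomorphic_on upper_half_plane \<and>
     (\<forall>A\<in>Gamma0 4. \<forall>z\<in>upper_half_plane. slash k f A z = f z) \<and>
     (\<forall>A\<in>SL2Z. meromorphic_at_cusp k f A)}"

text \<open>The two matrices below send \<open>\<infinity>\<close> to the cusps \<open>0\<close> and \<open>1/2\<close>.\<close>

definition sharp_forms4 :: "int \<Rightarrow> (complex \<Rightarrow> complex) set" where
  "sharp_forms4 k = {f \<in> weakly_holomorphic_forms4 k.
     holomorphic_at_cusp k f (vector [vector [0, -1], vector [1, 0]]) \<and>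
     holomorphic_at_cusp k f (vector [vector [1, 0], vector [2, 1]])}"

text \<open>
  \<open>basis_form4 l m f\<close> says that \<open>f\<close> is the form of weight \<open>2 * l\<close> with
  expansion \<open>q^(-m) + O(q^(l+1))\<close>. Functions are total here, so \<open>f\<close> is determined only on the
  upper half plane.
\<close>

definition basis_form4 :: "int \<Rightarrow> int \<Rightarrow> (complex \<Rightarrow> complex) \<Rightarrow> bool" where
  "basis_form4 l m f \<longleftrightarrow> f \<in> sharp_forms4 (2 * l) \<and>
     (\<exists>a. has_Fourier_expansion 1 (l + 1) a (\<lambda>z. f z - qpow 1 (-m) z))"

text \<open>
  The lower boundary of the fundamental domain modulo \<open>Gamma0 4\<close>: the two boundary semicircles are
  identified, so only the left one is kept. Intersecting with the upper half plane removes exactly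
  the end points \<open>0\<close> and \<open>-1/2\<close>, which are cusps.
\<close>

definition lower_boundary4 :: "complex set" where
  "lower_boundary4 = {z \<in> upper_half_plane.
     \<exists>\<theta>\<in>{0..pi}. z = - 1/4 + 1/4 * exp (\<i> * of_real \<theta>)}"

text \<open>Number of zeros in \<open>S\<close>, counted with multiplicity (0 by convention if there are infinitely many).\<close>

definition zeros_count :: "(complex \<Rightarrow> complex) \<Rightarrow> complex set \<Rightarrow> int" where
  "zeros_count f S = (\<Sum>z | z \<in> S \<and> f z = 0. zorder f z)"

end

theory Submission
  imports Defs "HOL-Probability.Distributions"
begin

text \<open>
  Write \<open>\<vartheta>(q)\<close> for the sum of \<open>q^(n^2)\<close> over all integers \<open>n\<close> and \<open>E(q) = q (\<Sum> q^(n(n+1)))^4\<close>, the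
  sum running over \<open>n \<ge> 0\<close> (below: \<open>theta3\<close> and \<open>eis\<close>). With \<open>q = exp (2 \<pi> i z)\<close>, both \<open>\<vartheta>^4\<close> and
  \<open>E\<close> have weight 2 for \<open>Gamma0 4\<close>; \<open>E\<close> has no zero in the upper half plane, and
  \<open>\<psi> = \<vartheta>^4 / (16 E)\<close> is a Hauptmodul whose only pole is the simple one at \<open>\<infinity>\<close>. Dividing the basis
  form \<open>f\<close> by \<open>E^l\<close> leaves a modular function with a pole at \<open>\<infinity>\<close> only, hence a polynomial \<open>P\<close> in
  \<open>\<psi>\<close>. The prescribed expansion \<open>q^(-m) + O(q^(l+1))\<close> says exactly that \<open>P(\<psi>)\<close> agrees with
  \<open>s = q^(-m) E^(-l)\<close> (below: \<open>seed\<close>) up to a function that is holomorphic in the unit disc and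
  vanishes at \<open>0\<close>. This is \<open>basis_form_polynomial\<close>; it rests on a maximum modulus argument over the
  three cusps (\<open>Gamma0_4_liouville\<close>).

  On the lower arc \<open>\<psi>\<close> is real, injective and has values in \<open>(0, 1)\<close>, so that zeros of \<open>f\<close> on the
  arc are real zeros of \<open>P\<close>. To evaluate \<open>P\<close> at \<open>x = \<psi>(q1)\<close>, where \<open>q1\<close> comes from a point of the
  arc, integrate \<open>s d log (\<psi> - x)\<close> over the circle of radius \<open>exp (-\<pi>/4)\<close>. Inside it, \<open>\<psi> - x\<close> has
  the two simple zeros \<open>q1\<close> and \<open>cnj q1\<close> (the second one comes from the right arc) and the simple
  pole \<open>0\<close>, and the residue theorem gives \<open>P(x) = 2 Re s(q1)\<close> up to the integral
  (\<open>seed_residue_formula\<close>). By Jacobi's derivative identity, \<open>- q d/dq log (\<psi> - x)\<close> is the quotient of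
  \<open>\<vartheta>(q)^4 \<vartheta>(-q)^4\<close> by \<open>(1 - x) \<vartheta>(q)^4 + x \<vartheta>(-q)^4\<close>, which for the \<open>x\<close> in question is at most 21 in
  absolute value on the circle (\<open>kernel_bound\<close>). Since \<open>|q^(-m)| = exp (\<pi> m / 4)\<close> there, the
  integral is at most of about that size.

  At the angle \<open>\<theta>\<close> of the arc, \<open>s\<close> has modulus about \<open>exp (\<pi> m sin \<theta> / 2)\<close> and a phase linear in
  \<open>cos \<theta>\<close> and \<open>\<theta>\<close> (\<open>seed_arc\<close>). For \<open>\<theta>\<close> between \<open>\<pi>/4\<close> and \<open>3\<pi>/4\<close>, and a little beyond,
  twice the modulus exceeds the error bound (\<open>main_term_dominates\<close>), so \<open>P\<close> has the sign of the cosine of the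
  phase wherever that cosine is \<open>1\<close> or \<open>-1\<close>. Between \<open>\<pi>/4\<close> and \<open>3\<pi>/4\<close> the phase changes by
  \<open>\<pi> (sqrt 2 / 2 m + k / 4)\<close>; the overlap beyond these angles makes up for the rounding, and the
  alternating signs produce the required number of zeros.

  The transformation laws of \<open>\<vartheta>\<close> and \<open>E\<close> come from the duplication formulas. At real nomes,
  doubling the parameter is a step of the arithmetic-geometric mean, whose limit determines its
  starting values; this yields the inversion \<open>t \<mapsto> 1/t\<close> on the imaginary axis (\<open>R3_inversion\<close>), and the
  identity theorem extends it to the upper half plane.
\<close>

section \<open>Lacunary power series and theta functions\<close>

lemma int_split_nat:
  fixes g :: "int \<Rightarrow> 'a :: banach"
  assumes "(\<lambda>n. norm (g (int n))) sums a'" "(\<lambda>n. norm (g (- 1 - int n))) sums b'"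
    and "(\<lambda>n. g (int n)) sums a" "(\<lambda>n. g (- 1 - int n)) sums b"
  shows "(g has_sum (a + b)) UNIV"
proof -
  have 1: "((\<lambda>n. g (int n)) has_sum a) UNIV"
    using norm_summable_imp_has_sum[OF _ assms(3)] assms(1) by (auto simp: sums_iff)
  have 2: "((\<lambda>n. g (-1 - int n)) has_sum b) UNIV"
    using norm_summable_imp_has_sum[OF _ assms(4)] assms(2) by (auto simp: sums_iff)
  have r1: "range int = {0..}" using zero_le_imp_eq_int by force
  have r2: "range (\<lambda>n. - 1 - int n) = {..<0}"
  proof -
    have "x \<in> range (\<lambda>n. - 1 - int n)" if "x < 0" for x :: int
    proof -
      have "x = - 1 - int (nat (- 1 - x))" using that by simp
      thus ?thesis by blast
    qed
    thus ?thesis by auto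
  qed
  have "(g has_sum a) {0..}"
    using 1 has_sum_reindex[of int UNIV g a] by (simp add: r1 o_def)
  moreover have "(g has_sum b) {..<0}"
    using 2 has_sum_reindex[of "\<lambda>n. -1 - int n" UNIV g b] by (simp add: r2 o_def inj_on_def)
  ultimately have "(g has_sum (a + b)) ({0..} \<union> {..<0})"
    by (intro has_sum_Un_disjoint) auto
  moreover have "{0..} \<union> {..<0} = (UNIV :: int set)" by auto
  ultimately show ?thesis by simp
qed

lemma lacunary_summable:
  fixes q :: "'a :: {real_normed_div_algebra, banach}"
  assumes "norm q < 1" "\<And>n. n \<le> e n" shows "summable (\<lambda>n. norm (q ^ e n))"
proof (rule summable_comparison_test')
  show "summable (\<lambda>n. norm q ^ n)" using assms by (simp add: summable_geometric)
  fix n :: nat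
  show "norm (norm (q ^ e n)) \<le> norm q ^ n"
    using assms by (simp add: norm_power power_decreasing)
qed

lemma lacunary_tail:
  fixes q :: complex
  assumes "norm q < 1" "\<And>n. a + b * n \<le> e n" "0 < b"
  shows "norm (\<Sum>n. q ^ e n) \<le> norm q ^ a / (1 - norm q ^ b)"
proof -
  define r where "r = norm q"
  have r: "0 \<le> r" "r < 1" "r ^ b < 1" using assms by (auto simp: r_def power_less_one_iff)
  have n: "n \<le> e n" for n
  proof -
    have "n \<le> b * n" using assms(3) by simp
    thus ?thesis using assms(2)[of n] by linarith
  qed
  have s: "summable (\<lambda>n. norm (q ^ e n))" by (rule lacunary_summable[OF assms(1) n])
  have g: "(\<lambda>n. r ^ a * (r ^ b) ^ n) sums (r ^ a * (1 / (1 - r ^ b)))"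
    using r by (intro sums_mult geometric_sums) simp
  have "norm (\<Sum>n. q ^ e n) \<le> (\<Sum>n. norm (q ^ e n))" by (rule summable_norm[OF s])
  also have "\<dots> \<le> (\<Sum>n. r ^ a * (r ^ b) ^ n)"
  proof (rule suminf_le[OF _ s])
    show "summable (\<lambda>n. r ^ a * (r ^ b) ^ n)" using g by (rule sums_summable)
    fix n
    have "r ^ e n \<le> r ^ (a + b * n)" using r assms(2) by (intro power_decreasing) auto
    thus "norm (q ^ e n) \<le> r ^ a * (r ^ b) ^ n"
      by (simp add: norm_power r_def power_add power_mult)
  qed
  also have "\<dots> = r ^ a / (1 - r ^ b)" using g by (simp add: sums_iff)
  finally show ?thesis by (simp add: r_def)
qed

lemma lacunary_holomorphic:
  assumes e: "\<And>n. n \<le> e n" shows "(\<lambda>q::complex. \<Sum>n. q ^ e n) holomorphic_on ball 0 1"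
proof -
  have der: "((\<lambda>x. x ^ e n) has_field_derivative of_nat (e n) * x ^ (e n - 1)) (at x)"
    for n and x :: complex by (auto intro!: derivative_eq_intros)
  have "\<exists>g g'. \<forall>x \<in> ball (0::complex) 1. ((\<lambda>n. x ^ e n) sums g x) \<and>
      ((\<lambda>n. of_nat (e n) * x ^ (e n - 1)) sums g' x) \<and> (g has_field_derivative g' x) (at x)"
  proof (rule series_and_derivative_comparison_local[OF open_ball der])
    fix x :: complex assume x: "x \<in> ball 0 1"
    define r where "r = (1 + norm x) / 2"
    have r: "0 \<le> r" "r < 1" "norm x < r" using x by (auto simp: r_def)
    show "\<exists>d h. 0 < d \<and> summable h \<and>
        (\<forall>\<^sub>F n in sequentially. \<forall>y\<in>ball x d \<inter> ball 0 1. norm (y ^ e n) \<le> h n)"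
    proof (intro exI conjI)
      show "0 < r - norm x" using r by simp
      show "summable (\<lambda>n. r ^ n)" using r by (simp add: summable_geometric)
      show "\<forall>\<^sub>F n in sequentially. \<forall>y\<in>ball x (r - norm x) \<inter> ball 0 1. norm (y ^ e n) \<le> r ^ n"
      proof (intro always_eventually allI ballI)
        fix n y assume "y \<in> ball x (r - norm x) \<inter> ball 0 1"
        hence y: "norm y < r" using norm_triangle_ineq2[of y x]
          by (auto simp: dist_norm norm_minus_commute)
        have "norm y ^ e n \<le> r ^ e n" using y by (intro power_mono) auto
        also have "\<dots> \<le> r ^ n" using r e[of n] by (intro power_decreasing) auto
        finally show "norm (y ^ e n) \<le> r ^ n" by (simp add: norm_power)
      qed
    qed
  qed
  then obtain g g' where g: "\<And>x. x \<in> ball (0::complex) 1 \<Longrightarrow> (\<lambda>n. x ^ e n) sums g x"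
    "\<And>x. x \<in> ball (0::complex) 1 \<Longrightarrow> (g has_field_derivative g' x) (at x)" by blast
  have "g holomorphic_on ball 0 1" using g(2) holomorphic_on_open by blast
  moreover have "(\<Sum>n. x ^ e n) = g x" if "x \<in> ball 0 1" for x :: complex
    using g(1)[OF that] by (simp add: sums_iff)
  ultimately show ?thesis by (metis (no_types, lifting) holomorphic_cong)
qed

lemma lacunary_cnj:
  assumes "norm q < 1" "\<And>n. n \<le> e n"
  shows "(\<Sum>n. cnj q ^ e n) = cnj (\<Sum>n. q ^ e n)"
proof -
  have "(\<lambda>n. q ^ e n) sums (\<Sum>n. q ^ e n)"
    by (rule summable_sums[OF summable_norm_cancel[OF lacunary_summable[OF assms]]])
  hence "(\<lambda>n. cnj (q ^ e n)) sums cnj (\<Sum>n. q ^ e n)" by (simp only: sums_cnj)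
  thus ?thesis by (simp add: sums_iff)
qed

text \<open>
  The sums over \<open>n \<ge> 0\<close> keep both functions power series with exponents at least \<open>n\<close>. The first is the
  Jacobi theta function; the second is \<open>\<vartheta>_2(q) / (2 q^(1/4))\<close>, a form of \<open>\<vartheta>_2\<close> without
  fractional powers. The Jacobi function \<open>\<vartheta>_4\<close> is \<open>theta3 (- q)\<close>.
\<close>

definition theta3 :: "complex \<Rightarrow> complex" where
  "theta3 q = 1 + 2 * (\<Sum>n. q ^ ((n + 1) ^ 2))"

definition tri :: "complex \<Rightarrow> complex" where
  "tri q = (\<Sum>n. q ^ (n * (n + 1)))"

lemma sq_ge: "n \<le> (n + 1) ^ 2" for n :: nat by (simp add: power2_eq_square)

lemma pronic_ge: "n \<le> n * (n + 1)" for n :: nat by simp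

lemmas theta3_summable = lacunary_summable[OF _ sq_ge]

lemmas tri_summable = lacunary_summable[OF _ pronic_ge]

lemma theta3_has_sum:
  assumes "norm q < 1" shows "((\<lambda>n::int. q ^ nat (n ^ 2)) has_sum theta3 q) UNIV"
proof -
  have e1: "nat ((int n)^2) = n^2" for n by (simp add: nat_power_eq)
  have e2: "nat ((- 1 - int n)^2) = (n+1)^2" for n
  proof -
    have "(- 1 - int n)^2 = int ((n+1)^2)" by (simp add: power2_eq_square algebra_simps)
    thus ?thesis by (simp only: nat_int)
  qed
  define S where "S = (\<Sum>n. q ^ ((n + 1) ^ 2))"
  have s: "summable (\<lambda>n. norm (q ^ ((n + 1) ^ 2)))" using theta3_summable[OF assms] .
  have s2: "summable (\<lambda>n. norm (q ^ (n ^ 2)))"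
    using s summable_Suc_iff[of "\<lambda>n. norm (q ^ (n ^ 2))"] by simp
  have h: "(\<lambda>n. q ^ ((n + 1) ^ 2)) sums S"
    using summable_norm_cancel[OF s] unfolding S_def by (rule summable_sums)
  have h2: "(\<lambda>n. q ^ (n ^ 2)) sums (S + 1)"
    using h sums_Suc[of "\<lambda>n. q ^ (n ^ 2)" S] by simp
  have "((\<lambda>n::int. q ^ nat (n ^ 2)) has_sum ((S + 1) + S)) UNIV"
    by (rule int_split_nat[of _ "suminf (\<lambda>n. norm (q ^ (n ^ 2)))" "suminf (\<lambda>n. norm (q ^ ((n + 1) ^ 2)))"])
       (use s s2 h h2 in \<open>simp_all only: e1 e2 summable_sums\<close>)
  moreover have "(S + 1) + S = theta3 q" by (simp add: theta3_def S_def)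
  ultimately show ?thesis by simp
qed

lemma tri_has_sum:
  assumes "norm q < 1" shows "((\<lambda>n::int. q ^ nat (n * (n + 1))) has_sum (2 * tri q)) UNIV"
proof -
  have e1: "nat (int n * (int n + 1)) = n * (n + 1)" for n
  proof -
    have "int n * (int n + 1) = int (n * (n + 1))" by (simp add: algebra_simps)
    thus ?thesis by (simp only: nat_int)
  qed
  have e2: "nat ((- 1 - int n) * (- 1 - int n + 1)) = n * (n + 1)" for n
  proof -
    have "(- 1 - int n) * (- 1 - int n + 1) = int (n * (n + 1))" by (simp add: algebra_simps)
    thus ?thesis by (simp only: nat_int)
  qed
  have s: "summable (\<lambda>n. norm (q ^ (n * (n + 1))))" using tri_summable[OF assms] .
  have h: "(\<lambda>n. q ^ (n * (n + 1))) sums tri q"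
    using summable_norm_cancel[OF s] unfolding tri_def by (rule summable_sums)
  have "((\<lambda>n::int. q ^ nat (n * (n + 1))) has_sum (tri q + tri q)) UNIV"
    by (rule int_split_nat[of _ "suminf (\<lambda>n. norm (q ^ (n * (n + 1))))" "suminf (\<lambda>n. norm (q ^ (n * (n + 1))))"])
       (use s h in \<open>simp_all only: e1 e2 summable_sums\<close>)
  thus ?thesis by simp
qed

lemma theta3_tail:
  assumes "norm q < 1" shows "norm (theta3 q - 1 - 2 * q) \<le> 2 * norm q ^ 4 / (1 - norm q ^ 5)"
proof -
  have "(\<Sum>n. q ^ ((n + 1) ^ 2)) = (\<Sum>n. q ^ ((n + 2) ^ 2)) + q"
    using suminf_split_head[OF summable_norm_cancel[OF theta3_summable[OF assms]]]
    by (simp add: numeral_2_eq_2)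
  hence "theta3 q - 1 - 2 * q = 2 * (\<Sum>n. q ^ ((n + 2) ^ 2))"
    by (simp add: theta3_def algebra_simps)
  moreover have "norm (\<Sum>n. q ^ ((n + 2) ^ 2)) \<le> norm q ^ 4 / (1 - norm q ^ 5)"
  proof (rule lacunary_tail[OF assms])
    fix n :: nat
    have "n \<le> n^2" by (cases n) (auto simp: power2_eq_square)
    thus "4 + 5 * n \<le> (n + 2) ^ 2" by (simp add: power2_eq_square)
  qed simp
  ultimately show ?thesis by (simp add: norm_mult)
qed

lemma tri_tail:
  assumes "norm q < 1" shows "norm (tri q - 1) \<le> norm q ^ 2 / (1 - norm q ^ 4)"
proof -
  have "tri q = (\<Sum>n. q ^ ((n + 1) * (n + 2))) + 1"
    using suminf_split_head[OF summable_norm_cancel[OF tri_summable[OF assms]]]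
    by (simp add: tri_def algebra_simps)
  moreover have "norm (\<Sum>n. q ^ ((n + 1) * (n + 2))) \<le> norm q ^ 2 / (1 - norm q ^ 4)"
  proof (rule lacunary_tail[OF assms])
    fix n :: nat
    have "n \<le> n^2" by (cases n) (auto simp: power2_eq_square)
    thus "2 + 4 * n \<le> (n + 1) * (n + 2)" by (simp add: power2_eq_square)
  qed simp
  ultimately show ?thesis by simp
qed

lemma theta3_holomorphic: "theta3 holomorphic_on ball 0 1"
  unfolding theta3_def[abs_def] by (intro holomorphic_intros lacunary_holomorphic sq_ge)

lemma tri_holomorphic: "tri holomorphic_on ball 0 1"
  unfolding tri_def[abs_def] by (intro lacunary_holomorphic pronic_ge)

lemma theta3_cnj: "norm q < 1 \<Longrightarrow> theta3 (cnj q) = cnj (theta3 q)"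
  using lacunary_cnj[OF _ sq_ge] by (simp add: theta3_def)

lemma tri_cnj: "norm q < 1 \<Longrightarrow> tri (cnj q) = cnj (tri q)"
  using lacunary_cnj[OF _ pronic_ge] by (simp add: tri_def)

section \<open>Duplication formulas\<close>

lemma has_sum_product_complex:
  fixes f g :: "'a \<Rightarrow> complex"
  assumes "(f has_sum a) UNIV" "(g has_sum b) UNIV"
  shows "((\<lambda>(x, y). f x * g y) has_sum (a * b)) UNIV"
proof -
  have "(\<lambda>x. norm (f x)) summable_on UNIV" "(\<lambda>x. norm (g x)) summable_on UNIV"
    using assms by (auto simp: summable_on_iff_abs_summable_on_complex[symmetric] summable_on_def)
  hence "(\<lambda>p. norm (case p of (x, y) \<Rightarrow> f x * g y)) summable_on (UNIV \<times> UNIV)"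
    by (subst Infinite_Sum.abs_summable_on_Sigma_iff) (auto simp: norm_mult infsum_cmult_right' infsum_nonneg
        abs_mult intro!: summable_on_cmult_right summable_on_cmult_left)
  hence s: "(\<lambda>(x, y). f x * g y) summable_on (UNIV \<times> UNIV)"
    by (rule abs_summable_summable)
  have "((\<lambda>(x, y). f x * g y) has_sum (a * b)) (Sigma UNIV (\<lambda>_. UNIV))"
    by (rule has_sum_SigmaI[where g = "\<lambda>x. f x * b"])
       (use assms s in \<open>auto intro: has_sum_cmult_left has_sum_cmult_right\<close>)
  thus ?thesis by simp
qed

text \<open>
  The substitutions \<open>(u + v, u - v)\<close> and \<open>(u + v + 1, u - v)\<close> run through the pairs with even and with
  odd sum. Applied to a product of two theta series they turn the exponent \<open>x^2 + y^2\<close> into twice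
  another sum of squares or of pronic numbers, which is what doubles the nome.
\<close>

lemma has_sum_parity_split:
  fixes g :: "int \<times> int \<Rightarrow> complex"
  assumes "((\<lambda>(u, v). g (u + v, u - v)) has_sum a) UNIV"
    and "((\<lambda>(u, v). g (u + v + 1, u - v)) has_sum b) UNIV"
  shows "(g has_sum (a + b)) UNIV"
proof -
  define h0 h1 :: "int \<times> int \<Rightarrow> int \<times> int"
    where "h0 = (\<lambda>(u, v). (u + v, u - v))" and "h1 = (\<lambda>(u, v). (u + v + 1, u - v))"
  have "inj h0" "inj h1" by (auto simp: inj_on_def h0_def h1_def)
  have "(x, y) \<in> range h0" if "even (x + y)" for x y
  proof -
    have "(x, y) = h0 ((x + y) div 2, (x - y) div 2)" using that unfolding h0_def by auto presburger+
    thus ?thesis by blast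
  qed
  hence r0: "range h0 = {p. even (fst p + snd p)}" by (auto simp: h0_def)
  have "(x, y) \<in> range h1" if "odd (x + y)" for x y
  proof -
    have "(x, y) = h1 ((x + y - 1) div 2, (x - y - 1) div 2)"
      using that unfolding h1_def by auto presburger+
    thus ?thesis by blast
  qed
  hence r1: "range h1 = {p. odd (fst p + snd p)}" by (auto simp: h1_def)
  have "(g has_sum a) {p. even (fst p + snd p)}"
    using assms(1) has_sum_reindex[OF \<open>inj h0\<close>, of g a] unfolding r0 by (simp add: o_def h0_def case_prod_unfold)
  moreover have "(g has_sum b) {p. odd (fst p + snd p)}"
    using assms(2) has_sum_reindex[OF \<open>inj h1\<close>, of g b] unfolding r1 by (simp add: o_def h1_def case_prod_unfold)
  ultimately have "(g has_sum (a + b)) ({p. even (fst p + snd p)} \<union> {p. odd (fst p + snd p)})"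
    by (intro has_sum_Un_disjoint) auto
  moreover have "{p. even (fst p + snd p)} \<union> {p. odd (fst p + snd p)} = (UNIV :: (int \<times> int) set)" by auto
  ultimately show ?thesis by simp
qed

lemma theta3_minus_has_sum:
  assumes "norm q < 1" shows "((\<lambda>n::int. (if even n then 1 else -1) * q ^ nat (n ^ 2)) has_sum theta3 (- q)) UNIV"
proof -
  have "(- q) ^ nat (n ^ 2) = (if even n then 1 else -1) * q ^ nat (n ^ 2)" for n
  proof -
    have "even (nat (n ^ 2)) \<longleftrightarrow> even n" by (simp add: even_nat_iff)
    thus ?thesis by (simp add: power_minus_odd)
  qed
  thus ?thesis using theta3_has_sum[of "- q"] assms by simp
qed

lemma pow2nat: "(q ^ 2) ^ nat n = q ^ nat (2 * n)" for q :: complex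
  by (simp add: power_mult[symmetric] nat_mult_distrib)

lemma pronic_int_nonneg: "0 \<le> n * (n + 1)" for n :: int
  by (cases "n \<ge> 0") (auto simp: zero_le_mult_iff)

lemma theta3_theta3_has_sum:
  assumes "norm q < 1"
  shows "((\<lambda>(u::int, v::int). q ^ nat (2 * (u^2 + v^2))) has_sum theta3 (q ^ 2) ^ 2) UNIV"
proof -
  have q2: "norm (q ^ 2) < 1" using assms by (simp add: norm_power power_less_one_iff)
  have "(\<lambda>(u, v). (q ^ 2) ^ nat (u ^ 2) * (q ^ 2) ^ nat (v ^ 2)) = (\<lambda>(u::int, v::int). q ^ nat (2 * (u^2 + v^2)))"
    by (simp only: pow2nat power_add[symmetric] nat_add_distrib[symmetric] distrib_left
          zero_le_mult_iff zero_le_power2 zero_le_numeral simp_thms)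
  thus ?thesis using has_sum_product_complex[OF theta3_has_sum[OF q2] theta3_has_sum[OF q2]]
    by (simp add: power2_eq_square)
qed

lemma tri_tri_has_sum:
  assumes "norm q < 1"
  shows "((\<lambda>(u::int, v::int). q ^ nat (2 * (u * (u + 1) + v * (v + 1)))) has_sum (2 * tri (q ^ 2)) ^ 2) UNIV"
proof -
  have q2: "norm (q ^ 2) < 1" using assms by (simp add: norm_power power_less_one_iff)
  have "(\<lambda>(u, v). (q ^ 2) ^ nat (u * (u + 1)) * (q ^ 2) ^ nat (v * (v + 1))) = (\<lambda>(u::int, v::int). q ^ nat (2 * (u * (u + 1) + v * (v + 1))))"
    by (intro ext) (auto simp only: split pow2nat power_add[symmetric] distrib_left[of 2]
          nat_add_distrib[symmetric] mult_nonneg_nonneg[OF _ pronic_int_nonneg] zero_le_numeral)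
  thus ?thesis using has_sum_product_complex[OF tri_has_sum[OF q2] tri_has_sum[OF q2]]
    by (simp add: power2_eq_square)
qed

lemma tri_theta3_has_sum:
  assumes "norm q < 1"
  shows "((\<lambda>(u::int, v::int). q ^ nat (2 * (u * (u + 1) + v^2))) has_sum (2 * tri (q ^ 2) * theta3 (q ^ 2))) UNIV"
proof -
  have q2: "norm (q ^ 2) < 1" using assms by (simp add: norm_power power_less_one_iff)
  have "(\<lambda>(u, v). (q ^ 2) ^ nat (u * (u + 1)) * (q ^ 2) ^ nat (v^2)) = (\<lambda>(u::int, v::int). q ^ nat (2 * (u * (u + 1) + v^2)))"
    by (intro ext) (auto simp only: split pow2nat power_add[symmetric] distrib_left[of 2]
          nat_add_distrib[symmetric] mult_nonneg_nonneg[OF _ pronic_int_nonneg] mult_nonneg_nonneg[OF _ zero_le_power2] zero_le_numeral)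
  thus ?thesis using has_sum_product_complex[OF tri_has_sum[OF q2] theta3_has_sum[OF q2]] by simp
qed

text \<open>
  Landen's transformations. All four follow by splitting a product of two theta series according to the
  parity of \<open>x + y\<close>: for the first two the even part contributes \<open>theta3 (q^2)^2\<close> and the odd part
  \<open>4 q tri (q^2)^2\<close>, with a sign for \<open>theta3 (- q)^2\<close>; in the mixed product the odd part vanishes by
  antisymmetry.
\<close>

lemma
  assumes q: "norm q < 1"
  shows theta3_sum_squares: "theta3 q ^ 2 + theta3 (- q) ^ 2 = 2 * theta3 (q ^ 2) ^ 2"
    and theta3_diff_squares: "theta3 q ^ 2 - theta3 (- q) ^ 2 = 8 * q * tri (q ^ 2) ^ 2"
    and theta3_mult: "theta3 q * theta3 (- q) = theta3 (- (q ^ 2)) ^ 2"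
    and tri_square: "tri q ^ 2 = tri (q ^ 2) * theta3 (q ^ 2)"
proof -
  define s :: "int \<Rightarrow> complex" where "s = (\<lambda>n. if even n then 1 else -1)"
  have q2: "norm (q ^ 2) < 1" using assms by (simp add: norm_power power_less_one_iff)
  have t4: "((\<lambda>n. s n * q ^ nat (n^2)) has_sum theta3 (- q)) UNIV"
    using theta3_minus_has_sum[OF q] by (simp add: s_def)
  have t4': "((\<lambda>n. s n * (q^2) ^ nat (n^2)) has_sum theta3 (- (q^2))) UNIV"
    using theta3_minus_has_sum[OF q2] by (simp add: s_def)
  note t3 = theta3_has_sum[OF q]
  have cmb: "q ^ nat a * q ^ nat b = q ^ nat (a + b)" if "0 \<le> a" "0 \<le> b" for a b
    using that by (simp add: power_add nat_add_distrib)
  have p0: "nat ((u + v)^2 + (u - v)^2) = nat (2 * (u^2 + v^2))" for u v :: int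
    by (simp add: power2_eq_square algebra_simps)
  have p1: "q ^ nat ((u + v + 1)^2 + (u - v)^2) = q * q ^ nat (2 * (u * (u + 1) + v * (v + 1)))" for u v :: int
  proof -
    have "(u + v + 1)^2 + (u - v)^2 = 1 + 2 * (u * (u + 1) + v * (v + 1))"
      by (simp add: power2_eq_square algebra_simps)
    moreover have "0 \<le> 2 * (u * (u + 1) + v * (v + 1))"
      using pronic_int_nonneg[of u] pronic_int_nonneg[of v] by simp
    ultimately have "nat ((u + v + 1)^2 + (u - v)^2) = Suc (nat (2 * (u * (u + 1) + v * (v + 1))))" by simp
    thus ?thesis by (simp only: power_Suc)
  qed
  have ssq: "((\<lambda>(x, y). q ^ nat (x^2) * q ^ nat (y^2)) has_sum (theta3 (q^2)^2 + q * (2 * tri (q ^ 2)) ^ 2)) UNIV"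
  proof (rule has_sum_parity_split)
    show "((\<lambda>(u, v). case (u + v, u - v) of (x, y) \<Rightarrow> q ^ nat (x^2) * q ^ nat (y^2)) has_sum theta3 (q^2)^2) UNIV"
      using theta3_theta3_has_sum[OF q] by (simp add: cmb p0)
    show "((\<lambda>(u, v). case (u + v + 1, u - v) of (x, y) \<Rightarrow> q ^ nat (x^2) * q ^ nat (y^2)) has_sum q * (2 * tri (q ^ 2)) ^ 2) UNIV"
      using has_sum_cmult_right[OF tri_tri_has_sum[OF q], of q] by (simp add: cmb p1 case_prod_unfold)
  qed
  have e3: "theta3 q ^ 2 = theta3 (q^2)^2 + q * (2 * tri (q ^ 2)) ^ 2"
    using has_sum_unique[OF has_sum_product_complex[OF t3 t3] ssq] by (simp add: power2_eq_square)
  have s4: "((\<lambda>(x, y). s x * q ^ nat (x^2) * (s y * q ^ nat (y^2))) has_sum (theta3 (q^2)^2 + - (q * (2 * tri (q ^ 2)) ^ 2))) UNIV"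
  proof (rule has_sum_parity_split)
    have "s (u + v) * s (u - v) = 1" for u v by (auto simp: s_def)
    hence "(\<lambda>(u, v). case (u + v, u - v) of (x, y) \<Rightarrow> s x * q ^ nat (x^2) * (s y * q ^ nat (y^2))) =
      (\<lambda>(u, v). q ^ nat (2 * (u^2 + v^2)))"
    proof (intro ext, clarify)
      fix u v :: int
      have "s (u + v) * q ^ nat ((u + v)^2) * (s (u - v) * q ^ nat ((u - v)^2)) =
          (s (u + v) * s (u - v)) * (q ^ nat ((u + v)^2) * q ^ nat ((u - v)^2))" by (simp only: mult_ac)
      thus "s (u + v) * q ^ nat ((u + v)^2) * (s (u - v) * q ^ nat ((u - v)^2)) = q ^ nat (2 * (u^2 + v^2))"
        using \<open>\<And>u v. s (u + v) * s (u - v) = 1\<close> by (simp add: cmb p0)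
    qed
    thus "((\<lambda>(u, v). case (u + v, u - v) of (x, y) \<Rightarrow> s x * q ^ nat (x^2) * (s y * q ^ nat (y^2))) has_sum theta3 (q^2)^2) UNIV"
      using theta3_theta3_has_sum[OF q] by simp
    have "s (u + v + 1) * s (u - v) = -1" for u v by (auto simp: s_def)
    hence "(\<lambda>(u, v). case (u + v + 1, u - v) of (x, y) \<Rightarrow> s x * q ^ nat (x^2) * (s y * q ^ nat (y^2))) =
      (\<lambda>(u, v). - (q * q ^ nat (2 * (u * (u + 1) + v * (v + 1)))))"
    proof (intro ext, clarify)
      fix u v :: int
      have "s (u + v + 1) * q ^ nat ((u + v + 1)^2) * (s (u - v) * q ^ nat ((u - v)^2)) =
          (s (u + v + 1) * s (u - v)) * (q ^ nat ((u + v + 1)^2) * q ^ nat ((u - v)^2))" by (simp only: mult_ac)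
      thus "s (u + v + 1) * q ^ nat ((u + v + 1)^2) * (s (u - v) * q ^ nat ((u - v)^2)) =
          - (q * q ^ nat (2 * (u * (u + 1) + v * (v + 1))))"
        using \<open>\<And>u v. s (u + v + 1) * s (u - v) = - 1\<close> by (simp add: cmb p1)
    qed
    thus "((\<lambda>(u, v). case (u + v + 1, u - v) of (x, y) \<Rightarrow> s x * q ^ nat (x^2) * (s y * q ^ nat (y^2))) has_sum - (q * (2 * tri (q ^ 2)) ^ 2)) UNIV"
      using has_sum_cmult_right[OF tri_tri_has_sum[OF q], of "-q"] by (simp add: case_prod_unfold)
  qed
  have e4: "theta3 (- q) ^ 2 = theta3 (q^2)^2 - q * (2 * tri (q ^ 2)) ^ 2"
    using has_sum_unique[OF has_sum_product_complex[OF t4 t4] s4] by (simp add: power2_eq_square)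
  show "theta3 q ^ 2 + theta3 (- q) ^ 2 = 2 * theta3 (q ^ 2) ^ 2" using e3 e4 by simp
  show "theta3 q ^ 2 - theta3 (- q) ^ 2 = 8 * q * tri (q ^ 2) ^ 2" using e3 e4 by (simp add: power2_eq_square)
  show "theta3 q * theta3 (- q) = theta3 (- (q ^ 2)) ^ 2"
  proof -
    have m: "((\<lambda>(u, v). s u * (q^2) ^ nat (u^2) * (s v * (q^2) ^ nat (v^2))) has_sum theta3 (- (q ^ 2)) ^ 2) UNIV"
      using has_sum_product_complex[OF t4' t4']
      by (simp add: power2_eq_square)
    have *: "q ^ nat ((u + v)^2) * q ^ nat ((u - v)^2) = (q^2) ^ nat (u^2) * (q^2) ^ nat (v^2)" for u v
      by (simp add: cmb pow2nat p0 distrib_left)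
    have sp: "s (u - v) = s u * s v" for u v by (auto simp: s_def)
    have "((\<lambda>(x, y). q ^ nat (x^2) * (s y * q ^ nat (y^2))) has_sum (theta3 (- (q ^ 2)) ^ 2 + 0)) UNIV"
    proof (rule has_sum_parity_split)
      show "((\<lambda>(u, v). case (u + v, u - v) of (x, y) \<Rightarrow> q ^ nat (x^2) * (s y * q ^ nat (y^2))) has_sum theta3 (- (q ^ 2)) ^ 2) UNIV"
      proof -
        have "q ^ nat ((u + v)^2) * (s (u - v) * q ^ nat ((u - v)^2)) =
            s u * (q^2) ^ nat (u^2) * (s v * (q^2) ^ nat (v^2))" for u v
        proof -
          have "q ^ nat ((u + v)^2) * (s (u - v) * q ^ nat ((u - v)^2)) =
              s u * s v * (q ^ nat ((u + v)^2) * q ^ nat ((u - v)^2))" by (simp only: sp mult_ac)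
          also have "\<dots> = s u * s v * ((q^2) ^ nat (u^2) * (q^2) ^ nat (v^2))" by (simp only: *)
          finally show ?thesis by (simp only: mult_ac)
        qed
        thus ?thesis using m by (simp only: split)
      qed
      text \<open>The odd part is antisymmetric.\<close>
      define h where "h = (\<lambda>(u, v). case (u + v + 1, u - v) of (x, y) \<Rightarrow> q ^ nat (x^2) * (s y * q ^ nat (y^2)))"
      have hs: "h = (\<lambda>(u, v). (s u * (q * (q^2) ^ nat (u * (u + 1)))) * (s v * (q^2) ^ nat (v * (v + 1))))"
      proof (intro ext, clarify)
        fix u v :: int
        have "h (u, v) = s u * s v * (q ^ nat ((u + v + 1)^2) * q ^ nat ((u - v)^2))"
          by (simp add: h_def sp)
        also have "q ^ nat ((u + v + 1)^2) * q ^ nat ((u - v)^2) = q * q ^ nat (2 * (u * (u + 1) + v * (v + 1)))"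
          by (simp add: cmb p1)
        also have "q ^ nat (2 * (u * (u + 1) + v * (v + 1))) = (q^2) ^ nat (u * (u + 1)) * (q^2) ^ nat (v * (v + 1))"
          using pronic_int_nonneg[of u] pronic_int_nonneg[of v]
          by (simp only: pow2nat cmb distrib_left[of 2] mult_nonneg_nonneg zero_le_numeral)
        finally show "h (u, v) = (s u * (q * (q^2) ^ nat (u * (u + 1)))) * (s v * (q^2) ^ nat (v * (v + 1)))"
          by simp
      qed
      have "((\<lambda>v. s v * (q^2) ^ nat (v * (v + 1))) has_sum 0) UNIV"
      proof -
        define k where "k = (\<lambda>v. s v * (q^2) ^ nat (v * (v + 1)))"
        have "(\<lambda>v::int. norm ((q^2) ^ nat (v * (v + 1)))) summable_on UNIV"
          using tri_has_sum[OF q2] by (auto simp: summable_on_iff_abs_summable_on_complex[symmetric] summable_on_def)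
        moreover have "norm (k v) = norm ((q^2) ^ nat (v * (v + 1)))" for v
          by (simp add: k_def norm_mult s_def)
        ultimately have "(\<lambda>v. norm (k v)) summable_on UNIV" by simp
        then obtain c where c: "(k has_sum c) UNIV" using Infinite_Sum.abs_summable_summable[of k] by (auto simp: summable_on_def)
        have bij: "bij (\<lambda>v::int. - 1 - v)" by (rule bij_betwI[of _ _ _ "\<lambda>v. - 1 - v"]) auto
        have "(k has_sum c) UNIV \<longleftrightarrow> ((\<lambda>v. k (- 1 - v)) has_sum c) UNIV"
          using has_sum_reindex[of "\<lambda>v::int. - 1 - v" UNIV k c] bij
          by (simp add: bij_is_surj bij_is_inj o_def)
        moreover have "k (- 1 - v) = - k v" for v
          by (auto simp: k_def s_def algebra_simps)
        ultimately have "((\<lambda>v. - k v) has_sum c) UNIV" using c by simp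
        hence "((\<lambda>v. k v) has_sum - c) UNIV" by (simp add: has_sum_uminus)
        hence "c = - c" using c has_sum_unique by blast
        thus ?thesis using c unfolding k_def by simp
      qed
      moreover have "\<exists>c. ((\<lambda>u. s u * (q * (q^2) ^ nat (u * (u + 1)))) has_sum c) UNIV"
      proof -
        have "((\<lambda>u. s u * (q^2) ^ nat (u * (u + 1)) * q) has_sum 0 * q) UNIV"
          by (intro has_sum_cmult_left) fact
        thus ?thesis by (auto simp: mult_ac)
      qed
      ultimately have "(h has_sum 0) UNIV" unfolding hs using has_sum_product_complex by fastforce
      thus "((\<lambda>(u, v). case (u + v + 1, u - v) of (x, y) \<Rightarrow> q ^ nat (x^2) * (s y * q ^ nat (y^2))) has_sum 0) UNIV"
        by (simp add: h_def)
    qed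
    thus ?thesis using has_sum_unique[OF has_sum_product_complex[OF t3 t4]] by simp
  qed
  show "tri q ^ 2 = tri (q ^ 2) * theta3 (q ^ 2)"
  proof -
    have "((\<lambda>(x, y). q ^ nat (x * (x + 1)) * q ^ nat (y * (y + 1))) has_sum
        (2 * tri (q ^ 2) * theta3 (q ^ 2) + 2 * tri (q ^ 2) * theta3 (q ^ 2))) UNIV"
    proof (rule has_sum_parity_split)
      have a: "(u + v) * (u + v + 1) + (u - v) * (u - v + 1) = 2 * (u * (u + 1) + v^2)" for u v :: int
        by (simp add: power2_eq_square algebra_simps)
      show "((\<lambda>(u, v). case (u + v, u - v) of (x, y) \<Rightarrow> q ^ nat (x * (x + 1)) * q ^ nat (y * (y + 1))) has_sum
        2 * tri (q ^ 2) * theta3 (q ^ 2)) UNIV"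
        using tri_theta3_has_sum[OF q] by (simp only: split cmb[OF pronic_int_nonneg pronic_int_nonneg] a)
      have b: "(u + v + 1) * (u + v + 1 + 1) + (u - v) * (u - v + 1) = 2 * (v * (v + 1) + (u + 1)^2)" for u v :: int
        by (simp add: power2_eq_square algebra_simps)
      have bij: "bij (\<lambda>(u, v). (v - 1, u) :: int \<times> int)"
        by (rule bij_betwI[of _ _ _ "\<lambda>(u, v). (v, u + 1)"]) auto
      have "((\<lambda>(u, v). q ^ nat (2 * (v * (v + 1) + (u + 1)^2))) has_sum 2 * tri (q ^ 2) * theta3 (q ^ 2)) UNIV"
        using has_sum_reindex[of "\<lambda>(u, v). (v - 1, u) :: int \<times> int" UNIV
            "\<lambda>(u, v). q ^ nat (2 * (v * (v + 1) + (u + 1)^2))" "2 * tri (q ^ 2) * theta3 (q ^ 2)"]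
          bij tri_theta3_has_sum[OF q]
        by (simp add: bij_is_surj bij_is_inj o_def case_prod_unfold)
      thus "((\<lambda>(u, v). case (u + v + 1, u - v) of (x, y) \<Rightarrow> q ^ nat (x * (x + 1)) * q ^ nat (y * (y + 1))) has_sum
        2 * tri (q ^ 2) * theta3 (q ^ 2)) UNIV"
        by (simp only: split cmb[OF pronic_int_nonneg pronic_int_nonneg] b)
    qed
    hence "(2 * tri q) * (2 * tri q) = 2 * tri (q ^ 2) * theta3 (q ^ 2) + 2 * tri (q ^ 2) * theta3 (q ^ 2)"
      using has_sum_unique[OF has_sum_product_complex[OF tri_has_sum[OF q] tri_has_sum[OF q]]] by simp
    thus ?thesis by (simp add: power2_eq_square)
  qed
qed

section \<open>Jacobi's identity and the logarithmic derivative\<close>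

text \<open>
  The Eisenstein series of weight 2 with expansion \<open>q + 4 q^3 + 6 q^5 + \<dots>\<close>, that is
  \<open>\<Sum> \<sigma>(n) q^n\<close> over odd \<open>n\<close>; equivalently \<open>\<vartheta>_2^4 / 16\<close>.
\<close>

definition eis :: "complex \<Rightarrow> complex" where "eis q = q * tri q ^ 4"

lemma theta3_0 [simp]: "theta3 0 = 1" using theta3_tail[of 0] by simp
lemma tri_0 [simp]: "tri 0 = 1" using tri_tail[of 0] by simp

lemma theta4_holomorphic: "(\<lambda>q. theta3 (- q)) holomorphic_on ball 0 1"
proof -
  have "(theta3 \<circ> uminus) holomorphic_on ball 0 1"
    by (rule holomorphic_on_compose_gen[OF _ theta3_holomorphic]) (auto intro!: holomorphic_intros)
  thus ?thesis by (simp add: o_def)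
qed

lemma isCont_ball:
  "f holomorphic_on ball 0 1 \<Longrightarrow> norm q < 1 \<Longrightarrow> isCont f q" for f :: "complex \<Rightarrow> complex"
  by (metis continuous_on_eq_continuous_at holomorphic_on_imp_continuous_on mem_ball_0 open_ball)

lemma square_iterates_tendsto_0:
  fixes q :: complex assumes "norm q < 1" shows "(\<lambda>n. q ^ (2 ^ n)) \<longlonglongrightarrow> 0"
proof -
  have "strict_mono (\<lambda>n. 2 ^ n :: nat)" by (simp add: strict_mono_def)
  hence "((\<lambda>n. q ^ n) \<circ> (\<lambda>n. 2 ^ n)) \<longlonglongrightarrow> 0"
    by (intro LIMSEQ_subseq_LIMSEQ LIMSEQ_power_zero assms)
  thus ?thesis by (simp add: o_def)
qed

text \<open>
  Iterated squaring drives \<open>q\<close> to \<open>0\<close>, so by continuity a function invariant under it takes its value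
  at \<open>0\<close>. This replaces product expansions in what follows: it gives the absence of zeros and the value
  of the logarithmic derivative.
\<close>

lemma invariant_under_squaring_constant:
  fixes f :: "complex \<Rightarrow> complex"
  assumes "f holomorphic_on ball 0 1" "norm q < 1"
    and "\<And>q. norm q < 1 \<Longrightarrow> P q \<Longrightarrow> P (q ^ 2) \<and> f q = f (q ^ 2)" "P q"
  shows "f q = f 0"
proof -
  have n: "norm (q ^ (2 ^ n)) < 1" for n
    using assms(2) by (simp add: norm_power power_less_one_iff)
  have "P (q ^ (2 ^ n)) \<and> f (q ^ (2 ^ n)) = f q" for n
  proof (induction n)
    case (Suc n)
    have "q ^ (2 ^ Suc n) = (q ^ (2 ^ n)) ^ 2" by (simp add: power_mult[symmetric] mult.commute)
    thus ?case using assms(3)[OF n[of n]] Suc by simp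
  qed (use assms(4) in simp)
  hence "(\<lambda>n. f (q ^ (2 ^ n))) = (\<lambda>_. f q)" by auto
  moreover have "(\<lambda>n. f (q ^ (2 ^ n))) \<longlonglongrightarrow> f 0"
    using square_iterates_tendsto_0[OF assms(2)] isCont_ball[OF assms(1), of 0]
    by (intro isCont_tendsto_compose[of _ f]) auto
  ultimately show ?thesis using LIMSEQ_unique tendsto_const by metis
qed

text \<open>
  A zero \<open>q\<close> of \<open>theta3 (- q)\<close> is by \<open>theta3_mult\<close> followed by the zero \<open>q^2\<close>, and so on down to
  \<open>0\<close>, where the value is \<open>1\<close>. The same descent works for \<open>tri\<close>.
\<close>

lemma theta3_nonzero: assumes "norm q < 1" shows "theta3 q \<noteq> 0"
proof
  assume 0: "theta3 q = 0"
  have "theta3 (- (- q)) = theta3 (- 0)"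
    by (rule invariant_under_squaring_constant[where P = "\<lambda>q. theta3 (- q) = 0", OF theta4_holomorphic])
       (use theta3_mult assms 0 in force)+
  thus False using 0 by simp
qed

lemma tri_nonzero: assumes "norm q < 1" shows "tri q \<noteq> 0"
proof
  assume 0: "tri q = 0"
  have n: "norm (q ^ 2) < 1" if "norm q < 1" for q :: complex
    using that by (simp add: norm_power power_less_one_iff)
  have "tri q = tri 0"
    by (rule invariant_under_squaring_constant[where P = "\<lambda>q. tri q = 0", OF tri_holomorphic])
       (use tri_square theta3_nonzero assms 0 n in force)+
  thus False using 0 by simp
qed

lemma jacobi_quartic: assumes "norm q < 1" shows "theta3 q ^ 4 - theta3 (- q) ^ 4 = 16 * eis q"
proof -
  have "theta3 q ^ 4 - theta3 (- q) ^ 4 = (theta3 q ^ 2 - theta3 (- q) ^ 2) * (theta3 q ^ 2 + theta3 (- q) ^ 2)"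
    by (simp add: algebra_simps flip: power_add)
  also have "\<dots> = 16 * q * (tri (q ^ 2) * theta3 (q ^ 2)) ^ 2"
    by (simp only: theta3_diff_squares[OF assms] theta3_sum_squares[OF assms]) (simp add: power_mult_distrib)
  also have "tri (q ^ 2) * theta3 (q ^ 2) = tri q ^ 2" using tri_square[OF assms] by simp
  finally show ?thesis by (simp add: eis_def flip: power_mult)
qed

lemma theta3_deriv_0: "(theta3 has_field_derivative 2) (at 0)"
proof -
  have "((\<lambda>h. theta3 h / h - 1 / h - 2) \<longlongrightarrow> 0) (at 0)"
  proof (rule Lim_null_comparison)
    have "\<forall>\<^sub>F h in at (0::complex). h \<in> ball 0 1 - {0}" by (rule eventually_at_in_open) auto
    thus "\<forall>\<^sub>F h in at 0. norm (theta3 h / h - 1 / h - 2) \<le> 2 * norm h ^ 3 / (1 - norm h ^ 5)"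
    proof eventually_elim
      case (elim h)
      have "theta3 h / h - 1 / h - 2 = (theta3 h - 1 - 2 * h) / h" using elim by (simp add: field_simps)
      also have "norm \<dots> \<le> 2 * norm h ^ 4 / (1 - norm h ^ 5) / norm h"
        unfolding norm_divide using theta3_tail[of h] elim by (intro divide_right_mono) auto
      also have "\<dots> = 2 * norm h ^ 3 / (1 - norm h ^ 5)" using elim by (simp add: power_numeral_reduce)
      finally show ?case .
    qed
    have "((\<lambda>h::complex. 2 * norm h ^ 3 / (1 - norm h ^ 5)) \<longlongrightarrow> 2 * norm (0::complex) ^ 3 / (1 - norm (0::complex) ^ 5)) (at 0)"
      by (intro tendsto_intros) auto
    thus "((\<lambda>h::complex. 2 * norm h ^ 3 / (1 - norm h ^ 5)) \<longlongrightarrow> 0) (at 0)" by simp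
  qed
  hence "((\<lambda>h. (theta3 h - 1) / h) \<longlongrightarrow> 2) (at 0)"
    using Lim_null[of "\<lambda>h. (theta3 h - 1) / h" 2 "at 0"] by (simp add: diff_divide_distrib)
  thus ?thesis by (simp add: has_field_derivative_iff)
qed

lemma theta3_deriv: "norm q < 1 \<Longrightarrow> (theta3 has_field_derivative deriv theta3 q) (at q)"
  using holomorphic_derivI[OF theta3_holomorphic open_ball] by simp

lemma theta4_deriv: "norm q < 1 \<Longrightarrow> ((\<lambda>q. theta3 (- q)) has_field_derivative - deriv theta3 (- q)) (at q)"
  using DERIV_chain2[where f = theta3 and g = uminus and x = q and s = UNIV, OF theta3_deriv[of "- q"], of "-1"]
  by (simp add: DERIV_minus[OF DERIV_ident, simplified])

text \<open>
  Jacobi's derivative identity. Differentiating the duplication formulas shows that the quotient of both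
  sides is invariant under \<open>q \<mapsto> q^2\<close>, hence constant.
\<close>

theorem theta_log_derivative:
  assumes "norm q < 1"
  shows "deriv theta3 q / theta3 q + deriv theta3 (- q) / theta3 (- q) = 4 * tri q ^ 4"
proof -
  define W where "W = (\<lambda>q. deriv theta3 q / theta3 q + deriv theta3 (- q) / theta3 (- q))"
  define M where "M = (\<lambda>q. W q / tri q ^ 4)"
  have d3: "deriv theta3 holomorphic_on ball 0 1"
    by (rule holomorphic_deriv[OF theta3_holomorphic open_ball])
  have d4: "(\<lambda>q. deriv theta3 (- q)) holomorphic_on ball 0 1"
  proof -
    have "(deriv theta3 \<circ> uminus) holomorphic_on ball 0 1"
      by (rule holomorphic_on_compose_gen[OF _ d3]) (auto intro!: holomorphic_intros)
    thus ?thesis by (simp add: o_def)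
  qed
  have M: "M holomorphic_on ball 0 1" unfolding M_def W_def
    by (intro holomorphic_intros d3 d4 theta3_holomorphic theta4_holomorphic tri_holomorphic)
       (auto simp: theta3_nonzero tri_nonzero)
  have step: "M q = M (q ^ 2)" if q: "norm q < 1" "q \<noteq> 0" for q
  proof -
    have q2: "norm (q ^ 2) < 1" using q by (simp add: norm_power power_less_one_iff)
    have "((\<lambda>q. theta3 q ^ 2 + theta3 (- q) ^ 2) has_field_derivative
        2 * theta3 q * deriv theta3 q - 2 * theta3 (- q) * deriv theta3 (- q)) (at q)"
      by (auto intro!: derivative_eq_intros theta3_deriv theta4_deriv q simp: algebra_simps)
    moreover have c3: "((\<lambda>q. theta3 (q ^ 2)) has_field_derivative deriv theta3 (q ^ 2) * (2 * q)) (at q)"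
      by (rule DERIV_chain2[where g = "\<lambda>q. q ^ 2", OF theta3_deriv[OF q2]]) (auto intro!: derivative_eq_intros)
    hence "((\<lambda>q. 2 * theta3 (q ^ 2) ^ 2) has_field_derivative 8 * q * theta3 (q ^ 2) * deriv theta3 (q ^ 2)) (at q)"
      by (auto intro!: derivative_eq_intros simp: algebra_simps)
    hence "((\<lambda>q. theta3 q ^ 2 + theta3 (- q) ^ 2) has_field_derivative 8 * q * theta3 (q ^ 2) * deriv theta3 (q ^ 2)) (at q)"
      by (rule has_field_derivative_transform_within_open[OF _ open_ball[of 0 1]])
         (use q theta3_sum_squares in auto)
    ultimately have A: "2 * theta3 q * deriv theta3 q - 2 * theta3 (- q) * deriv theta3 (- q) =
        8 * q * theta3 (q ^ 2) * deriv theta3 (q ^ 2)" by (rule DERIV_unique)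
    have "((\<lambda>q. theta3 q * theta3 (- q)) has_field_derivative
        deriv theta3 q * theta3 (- q) - theta3 q * deriv theta3 (- q)) (at q)"
      by (auto intro!: derivative_eq_intros theta3_deriv theta4_deriv q simp: algebra_simps)
    moreover have "((\<lambda>q. theta3 (- (q ^ 2))) has_field_derivative (- deriv theta3 (- (q ^ 2))) * (2 * q)) (at q)"
      by (rule DERIV_chain2[where f = "\<lambda>q. theta3 (- q)" and g = "\<lambda>q. q ^ 2", OF theta4_deriv[OF q2]]) (auto intro!: derivative_eq_intros)
    hence "((\<lambda>q. theta3 (- (q ^ 2)) ^ 2) has_field_derivative - 4 * q * theta3 (- (q ^ 2)) * deriv theta3 (- (q ^ 2))) (at q)"
      by (auto intro!: derivative_eq_intros simp: algebra_simps)
    hence "((\<lambda>q. theta3 q * theta3 (- q)) has_field_derivative - 4 * q * theta3 (- (q ^ 2)) * deriv theta3 (- (q ^ 2))) (at q)"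
      by (rule has_field_derivative_transform_within_open[OF _ open_ball[of 0 1]])
         (use q theta3_mult in auto)
    ultimately have B: "deriv theta3 q * theta3 (- q) - theta3 q * deriv theta3 (- q) =
        - 4 * q * theta3 (- (q ^ 2)) * deriv theta3 (- (q ^ 2))" by (rule DERIV_unique)
    define a b x y A' B' where "a = theta3 q" and "b = theta3 (- q)" and "x = deriv theta3 q" and "y = deriv theta3 (- q)"
      and "A' = theta3 (q ^ 2)" and "B' = theta3 (- (q ^ 2))"
    define X' Y' where "X' = deriv theta3 (q ^ 2)" and "Y' = deriv theta3 (- (q ^ 2))"
    \<comment> \<open>These two relations come from differentiating \<open>theta3_sum_squares\<close> and \<open>theta3_mult\<close>; solved for
      \<open>X'\<close> and \<open>Y'\<close> they express the left-hand side at \<open>q^2\<close> through its value at \<open>q\<close>.\<close>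
    have A2: "a * x - b * y = 4 * q * A' * X'" and B2: "x * b - a * y = - 4 * q * B' * Y'"
    proof -
      have "2 * (a * x - b * y) = 2 * (4 * q * A' * X')"
        using A by (simp add: a_def b_def x_def y_def A'_def X'_def algebra_simps)
      thus "a * x - b * y = 4 * q * A' * X'" by (simp only: mult_cancel_left) simp
      show "x * b - a * y = - 4 * q * B' * Y'"
        using B by (simp add: a_def b_def x_def y_def B'_def Y'_def)
    qed
    have nz: "a \<noteq> 0" "b \<noteq> 0" "A' \<noteq> 0" "B' \<noteq> 0" using q q2 theta3_nonzero by (auto simp: a_def b_def A'_def B'_def)
    have e1: "a ^ 2 + b ^ 2 = 2 * A' ^ 2" and e2: "a * b = B' ^ 2" and e3: "a ^ 2 - b ^ 2 = 8 * q * tri (q ^ 2) ^ 2"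
      using theta3_sum_squares theta3_mult theta3_diff_squares q by (auto simp: a_def b_def A'_def B'_def)
    have "W (q ^ 2) = X' / A' + Y' / B'" by (simp add: W_def A'_def B'_def X'_def Y'_def)
    also have "X' / A' = (a * x - b * y) / (4 * q * A' ^ 2)"
      using nz q unfolding A2 by (simp add: field_simps power2_eq_square)
    also have "Y' / B' = - (x * b - a * y) / (4 * q * B' ^ 2)"
      using nz q unfolding B2 by (simp add: field_simps power2_eq_square)
    also have "(a * x - b * y) / (4 * q * A' ^ 2) + - (x * b - a * y) / (4 * q * B' ^ 2)
        = (x / a + y / b) * (a ^ 2 - b ^ 2) / (8 * q * A' ^ 2)"
    proof -
      have E: "4 * q * A' ^ 2 = 2 * q * (a ^ 2 + b ^ 2)" "8 * q * A' ^ 2 = 4 * q * (a ^ 2 + b ^ 2)"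
        using e1 by simp_all
      have n1: "a ^ 2 + b ^ 2 \<noteq> 0" using e1 nz by simp
      have "a * (a * 2) + b * (b * 2) = 2 * (a ^ 2 + b ^ 2)" by (simp add: power2_eq_square algebra_simps)
      hence "a * (a * 2) + b * (b * 2) \<noteq> 0" using n1 by (metis mult_eq_0_iff zero_neq_numeral)
      thus ?thesis using nz q n1 unfolding e2[symmetric] E
        by (simp add: divide_simps) (simp add: algebra_simps power2_eq_square)
    qed
    also have "\<dots> = W q * tri (q ^ 2) ^ 2 / A' ^ 2"
      unfolding e3 using q by (simp add: W_def a_def b_def x_def y_def)
    finally have W2: "W (q ^ 2) = W q * tri (q ^ 2) ^ 2 / A' ^ 2" .
    have "tri q ^ 4 = (tri q ^ 2) ^ 2" by (simp flip: power_mult)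
    also have "\<dots> = tri (q ^ 2) ^ 2 * A' ^ 2" using tri_square[OF q(1)] by (simp add: A'_def power_mult_distrib)
    finally have t4: "tri q ^ 4 = tri (q ^ 2) ^ 2 * A' ^ 2" .
    show ?thesis unfolding M_def W2 t4 using nz tri_nonzero[OF q2]
      by (simp add: field_simps flip: power_add)
  qed
  have "M q = M 0"
  proof (cases "q = 0")
    case False
    show ?thesis
      by (rule invariant_under_squaring_constant[where P = "\<lambda>q. q \<noteq> 0", OF M assms])
         (use step False in auto)
  qed simp
  also have "M 0 = 4" using DERIV_imp_deriv[OF theta3_deriv_0] by (simp add: M_def W_def)
  finally show ?thesis using tri_nonzero[OF assms] by (simp add: M_def W_def field_simps)
qed

section \<open>Real nomes and the arithmetic-geometric mean\<close>

text \<open>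
  Comparison of the sum of a decreasing function with its integral. It pins down \<open>theta3\<close> at real nomes
  near \<open>1\<close> up to a bounded error, which is all that the inversion formula below needs.
\<close>

lemma gaussian_sum_bounds:
  fixes s :: real assumes s: "0 < s"
  defines "g \<equiv> \<lambda>x. exp (- pi * s * x ^ 2)"
  assumes sm: "summable (\<lambda>n. g (real (n + 1)))"
  shows "(\<Sum>n. g (real (n + 1))) \<le> 1 / (2 * sqrt s)" "1 / (2 * sqrt s) \<le> 1 + (\<Sum>n. g (real (n + 1)))"
proof -
  define c where "c = sqrt (pi * s)"
  have c: "c > 0" "c ^ 2 = pi * s" using s by (auto simp: c_def)
  have "has_bochner_integral lborel (\<lambda>x. indicator {0..} (0 + c * x) *\<^sub>R exp (- (0 + c * x)\<^sup>2)) ((sqrt pi / 2) /\<^sub>R \<bar>c\<bar>)"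
    using c by (intro lborel_has_bochner_integral_real_affine_iff[THEN iffD1, OF _ gaussian_moment_0]) simp
  moreover have "indicator {0..} (0 + c * x) *\<^sub>R exp (- (0 + c * x)\<^sup>2) = g x * indicator {0..} x" for x :: real
    using c by (auto simp: g_def power_mult_distrib indicator_def zero_le_mult_iff)
  moreover have "(sqrt pi / 2) /\<^sub>R \<bar>c\<bar> = 1 / (2 * sqrt s)"
    using s by (simp add: c_def real_sqrt_mult field_simps)
  ultimately have hb: "has_bochner_integral lborel (\<lambda>x. g x * indicator {0..} x) (1 / (2 * sqrt s))" by (simp add: mult.commute)
  have I: "(\<integral>\<^sup>+x. ennreal (g x * indicator {0..} x) \<partial>lborel) = ennreal (1 / (2 * sqrt s))"
    using hb by (subst nn_integral_eq_integral) (auto simp: has_bochner_integral_iff g_def)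
  have g0: "0 \<le> g x" for x by (simp add: g_def)
  have anti: "g y \<le> g x" if "0 \<le> x" "x \<le> y" for x y
    using that s by (auto simp: g_def intro!: mult_left_mono power_mono)
  have dj: "disjoint_family (\<lambda>n::nat. {real n..<real n + 1})"
  proof (unfold disjoint_family_on_def, intro ballI impI, rule ccontr)
    fix m n :: nat assume "m \<noteq> n" "{real m..<real m + 1} \<inter> {real n..<real n + 1} \<noteq> {}"
    then obtain x where "real m \<le> x" "x < real m + 1" "real n \<le> x" "x < real n + 1" by auto
    hence "real m < real (n + 1)" "real n < real (m + 1)" by simp_all
    thus False using \<open>m \<noteq> n\<close> unfolding of_nat_less_iff by simp
  qed
  have st: "(\<Sum>n. ennreal (h n) * indicator {real n..<real n + 1} x) = ennreal (h (nat \<lfloor>x\<rfloor>))"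
    if "0 \<le> x" for h :: "nat \<Rightarrow> real" and x
    using that floor_correct[of x] by (intro suminf_cmult_indicator[OF dj]) (simp_all add: of_nat_nat)
  have st0: "(\<Sum>n. ennreal (h n) * indicator {real n..<real n + 1} x) = 0"
    if "x < 0" for h :: "nat \<Rightarrow> real" and x
  proof -
    have "indicator {real n..<real n + 1} x = (0::ennreal)" for n using that by (auto simp: indicator_def)
    thus ?thesis by simp
  qed
  have int: "(\<integral>\<^sup>+x. (\<Sum>n. ennreal (h n) * indicator {real n..<real n + 1} x) \<partial>lborel) = (\<Sum>n. ennreal (h n))"
    for h :: "nat \<Rightarrow> real"
    by (subst nn_integral_suminf) (auto simp: nn_integral_cmult_indicator)
  have s0: "summable (\<lambda>n. g (real n))" using sm summable_Suc_iff[of "\<lambda>n. g (real n)"] by simp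
  have "(\<Sum>n. ennreal (g (real (n + 1)))) \<le> (\<integral>\<^sup>+x. ennreal (g x * indicator {0..} x) \<partial>lborel)"
    unfolding int[symmetric]
  proof (rule nn_integral_mono)
    fix x :: real
    show "(\<Sum>n. ennreal (g (real (n + 1))) * indicator {real n..<real n + 1} x) \<le> ennreal (g x * indicator {0..} x)"
    proof (cases "x < 0")
      case False
      have "g (real (nat \<lfloor>x\<rfloor> + 1)) \<le> g x" using False by (intro anti) linarith+
      thus ?thesis using st[of x "\<lambda>n. g (real (n + 1))"] False by (auto simp: ennreal_leI)
    qed (simp add: st0)
  qed
  hence "ennreal (\<Sum>n. g (real (n + 1))) \<le> ennreal (1 / (2 * sqrt s))"
    unfolding I by (subst (asm) suminf_ennreal2) (use sm g0 in auto)
  thus "(\<Sum>n. g (real (n + 1))) \<le> 1 / (2 * sqrt s)" using s by (subst (asm) ennreal_le_iff) auto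
  have "(\<integral>\<^sup>+x. ennreal (g x * indicator {0..} x) \<partial>lborel) \<le> (\<Sum>n. ennreal (g (real n)))"
    unfolding int[symmetric]
  proof (rule nn_integral_mono)
    fix x :: real
    show "ennreal (g x * indicator {0..} x) \<le> (\<Sum>n. ennreal (g (real n)) * indicator {real n..<real n + 1} x)"
    proof (cases "x < 0")
      case False
      have "g x \<le> g (real (nat \<lfloor>x\<rfloor>))" using False by (intro anti) linarith+
      thus ?thesis using st[of x "\<lambda>n. g (real n)"] False by (auto simp: ennreal_leI)
    qed simp
  qed
  hence "ennreal (1 / (2 * sqrt s)) \<le> ennreal (\<Sum>n. g (real n))"
    unfolding I by (subst (asm) suminf_ennreal2) (use s0 g0 in auto)
  hence "1 / (2 * sqrt s) \<le> (\<Sum>n. g (real n))" using suminf_nonneg[OF s0 g0] by (subst (asm) ennreal_le_iff) auto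
  also have "(\<Sum>n. g (real n)) = 1 + (\<Sum>n. g (real (n + 1)))"
    using suminf_split_head[OF s0] by (simp add: g_def)
  finally show "1 / (2 * sqrt s) \<le> 1 + (\<Sum>n. g (real (n + 1)))" .
qed

text \<open>
  On the imaginary axis everything is real. \<open>R3\<close> and \<open>R4\<close> are \<open>\<vartheta>_3\<close> and \<open>\<vartheta>_4\<close> at the nome
  \<open>exp (- \<pi> t)\<close>, while \<open>R2\<close> is the square of \<open>\<vartheta>_2\<close> there; the square is what the duplication formulas
  involve.
\<close>

definition nome :: "real \<Rightarrow> complex" where "nome t = complex_of_real (exp (- pi * t))"

definition R3 :: "real \<Rightarrow> real" where "R3 t = Re (theta3 (nome t))"
definition R4 :: "real \<Rightarrow> real" where "R4 t = Re (theta3 (- nome t))"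
definition Tr :: "real \<Rightarrow> real" where "Tr t = Re (tri (nome t))"
definition R2 :: "real \<Rightarrow> real" where "R2 t = 4 * exp (- pi * t / 2) * Tr t ^ 2"

lemma norm_nome: "t > 0 \<Longrightarrow> norm (nome t) < 1" by (simp add: nome_def)

lemma nome_double: "nome (2 * t) = nome t ^ 2"
  by (simp add: nome_def exp_double[symmetric] mult_ac flip: of_real_power exp_of_nat_mult)

lemma cnj_fixed_of_real: "cnj z = z \<Longrightarrow> z = of_real (Re z)"
  by (simp add: complex_eq_iff)

lemma theta_nome:
  assumes "t > 0"
  shows "theta3 (nome t) = of_real (R3 t)" "theta3 (- nome t) = of_real (R4 t)" "tri (nome t) = of_real (Tr t)"
  unfolding R3_def R4_def Tr_def
  using theta3_cnj[of "nome t"] theta3_cnj[of "- nome t"] tri_cnj[of "nome t"] norm_nome[OF assms]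
  by (intro cnj_fixed_of_real; simp add: nome_def)+

lemma R_double:
  assumes t: "t > 0"
  shows "R3 t ^ 2 + R4 t ^ 2 = 2 * R3 (2 * t) ^ 2" "R3 t * R4 t = R4 (2 * t) ^ 2"
    "R3 t ^ 2 - R4 t ^ 2 = 2 * R2 (2 * t)" "Tr t ^ 2 = Tr (2 * t) * R3 (2 * t)" "R3 t ^ 4 - R4 t ^ 4 = R2 t ^ 2"
proof -
  note n = norm_nome[OF t] and th = theta_nome[OF t] theta_nome[of "2 * t", simplified nome_double]
  have c: "(x::real) = y" if "complex_of_real x = of_real y" for x y using that by simp
  show "R3 t ^ 2 + R4 t ^ 2 = 2 * R3 (2 * t) ^ 2"
    using theta3_sum_squares[OF n] t by (intro c) (simp add: th)
  show "R3 t * R4 t = R4 (2 * t) ^ 2"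
    using theta3_mult[OF n] t by (intro c) (simp add: th)
  show "R3 t ^ 2 - R4 t ^ 2 = 2 * R2 (2 * t)"
  proof -
    have "complex_of_real (R2 (2 * t)) = 4 * nome t * of_real (Tr (2 * t)) ^ 2"
      by (simp add: R2_def nome_def)
    thus ?thesis using theta3_diff_squares[OF n] t by (intro c) (simp add: th)
  qed
  show "Tr t ^ 2 = Tr (2 * t) * R3 (2 * t)"
    using tri_square[OF n] t by (intro c) (simp add: th)
  have "exp (- pi * t / 2) ^ 2 = exp (- pi * t)" by (simp flip: exp_double)
  hence "R2 t ^ 2 = 16 * exp (- pi * t) * Tr t ^ 4"
    by (simp add: R2_def power_mult_distrib flip: power_mult)
  hence "complex_of_real (R2 t) ^ 2 = 16 * nome t * of_real (Tr t) ^ 4"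
    unfolding nome_def by (metis of_real_mult of_real_numeral of_real_power)
  thus "R3 t ^ 4 - R4 t ^ 4 = R2 t ^ 2"
    using jacobi_quartic[OF n] t by (intro c) (simp add: th eis_def)
qed

lemma R3_eq: "t > 0 \<Longrightarrow> R3 t = 1 + 2 * (\<Sum>n. exp (- pi * t * real (n + 1) ^ 2))"
  and R3_summable: "t > 0 \<Longrightarrow> summable (\<lambda>n. exp (- pi * t * real (n + 1) ^ 2))"
proof -
  assume t: "t > 0"
  have e: "exp (- pi * t) ^ ((n + 1) ^ 2) = exp (- pi * t * real (n + 1) ^ 2)" for n
    by (simp add: mult_ac flip: exp_of_nat_mult)
  have s: "summable (\<lambda>n. norm (exp (- pi * t) ^ ((n + 1) ^ 2)))" by (rule theta3_summable) (use t in simp)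
  thus s2: "summable (\<lambda>n. exp (- pi * t * real (n + 1) ^ 2))" by (simp only: e real_norm_def abs_exp_cancel)
  have "(\<lambda>n. complex_of_real (exp (- pi * t * real (n + 1) ^ 2))) sums of_real (\<Sum>n. exp (- pi * t * real (n + 1) ^ 2))"
    using s2 by (intro sums_of_real summable_sums)
  hence "theta3 (nome t) = of_real (1 + 2 * (\<Sum>n. exp (- pi * t * real (n + 1) ^ 2)))"
    unfolding theta3_def nome_def of_real_power[symmetric] e by (simp add: sums_iff)
  thus "R3 t = 1 + 2 * (\<Sum>n. exp (- pi * t * real (n + 1) ^ 2))" by (simp only: R3_def Re_complex_of_real)
qed

lemma R3_ge_1: "t > 0 \<Longrightarrow> R3 t \<ge> 1"
  using R3_eq[of t] suminf_nonneg[OF R3_summable[of t]] by simp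

lemma R4_pos: "t > 0 \<Longrightarrow> R4 t > 0"
proof -
  assume t: "t > 0"
  have nz: "R4 t \<noteq> 0" if "t > 0" for t using theta3_nonzero[of "- nome t"] theta_nome[OF that] norm_nome[OF that] by auto
  have "R3 t * R4 t > 0" unfolding R_double(2)[OF t] using nz[of "2 * t"] t by simp
  thus ?thesis using R3_ge_1[OF t] by (simp add: zero_less_mult_iff)
qed

lemma Tr_pos: "t > 0 \<Longrightarrow> Tr t > 0"
proof -
  assume t: "t > 0"
  have nz: "Tr t \<noteq> 0" if "t > 0" for t using tri_nonzero[of "nome t"] theta_nome[OF that] norm_nome[OF that] by auto
  have "Tr (2 * (t / 2)) * R3 (2 * (t / 2)) > 0" unfolding R_double(4)[of "t / 2", symmetric, OF half_gt_zero[OF t]]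
    using nz[of "t / 2"] t by simp
  thus ?thesis using R3_ge_1[OF t] by (simp add: zero_less_mult_iff)
qed

lemma R2_pos: "t > 0 \<Longrightarrow> R2 t > 0" using Tr_pos[of t] by (simp add: R2_def)

fun agm :: "nat \<Rightarrow> real \<Rightarrow> real \<Rightarrow> real" where
  "agm 0 a b = a"
| "agm (Suc n) a b = agm n ((a + b) / 2) (sqrt (a * b))"

lemma agm_scale: "c \<ge> 0 \<Longrightarrow> agm n (c * a) (c * b) = c * agm n a b"
proof (induction n arbitrary: a b)
  case (Suc n)
  have "sqrt (c * a * (c * b)) = c * sqrt (a * b)"
    using Suc.prems by (simp add: real_sqrt_mult mult_ac flip: real_sqrt_mult_self)
       (metis abs_of_nonneg mult.assoc real_sqrt_abs2 real_sqrt_mult)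
  moreover have "(c * a + c * b) / 2 = c * ((a + b) / 2)" by (simp add: algebra_simps)
  ultimately show ?case using Suc by (simp only: agm.simps)
qed simp

lemma agm_mono: "0 \<le> a \<Longrightarrow> a \<le> a' \<Longrightarrow> 0 \<le> b \<Longrightarrow> b \<le> b' \<Longrightarrow> agm n a b \<le> agm n a' b'"
proof (induction n arbitrary: a b a' b')
  case (Suc n)
  show ?case unfolding agm.simps using Suc.prems by (intro Suc.IH) (auto intro!: mult_mono)
qed simp

text \<open>
  Plain monotonicity of the iterates gives only a weak inequality between the limits. One step of the
  mean makes both entries smaller by a fixed factor \<open>r < 1\<close>, and homogeneity carries the factor through
  to the limit.
\<close>

lemma agm_limit_strict_mono:
  assumes b: "0 < b" "b < b'" and L: "(\<lambda>n. agm n 1 b) \<longlonglongrightarrow> L" "(\<lambda>n. agm n 1 b') \<longlonglongrightarrow> L'" "L' > 0"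
  shows "L < L'"
proof -
  define r where "r = max ((1 + b) / (1 + b')) (sqrt b / sqrt b')"
  have r: "0 < r" "r < 1" using b by (auto simp: r_def less_max_iff_disj)
  have "(1 + b) / 2 \<le> r * ((1 + b') / 2)"
  proof -
    have "(1 + b) / (1 + b') \<le> r" by (simp add: r_def)
    thus ?thesis using b by (simp add: field_simps)
  qed
  moreover have "sqrt b \<le> r * sqrt b'"
  proof -
    have "sqrt b / sqrt b' \<le> r" by (simp add: r_def)
    thus ?thesis using b by (simp add: field_simps)
  qed
  ultimately have "agm (Suc n) 1 b \<le> r * agm (Suc n) 1 b'" for n
    using b r by (simp add: agm_scale[symmetric]) (intro agm_mono, auto)
  moreover have "(\<lambda>n. agm (Suc n) 1 b) \<longlonglongrightarrow> L" "(\<lambda>n. r * agm (Suc n) 1 b') \<longlonglongrightarrow> r * L'"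
    using L by (auto intro!: tendsto_mult_left LIMSEQ_Suc[where f = "\<lambda>n. agm n _ _"] simp del: agm.simps)
  ultimately have "L \<le> r * L'" by (intro LIMSEQ_le) auto
  also have "\<dots> < L'" using r L by simp
  finally show ?thesis .
qed

text \<open>
  The mean of \<open>R3^2\<close> and \<open>R4^2\<close> moves \<open>t\<close> to \<open>2 t\<close>, that of \<open>R3^2\<close> and \<open>R2\<close> moves it to \<open>t / 2\<close>.
  The two limits are therefore governed by \<open>t \<rightarrow> \<infinity>\<close>, where \<open>R3\<close> tends to \<open>1\<close>, and by \<open>t \<rightarrow> 0\<close>, where the
  Gaussian integral gives the size of \<open>R3\<close>.
\<close>

lemma agm_R3_R4: "t > 0 \<Longrightarrow> agm n (R3 t ^ 2) (R4 t ^ 2) = R3 (2 ^ n * t) ^ 2"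
proof (induction n arbitrary: t)
  case (Suc n)
  have "sqrt (R3 t ^ 2 * R4 t ^ 2) = R4 (2 * t) ^ 2"
    using R_double(2)[OF Suc.prems] R3_ge_1[OF Suc.prems] R4_pos[OF Suc.prems]
    by (simp add: real_sqrt_mult)
  thus ?case using R_double(1)[OF Suc.prems] Suc.IH[of "2 * t"] Suc.prems by (simp add: mult_ac)
qed simp

lemma agm_R3_R2: "t > 0 \<Longrightarrow> agm n (R3 t ^ 2) (R2 t) = R3 (t / 2 ^ n) ^ 2 / 2 ^ n"
proof (induction n arbitrary: t)
  case (Suc n)
  have t2: "t / 2 > 0" using Suc.prems by simp
  have a: "R3 t ^ 2 + R2 t = R3 (t / 2) ^ 2"
    using R_double(1,3)[OF t2] by simp
  have "R2 (t / 2) = 4 * exp (- pi * t / 4) * (Tr t * R3 t)"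
    using R_double(4)[OF t2] by (simp add: R2_def)
  moreover have "sqrt (R3 t ^ 2 * R2 t) = R3 t * (2 * exp (- pi * t / 4) * Tr t)"
  proof (rule real_sqrt_unique)
    have "exp (- pi * t / 2) = exp (- pi * t / 4) ^ 2" by (simp flip: exp_double)
    thus "(R3 t * (2 * exp (- pi * t / 4) * Tr t)) ^ 2 = R3 t ^ 2 * R2 t"
      by (simp add: R2_def power_mult_distrib)
    show "0 \<le> R3 t * (2 * exp (- pi * t / 4) * Tr t)"
      using R3_ge_1[OF Suc.prems] Tr_pos[OF Suc.prems] by simp
  qed
  ultimately have b: "sqrt (R3 t ^ 2 * R2 t) = R2 (t / 2) / 2" by simp
  have "agm (Suc n) (R3 t ^ 2) (R2 t) = agm n (1 / 2 * R3 (t / 2) ^ 2) (1 / 2 * R2 (t / 2))"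
    unfolding agm.simps a b by simp
  also have "\<dots> = 1 / 2 * (R3 (t / 2 / 2 ^ n) ^ 2 / 2 ^ n)"
    using Suc.IH[OF t2] by (subst agm_scale) auto
  finally show ?case by (simp add: mult_ac)
qed simp

lemma R3_tendsto_1: assumes "t > 0" shows "(\<lambda>n. R3 (2 ^ n * t)) \<longlonglongrightarrow> 1"
proof -
  have "nome (2 ^ n * t) = nome t ^ (2 ^ n)" for n
    by (simp add: nome_def mult_ac flip: of_real_power exp_of_nat_mult)
  moreover have "(\<lambda>n. theta3 (nome t ^ (2 ^ n))) \<longlonglongrightarrow> theta3 0"
    using square_iterates_tendsto_0[OF norm_nome[OF assms]] isCont_ball[OF theta3_holomorphic, of 0]
    by (intro isCont_tendsto_compose[of _ theta3]) auto
  ultimately show ?thesis unfolding R3_def using tendsto_Re by fastforce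
qed

lemma R3_asymptotic_0: assumes "t > 0" shows "(\<lambda>n. R3 (t / 2 ^ n) ^ 2 / 2 ^ n) \<longlonglongrightarrow> 1 / t"
proof -
  have b: "\<bar>sqrt s * R3 s - 1\<bar> \<le> sqrt s" if s: "s > 0" for s
  proof -
    have "R3 s \<le> 1 + 1 / sqrt s" "1 / sqrt s - 1 \<le> R3 s"
      using gaussian_sum_bounds[OF s R3_summable[OF s]] R3_eq[OF s] by (auto simp: field_simps)
    hence "sqrt s * R3 s \<le> sqrt s * (1 + 1 / sqrt s)" "sqrt s * (1 / sqrt s - 1) \<le> sqrt s * R3 s"
      using s by (auto intro!: mult_left_mono)
    thus ?thesis using s by (simp add: algebra_simps abs_le_iff)
  qed
  have z: "(\<lambda>n. sqrt (t / 2 ^ n)) \<longlonglongrightarrow> 0"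
  proof -
    have "(\<lambda>n. sqrt (t * (1 / 2) ^ n)) \<longlonglongrightarrow> sqrt (t * 0)"
      by (intro tendsto_intros LIMSEQ_power_zero) auto
    thus ?thesis by (simp add: power_one_over)
  qed
  have "(\<lambda>n. sqrt (t / 2 ^ n) * R3 (t / 2 ^ n) - 1) \<longlonglongrightarrow> 0"
    by (rule Lim_null_comparison[OF _ z]) (use b assms in auto)
  hence "(\<lambda>n. sqrt (t / 2 ^ n) * R3 (t / 2 ^ n)) \<longlonglongrightarrow> 1" by (simp add: LIM_zero_iff)
  hence "(\<lambda>n. (sqrt (t / 2 ^ n) * R3 (t / 2 ^ n)) ^ 2 / t) \<longlonglongrightarrow> 1 ^ 2 / t"
    by (intro tendsto_intros) (use assms in auto)
  moreover have "(sqrt (t / 2 ^ n) * R3 (t / 2 ^ n)) ^ 2 / t = R3 (t / 2 ^ n) ^ 2 / 2 ^ n" for n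
    using assms by (simp add: power_mult_distrib)
  ultimately show ?thesis by simp
qed

lemma agm_limit_R4: assumes t: "t > 0" shows "(\<lambda>n. agm n 1 (R4 t ^ 2 / R3 t ^ 2)) \<longlonglongrightarrow> 1 / R3 t ^ 2"
proof -
  have "R3 t \<noteq> 0" using R3_ge_1[OF t] by simp
  hence "agm n 1 (R4 t ^ 2 / R3 t ^ 2) = (1 / R3 t ^ 2) * R3 (2 ^ n * t) ^ 2" for n
    using agm_scale[of "1 / R3 t ^ 2" n "R3 t ^ 2" "R4 t ^ 2"] agm_R3_R4[OF t] by simp
  moreover have "(\<lambda>n. (1 / R3 t ^ 2) * R3 (2 ^ n * t) ^ 2) \<longlonglongrightarrow> (1 / R3 t ^ 2) * 1 ^ 2"
    by (intro tendsto_intros R3_tendsto_1 t)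
  ultimately show ?thesis by simp
qed

lemma agm_limit_R2: assumes t: "t > 0" shows "(\<lambda>n. agm n 1 (R2 t / R3 t ^ 2)) \<longlonglongrightarrow> 1 / (t * R3 t ^ 2)"
proof -
  have "R3 t \<noteq> 0" using R3_ge_1[OF t] by simp
  hence "agm n 1 (R2 t / R3 t ^ 2) = (1 / R3 t ^ 2) * (R3 (t / 2 ^ n) ^ 2 / 2 ^ n)" for n
    using agm_scale[of "1 / R3 t ^ 2" n "R3 t ^ 2" "R2 t"] agm_R3_R2[OF t] by simp
  moreover have "(\<lambda>n. (1 / R3 t ^ 2) * (R3 (t / 2 ^ n) ^ 2 / 2 ^ n)) \<longlonglongrightarrow> (1 / R3 t ^ 2) * (1 / t)"
    by (intro tendsto_intros R3_asymptotic_0 t)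
  ultimately show ?thesis by (simp add: mult.commute)
qed

text \<open>
  Let \<open>k\<close> and \<open>p\<close> be the modulus \<open>R2 / R3^2\<close> and its complement \<open>R4^2 / R3^2\<close>, so that
  \<open>k^2 + p^2 = 1\<close>. The mean of \<open>1\<close> and \<open>p\<close> is \<open>1 / R3^2\<close> and that of \<open>1\<close> and \<open>k\<close> is
  \<open>1 / (t R3^2)\<close>. If \<open>k (1 / t) < p t\<close>, then also \<open>k t < p (1 / t)\<close>, and strict monotonicity of the
  mean gives two inequalities between \<open>R3 (1 / t)^2\<close> and \<open>t R3 t^2\<close> that contradict each other. The
  opposite inequality is excluded in the same way, and equality of the moduli gives the formulas.
\<close>

theorem
  assumes t: "t > 0"
  shows R3_inversion: "R3 (1 / t) ^ 2 = t * R3 t ^ 2" and R2_inversion: "R2 (1 / t) = t * R4 t ^ 2"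
proof -
  define p k where "p = (\<lambda>t. R4 t ^ 2 / R3 t ^ 2)" and "k = (\<lambda>t. R2 t / R3 t ^ 2)"
  have pos: "p t > 0" "k t > 0" "0 < R3 t" if "t > 0" for t
    using R3_ge_1[OF that] R4_pos[OF that] R2_pos[OF that] by (auto simp: p_def k_def)
  have pk: "p t ^ 2 + k t ^ 2 = 1" if "t > 0" for t
  proof -
    have "p t ^ 2 + k t ^ 2 = (R4 t ^ 4 + R2 t ^ 2) / R3 t ^ 4"
      by (simp add: p_def k_def power_divide add_divide_distrib flip: power_mult)
    thus ?thesis using R_double(5)[OF that] R3_ge_1[OF that] by simp
  qed
  have Lp: "(\<lambda>n. agm n 1 (p t)) \<longlonglongrightarrow> 1 / R3 t ^ 2" if "t > 0" for t
    using agm_limit_R4[OF that] by (simp add: p_def)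
  have Lk: "(\<lambda>n. agm n 1 (k t)) \<longlonglongrightarrow> 1 / (t * R3 t ^ 2)" if "t > 0" for t
    using agm_limit_R2[OF that] by (simp add: k_def)
  have t': "1 / t > 0" using t by simp
  have opp: "p (1 / t) > k t" if "k (1 / t) < p t"
  proof -
    have "k (1 / t) ^ 2 < p t ^ 2" using that pos[OF t'] by (intro power_strict_mono) auto
    hence "k t ^ 2 < p (1 / t) ^ 2" using pk[OF t] pk[OF t'] by linarith
    thus ?thesis using pos[OF t'] by (intro power2_less_imp_less[of "k t"]) auto
  qed
  have opp': "p (1 / t) < k t" if "p t < k (1 / t)"
  proof -
    have "p t ^ 2 < k (1 / t) ^ 2" using that pos[OF t] by (intro power_strict_mono) auto
    hence "p (1 / t) ^ 2 < k t ^ 2" using pk[OF t] pk[OF t'] by linarith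
    thus ?thesis using pos[OF t] by (intro power2_less_imp_less[of "p (1 / t)"]) auto
  qed
  have ne: "R3 t \<noteq> 0" "R3 (1 / t) \<noteq> 0" using pos(3)[OF t] pos(3)[OF t'] by simp_all
  note P = pos(1)[OF t] pos(1)[OF t'] pos(2)[OF t] pos(2)[OF t'] ne t
  have c1: "\<not> k (1 / t) < p t"
  proof
    assume a: "k (1 / t) < p t"
    have "1 / (1 / t * R3 (1 / t) ^ 2) < 1 / R3 t ^ 2"
      by (rule agm_limit_strict_mono[OF _ a Lk[OF t'] Lp[OF t]]) (use P in simp_all)
    moreover have "1 / (t * R3 t ^ 2) < 1 / R3 (1 / t) ^ 2"
      by (rule agm_limit_strict_mono[OF _ opp[OF a] Lk[OF t] Lp[OF t']]) (use P in simp_all)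
    ultimately show False using ne t by (simp add: field_simps)
  qed
  have c2: "\<not> p t < k (1 / t)"
  proof
    assume a: "p t < k (1 / t)"
    have "1 / R3 t ^ 2 < 1 / (1 / t * R3 (1 / t) ^ 2)"
      by (rule agm_limit_strict_mono[OF _ a Lp[OF t] Lk[OF t']]) (use P in simp_all)
    moreover have "1 / R3 (1 / t) ^ 2 < 1 / (t * R3 t ^ 2)"
      by (rule agm_limit_strict_mono[OF _ opp'[OF a] Lp[OF t'] Lk[OF t]]) (use P in simp_all)
    ultimately show False using ne t by (simp add: field_simps)
  qed
  have e: "k (1 / t) = p t" using c1 c2 by linarith
  have "1 / (1 / t * R3 (1 / t) ^ 2) = 1 / R3 t ^ 2"
    using LIMSEQ_unique[OF Lk[OF t'] Lp[OF t, folded e]] .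
  thus r: "R3 (1 / t) ^ 2 = t * R3 t ^ 2" using ne t by (simp add: field_simps)
  show "R2 (1 / t) = t * R4 t ^ 2" using e ne t unfolding k_def p_def r by (simp add: field_simps)
qed

section \<open>Modular transformation laws\<close>

definition qe :: "complex \<Rightarrow> complex" where "qe z = exp (2 * of_real pi * \<i> * z)"

lemma norm_qe: "norm (qe z) = exp (- 2 * pi * Im z)"
  by (simp add: qe_def)

lemma norm_qe_less_1: "z \<in> upper_half_plane \<Longrightarrow> norm (qe z) < 1"
  by (simp add: norm_qe upper_half_plane_def)

lemma qe_nonzero [simp]: "qe z \<noteq> 0" by (simp add: qe_def)

lemma qe_add_1: "qe (z + 1) = qe z"
  using exp_plus_2pin[of "2 * of_real pi * \<i> * z" 1] by (simp add: qe_def algebra_simps)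

lemma qe_diff_1: "qe (z - 1) = qe z"
  using qe_add_1[of "z - 1"] by simp

lemma qe_add_half: "qe (z + 1 / 2) = - qe z"
proof -
  have "qe (z + 1 / 2) = exp (2 * of_real pi * \<i> * z) * exp (\<i> * of_real pi)"
    by (simp add: qe_def algebra_simps exp_add)
  thus ?thesis by (simp add: qe_def)
qed

lemma qe_imaginary: "qe (\<i> * of_real t / 2) = nome t"
  by (simp add: qe_def nome_def exp_of_real[symmetric] flip: mult.assoc)

lemma qe_holomorphic: "qe holomorphic_on S"
  unfolding qe_def[abs_def] by (intro holomorphic_intros)

lemma open_uhp: "open upper_half_plane"
  unfolding upper_half_plane_def by (rule open_halfspace_Im_gt)

lemma connected_uhp: "connected upper_half_plane"
  unfolding upper_half_plane_def by (intro convex_connected convex_halfspace_Im_gt)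

lemma eis_nonzero: "norm q < 1 \<Longrightarrow> q \<noteq> 0 \<Longrightarrow> eis q \<noteq> 0"
  using tri_nonzero by (simp add: eis_def)

lemma eis_holomorphic: "eis holomorphic_on ball 0 1"
  unfolding eis_def[abs_def] by (intro holomorphic_intros tri_holomorphic)

lemma eis_minus: assumes "norm q < 1" shows "eis (- q) = - eis q"
proof -
  have "16 * (eis (- q) + eis q) = 0"
    using jacobi_quartic[of q] jacobi_quartic[of "- q"] assms
    by (simp only: distrib_left norm_minus_cancel minus_minus flip: jacobi_quartic) simp
  thus ?thesis by (simp only: mult_eq_0_iff eq_neg_iff_add_eq_0) simp
qed

lemma Im_moebius:
  fixes a b c d :: real
  shows "Im ((of_real a * z + of_real b) / (of_real c * z + of_real d)) =
    (a * d - b * c) * Im z / norm (of_real c * z + of_real d) ^ 2"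
proof -
  have "Im ((of_real a * z + of_real b) / (of_real c * z + of_real d)) =
    Im ((of_real a * z + of_real b) * cnj (of_real c * z + of_real d)) / norm (of_real c * z + of_real d) ^ 2"
    by (simp add: complex_div_cnj[of "of_real a * z + of_real b"])
  also have "Im ((of_real a * z + of_real b) * cnj (of_real c * z + of_real d)) = (a * d - b * c) * Im z"
    by (simp add: algebra_simps)
  finally show ?thesis .
qed

lemma uhp_nonzero: "z \<in> upper_half_plane \<Longrightarrow> z \<noteq> 0" by (auto simp: upper_half_plane_def)

lemma uhp_denominator_nonzero:
  fixes c d :: real assumes "z \<in> upper_half_plane" "c \<noteq> 0 \<or> d \<noteq> 0"
  shows "of_real c * z + of_real d \<noteq> 0"
  using assms by (auto simp: complex_eq_iff upper_half_plane_def)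

lemma uhp_moebius:
  fixes a b c d :: real
  assumes "z \<in> upper_half_plane" "a * d - b * c > 0"
  shows "(of_real a * z + of_real b) / (of_real c * z + of_real d) \<in> upper_half_plane"
proof -
  have "c \<noteq> 0 \<or> d \<noteq> 0" using assms(2) by auto
  from uhp_denominator_nonzero[OF assms(1) this] show ?thesis
    using assms by (auto simp: upper_half_plane_def Im_moebius intro!: divide_pos_pos)
qed

lemma uhp_inv4: "z \<in> upper_half_plane \<Longrightarrow> - 1 / (4 * z) \<in> upper_half_plane"
  using uhp_moebius[of z 0 0 "-1" 4] by simp

lemma uhp_shift: "z \<in> upper_half_plane \<Longrightarrow> z + of_real r \<in> upper_half_plane"
  by (simp add: upper_half_plane_def)

text \<open>
  The factor \<open>1/2\<close> matches the nome: \<open>q = exp (- \<pi> t)\<close> belongs to \<open>z = i t / 2\<close>, and \<open>t \<mapsto> 1 / t\<close>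
  becomes the Fricke involution \<open>z \<mapsto> - 1 / (4 z)\<close>.
\<close>

lemma identity_imaginary_axis:
  assumes "f holomorphic_on upper_half_plane" "\<And>t. t > 0 \<Longrightarrow> f (\<i> * of_real t / 2) = 0" "z \<in> upper_half_plane"
  shows "f z = 0"
proof (rule analytic_continuation[OF assms(1) open_uhp connected_uhp, of "(\<lambda>t. \<i> * of_real t / 2) ` {0<..}" "\<i> / 2"])
  show "\<i> / 2 islimpt (\<lambda>t. \<i> * of_real t / 2) ` {0<..}"
  proof (unfold islimpt_approachable, intro allI impI)
    fix e :: real assume "e > 0"
    moreover have "\<i> * of_real (1 + e) / 2 - \<i> / 2 = \<i> * complex_of_real (e / 2)"
      by (simp add: field_simps)
    hence "dist (\<i> * of_real (1 + e) / 2) (\<i> / 2) = \<bar>e / 2\<bar>" by (simp only: dist_norm norm_mult norm_ii norm_of_real mult_1)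
    moreover have "\<i> * complex_of_real (1 + e) / 2 \<noteq> \<i> / 2"
      using \<open>e > 0\<close> by (simp add: complex_eq_iff)
    ultimately show "\<exists>x'\<in>(\<lambda>t. \<i> * of_real t / 2) ` {0<..}. x' \<noteq> \<i> / 2 \<and> dist x' (\<i> / 2) < e"
      by (intro bexI[of _ "\<i> * of_real (1 + e) / 2"] conjI imageI) auto
  qed
qed (use assms in \<open>auto simp: upper_half_plane_def\<close>)

lemma qe_image: "qe ` upper_half_plane \<subseteq> ball 0 1" by (auto simp: norm_qe_less_1)

lemma theta3_qe_holomorphic: "(\<lambda>z. theta3 (qe z)) holomorphic_on upper_half_plane"
  using holomorphic_on_compose_gen[OF qe_holomorphic theta3_holomorphic qe_image] by (simp add: o_def)

lemma theta4_qe_holomorphic: "(\<lambda>z. theta3 (- qe z)) holomorphic_on upper_half_plane"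
  using holomorphic_on_compose_gen[OF qe_holomorphic theta4_holomorphic qe_image] by (simp add: o_def)

lemma eis_qe_holomorphic: "(\<lambda>z. eis (qe z)) holomorphic_on upper_half_plane"
  using holomorphic_on_compose_gen[OF qe_holomorphic eis_holomorphic qe_image] by (simp add: o_def)

lemma compose_inv4_holomorphic:
  "f holomorphic_on upper_half_plane \<Longrightarrow> (\<lambda>z. f (- 1 / (4 * z))) holomorphic_on upper_half_plane"
proof -
  assume f: "f holomorphic_on upper_half_plane"
  have "(\<lambda>z. - 1 / (4 * z)) holomorphic_on upper_half_plane"
    by (intro holomorphic_intros) (use uhp_nonzero in auto)
  from holomorphic_on_compose_gen[OF this f] show ?thesis using uhp_inv4 by (auto simp: o_def)
qed

lemma inv4_imaginary: "t > 0 \<Longrightarrow> - 1 / (4 * (\<i> * of_real t / 2)) = \<i> * of_real (1 / t) / 2"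
  by (simp add: field_simps)

text \<open>
  The first two laws hold on the imaginary axis by the inversion formulas for \<open>R3\<close> and \<open>R2\<close> and extend
  by the identity theorem; the third is their difference, by Jacobi's quartic identity. The Fricke
  involution thus exchanges \<open>theta3 (- q)^4\<close> and \<open>16 eis q\<close>.
\<close>

theorem
  assumes z: "z \<in> upper_half_plane"
  shows theta3_inversion: "theta3 (qe (- 1 / (4 * z))) ^ 4 = - 4 * z ^ 2 * theta3 (qe z) ^ 4"
    and eis_inversion: "16 * eis (qe (- 1 / (4 * z))) = - 4 * z ^ 2 * theta3 (- qe z) ^ 4"
    and theta4_inversion: "theta3 (- qe (- 1 / (4 * z))) ^ 4 = - 4 * z ^ 2 * (16 * eis (qe z))"
proof -
  have sq: "(\<i> * of_real t / 2) ^ 2 = - (of_real t ^ 2) / 4" for t by (simp add: power_mult_distrib power_divide)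
  show A: "theta3 (qe (- 1 / (4 * z))) ^ 4 = - 4 * z ^ 2 * theta3 (qe z) ^ 4"
  proof -
    have "theta3 (qe (- 1 / (4 * z))) ^ 4 - - 4 * z ^ 2 * theta3 (qe z) ^ 4 = 0"
    proof (rule identity_imaginary_axis[OF _ _ z])
      show "(\<lambda>z. theta3 (qe (- 1 / (4 * z))) ^ 4 - - 4 * z ^ 2 * theta3 (qe z) ^ 4) holomorphic_on upper_half_plane"
        by (intro holomorphic_intros theta3_qe_holomorphic compose_inv4_holomorphic[OF theta3_qe_holomorphic])
      fix t :: real assume t: "t > 0"
      have "R3 (1 / t) ^ 4 = (R3 (1 / t) ^ 2) ^ 2" by (simp flip: power_mult)
      also have "\<dots> = t ^ 2 * R3 t ^ 4" by (simp add: R3_inversion[OF t] power_mult_distrib flip: power_mult)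
      finally have "complex_of_real (R3 (1 / t)) ^ 4 = of_real t ^ 2 * of_real (R3 t) ^ 4"
        by (metis of_real_mult of_real_power)
      thus "theta3 (qe (- 1 / (4 * (\<i> * of_real t / 2)))) ^ 4 -
          - 4 * (\<i> * of_real t / 2) ^ 2 * theta3 (qe (\<i> * of_real t / 2)) ^ 4 = 0"
        unfolding inv4_imaginary[OF t] qe_imaginary sq using t by (simp add: theta_nome)
    qed
    thus ?thesis by (simp only: right_minus_eq)
  qed
  show B: "16 * eis (qe (- 1 / (4 * z))) = - 4 * z ^ 2 * theta3 (- qe z) ^ 4"
  proof -
    have "16 * eis (qe (- 1 / (4 * z))) - - 4 * z ^ 2 * theta3 (- qe z) ^ 4 = 0"
    proof (rule identity_imaginary_axis[OF _ _ z])
      show "(\<lambda>z. 16 * eis (qe (- 1 / (4 * z))) - - 4 * z ^ 2 * theta3 (- qe z) ^ 4) holomorphic_on upper_half_plane"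
        by (intro holomorphic_intros theta4_qe_holomorphic compose_inv4_holomorphic[OF eis_qe_holomorphic])
      fix t :: real assume t: "t > 0"
      have "R2 (1 / t) ^ 2 = t ^ 2 * R4 t ^ 4" by (simp add: R2_inversion[OF t] power_mult_distrib flip: power_mult)
      hence "R3 (1 / t) ^ 4 - R4 (1 / t) ^ 4 = t ^ 2 * R4 t ^ 4" using R_double(5)[of "1 / t"] t by simp
      hence "complex_of_real (R3 (1 / t) ^ 4 - R4 (1 / t) ^ 4) = of_real (t ^ 2 * R4 t ^ 4)" by (rule arg_cong)
      hence "complex_of_real (R3 (1 / t)) ^ 4 - of_real (R4 (1 / t)) ^ 4 = of_real t ^ 2 * of_real (R4 t) ^ 4"
        by (simp only: of_real_diff of_real_power of_real_mult)
      moreover have "16 * eis (nome (1 / t)) = of_real (R3 (1 / t)) ^ 4 - of_real (R4 (1 / t)) ^ 4"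
        using jacobi_quartic[of "nome (1 / t)"] t by (simp add: theta_nome norm_nome)
      ultimately show "16 * eis (qe (- 1 / (4 * (\<i> * of_real t / 2)))) -
          - 4 * (\<i> * of_real t / 2) ^ 2 * theta3 (- qe (\<i> * of_real t / 2)) ^ 4 = 0"
        unfolding inv4_imaginary[OF t] qe_imaginary sq using t by (simp add: theta_nome)
    qed
    thus ?thesis by (simp only: right_minus_eq)
  qed
  show "theta3 (- qe (- 1 / (4 * z))) ^ 4 = - 4 * z ^ 2 * (16 * eis (qe z))"
  proof -
    note j = jacobi_quartic[OF norm_qe_less_1[OF z]] and j' = jacobi_quartic[OF norm_qe_less_1[OF uhp_inv4[OF z]]]
    have "theta3 (- qe (- 1 / (4 * z))) ^ 4 = theta3 (qe (- 1 / (4 * z))) ^ 4 - 16 * eis (qe (- 1 / (4 * z)))"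
      unfolding j'[symmetric] by simp
    also have "\<dots> = - 4 * z ^ 2 * (theta3 (qe z) ^ 4 - theta3 (- qe z) ^ 4)"
      unfolding A B by (simp only: right_diff_distrib)
    finally show ?thesis unfolding j .
  qed
qed

text \<open>
  The generator \<open>z \<mapsto> z / (4 z + 1)\<close> of \<open>Gamma0 4\<close> is the conjugate of \<open>z \<mapsto> z - 1\<close> under the Fricke
  involution.
\<close>

lemma
  assumes z: "z \<in> upper_half_plane"
  shows eis_S: "eis (qe (z / (4 * z + 1))) = (4 * z + 1) ^ 2 * eis (qe z)"
    and theta3_S: "theta3 (qe (z / (4 * z + 1))) ^ 4 = (4 * z + 1) ^ 2 * theta3 (qe z) ^ 4"
proof -
  define v where "v = - 1 / (4 * z)"
  have v: "v \<in> upper_half_plane" unfolding v_def by (rule uhp_inv4[OF z])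
  have u: "v - 1 \<in> upper_half_plane" using uhp_shift[OF v, of "-1"] by simp
  have nz: "z \<noteq> 0" "4 * z + 1 \<noteq> 0" using uhp_nonzero[OF z] uhp_denominator_nonzero[OF z, of 4 1] by auto
  have e: "z / (4 * z + 1) = - 1 / (4 * (v - 1))"
    using nz by (simp add: v_def divide_simps) (simp add: algebra_simps)
  have m: "(v - 1) ^ 2 * (16 * z ^ 2) = (4 * z + 1) ^ 2"
  proof -
    have "(v - 1) * (4 * z) = - (4 * z + 1)" using nz by (simp add: v_def field_simps)
    hence "((v - 1) * (4 * z)) ^ 2 = (4 * z + 1) ^ 2" by (metis power2_minus)
    thus ?thesis by (simp add: power_mult_distrib)
  qed
  have "16 * eis (qe (z / (4 * z + 1))) = - 4 * (v - 1) ^ 2 * theta3 (- qe v) ^ 4"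
    using eis_inversion[OF u] by (simp only: e qe_diff_1)
  also have "\<dots> = 16 * ((v - 1) ^ 2 * (16 * z ^ 2) * eis (qe z))"
    using theta4_inversion[OF z] by (simp add: v_def)
  finally show "eis (qe (z / (4 * z + 1))) = (4 * z + 1) ^ 2 * eis (qe z)" unfolding m by simp
  have "theta3 (qe (z / (4 * z + 1))) ^ 4 = - 4 * (v - 1) ^ 2 * theta3 (qe v) ^ 4"
    using theta3_inversion[OF u] by (simp only: e qe_diff_1)
  also have "\<dots> = (v - 1) ^ 2 * (16 * z ^ 2) * theta3 (qe z) ^ 4"
    using theta3_inversion[OF z] by (simp add: v_def)
  finally show "theta3 (qe (z / (4 * z + 1))) ^ 4 = (4 * z + 1) ^ 2 * theta3 (qe z) ^ 4" unfolding m .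
qed

section \<open>A Liouville theorem for level 4\<close>

text \<open>
  Reduction to the fundamental domain, carried out on a function invariant under the two generators
  rather than on group elements. Among all images of \<open>z\<close> with the same value of \<open>G\<close>, one of
  maximal height exists because \<open>|c z + d| \<le> 1\<close> has only finitely many integer solutions; a point
  inside one of the two discs would be moved higher by a generator.
\<close>

lemma orbit_reduction:
  fixes G :: "complex \<Rightarrow> complex"
  assumes z: "z \<in> upper_half_plane"
    and T: "\<And>z. z \<in> upper_half_plane \<Longrightarrow> G (z + 1) = G z"
    and S: "\<And>z. z \<in> upper_half_plane \<Longrightarrow> G (z / (4 * z + 1)) = G z"
  obtains w where "w \<in> upper_half_plane" "G w = G z" "\<bar>Re w\<bar> \<le> 1 / 2" "norm (4 * w + 1) \<ge> 1" "norm (4 * w - 1) \<ge> 1"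
proof -
  define mb where "mb = (\<lambda>a b c d::int. (of_int a * z + of_int b) / (of_int c * z + of_int d))"
  \<comment> \<open>Bottom rows of integral unimodular matrices that preserve the value of \<open>G\<close> at \<open>z\<close>. The height
    of the image is \<open>Im z / |c z + d|^2\<close>, so maximal height means minimal \<open>N\<close>.\<close>
  define R where "R = {(c, d). \<exists>a b. a * d - b * c = 1 \<and> G (mb a b c d) = G z}"
  define N where "N = (\<lambda>(c::int, d::int). norm (of_int c * z + of_int d))"
  have uhp_mb: "mb a b c d \<in> upper_half_plane" if "a * d - b * c = 1" for a b c d
  proof -
    have "real_of_int (a * d - b * c) = 1" unfolding that by simp
    hence "0 < real_of_int a * real_of_int d - real_of_int b * real_of_int c" by simp
    thus ?thesis using uhp_moebius[OF z, of "real_of_int a" "real_of_int d" "real_of_int b" "real_of_int c"]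
      by (simp add: mb_def)
  qed
  have nz: "of_int c * z + of_int d \<noteq> 0" if "a * d - b * c = 1" for a b c d :: int
  proof -
    have "real_of_int c \<noteq> 0 \<or> real_of_int d \<noteq> 0" using that by auto
    thus ?thesis using uhp_denominator_nonzero[OF z, of "real_of_int c" "real_of_int d"] by simp
  qed
  have fin: "finite {p \<in> R. N p \<le> 1}"
  proof (rule finite_subset)
    define K where "K = \<lceil>1 / Im z\<rceil>"
    define K' where "K' = \<lceil>1 + of_int K * norm z\<rceil>"
    have Im: "Im z > 0" using z by (simp add: upper_half_plane_def)
    show "{p \<in> R. N p \<le> 1} \<subseteq> {- K..K} \<times> {- K'..K'}"
    proof clarify
      fix c d :: int assume N1: "N (c, d) \<le> 1"
      have "\<bar>Im (of_int c * z + of_int d)\<bar> \<le> 1"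
        using abs_Im_le_cmod[of "of_int c * z + of_int d"] N1 by (simp add: N_def)
      hence "real_of_int \<bar>c\<bar> \<le> 1 / Im z" using Im by (simp add: abs_mult field_simps)
      hence c: "\<bar>c\<bar> \<le> K" unfolding K_def by linarith
      have "real_of_int \<bar>d\<bar> = norm (of_int c * z + of_int d - of_int c * z)" by simp
      also have "\<dots> \<le> 1 + norm (of_int c * z)"
        using N1 norm_triangle_ineq4[of "of_int c * z + of_int d" "of_int c * z"] by (simp add: N_def)
      also have "norm (of_int c * z) \<le> of_int K * norm z"
        using c by (simp add: norm_mult) (intro mult_right_mono, auto)
      finally have "\<bar>d\<bar> \<le> K'" unfolding K'_def by linarith
      thus "c \<in> {- K..K} \<and> d \<in> {- K'..K'}" using c by auto
    qed
  qed simp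
  have "(0, 1) \<in> {p \<in> R. N p \<le> 1}"
    by (auto simp: R_def N_def mb_def intro!: exI[of _ 1] exI[of _ 0])
  then obtain p where p: "p \<in> R" "N p \<le> 1" "\<And>p'. p' \<in> R \<Longrightarrow> N p' \<le> 1 \<Longrightarrow> N p \<le> N p'"
    using arg_min_if_finite[OF fin, of N] by (metis (mono_tags, lifting) empty_iff linorder_not_less mem_Collect_eq)
  have pmin: "N p \<le> N p'" if "p' \<in> R" for p' using p(2) p(3)[OF that] by (cases "N p' \<le> 1") auto
  obtain c d where cd: "p = (c, d)" by (cases p)
  then obtain a b where ab: "a * d - b * c = 1" "G (mb a b c d) = G z" using p(1) by (auto simp: R_def)
  have shift: "G (w + of_int n) = G w" if "w \<in> upper_half_plane" for w n
  proof (induction n rule: int_induct[of _ 0])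
    case (step1 n)
    thus ?case using T[OF uhp_shift[OF that, of "of_int n"]] by (simp add: add_ac)
  next
    case (step2 n)
    thus ?case using T[OF uhp_shift[OF that, of "of_int (n - 1)"]] by (simp add: algebra_simps)
  qed simp
  define n where "n = \<lfloor>Re (mb a b c d) + 1 / 2\<rfloor>"
  define a' b' where "a' = a - n * c" and "b' = b - n * d"
  define w where "w = mb a' b' c d"
  have det: "a' * d - b' * c = 1" using ab by (simp add: a'_def b'_def algebra_simps)
  have weq: "w = mb a b c d - of_int n"
    using nz[OF ab(1)] by (simp add: w_def mb_def a'_def b'_def field_simps)
  have wH: "w \<in> upper_half_plane" unfolding w_def by (rule uhp_mb[OF det])
  have Gw: "G w = G z" using shift[OF uhp_mb[OF ab(1)], of "- n"] ab by (simp add: weq)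
  have re: "\<bar>Re w\<bar> \<le> 1 / 2"
  proof -
    define t where "t = Re (mb a b c d)"
    have "Re w = t - of_int \<lfloor>t + 1 / 2\<rfloor>" by (simp add: weq n_def t_def)
    thus ?thesis using floor_correct[of "t + 1 / 2"] by linarith
  qed
  have w1: "of_int c * z + of_int d \<noteq> 0" by (rule nz[OF det])
  have wz: "w * (of_int c * z + of_int d) = of_int a' * z + of_int b'" using w1 by (simp add: w_def mb_def)
  \<comment> \<open>Composing with \<open>w \<mapsto> w / (4 s w + 1)\<close> multiplies \<open>|c z + d|\<close> by \<open>|4 s w + 1|\<close>.\<close>
  have gen: "norm (4 * of_int s * w + 1) \<ge> 1" if s: "G (w / (4 * of_int s * w + 1)) = G w" for s :: int
  proof -
    have e: "of_int (4 * s * a' + c) * z + of_int (4 * s * b' + d) = (4 * of_int s * w + 1) * (of_int c * z + of_int d)"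
    proof -
      have "(4 * of_int s * w + 1) * (of_int c * z + of_int d) =
          4 * of_int s * (w * (of_int c * z + of_int d)) + (of_int c * z + of_int d)"
        by (simp add: algebra_simps)
      thus ?thesis unfolding wz by (simp add: algebra_simps)
    qed
    have "mb a' b' (4 * s * a' + c) (4 * s * b' + d) = w / (4 * of_int s * w + 1)"
      unfolding mb_def e using wz w1 by (simp flip: wz)
    moreover have "a' * (4 * s * b' + d) - b' * (4 * s * a' + c) = 1" using det by (simp add: algebra_simps)
    ultimately have "(4 * s * a' + c, 4 * s * b' + d) \<in> R" using s Gw unfolding R_def
      by (intro CollectI case_prodI exI[of _ a'] exI[of _ b']) simp
    from pmin[OF this] have "norm (of_int c * z + of_int d) \<le> norm (4 * of_int s * w + 1) * norm (of_int c * z + of_int d)"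
      by (simp only: cd N_def split e norm_mult)
    thus ?thesis using w1 by simp
  qed
  have "norm (4 * of_int 1 * w + 1) \<ge> 1" using S[OF wH] by (intro gen) simp
  moreover have "norm (4 * of_int (- 1) * w + 1) \<ge> 1"
  proof (rule gen)
    define u where "u = w / (1 - 4 * w)"
    have uH: "u \<in> upper_half_plane" using uhp_moebius[OF wH, of 1 1 0 "-4"] by (simp add: u_def)
    have "1 - 4 * w \<noteq> 0" using uhp_denominator_nonzero[OF wH, of "-4" 1] by simp
    hence "u / (4 * u + 1) = w" by (simp add: u_def divide_simps)
    thus "G (w / (4 * of_int (- 1) * w + 1)) = G w" using S[OF uH] by (simp add: u_def)
  qed
  ultimately show ?thesis using that[OF wH Gw re] by (simp add: norm_minus_commute)
qed

lemma qe_surj: assumes "norm q < 1" "q \<noteq> 0" obtains z where "z \<in> upper_half_plane" "qe z = q"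
proof
  define z where "z = Ln q / (2 * of_real pi * \<i>)"
  show "qe z = q" using assms by (simp add: z_def qe_def)
  hence "exp (- 2 * pi * Im z) < 1" using assms norm_qe[of z] by simp
  thus "z \<in> upper_half_plane" by (simp add: upper_half_plane_def zero_less_mult_iff)
qed

text \<open>
  Low points of the fundamental domain lie in a horoball at a cusp. Stated for the cusp \<open>0\<close>; the cusps
  \<open>1/2\<close> and \<open>-1/2\<close> are reached by translation.
\<close>

lemma horoball_bound:
  fixes w :: complex
  assumes "\<bar>Re w\<bar> \<le> 1 / 4" "0 < Im w" "Im w < 1 / 4" "norm (4 * w + 1) \<ge> 1 \<and> Re w \<le> 0 \<or> norm (4 * w - 1) \<ge> 1 \<and> Re w \<ge> 0"
  shows "2 * norm w ^ 2 \<le> Im w"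
proof -
  have n: "norm w ^ 2 = \<bar>Re w\<bar> ^ 2 + Im w ^ 2" by (simp add: cmod_power2)
  have R: "\<bar>Re w\<bar> \<le> 2 * norm w ^ 2"
  proof -
    have p: "norm (4 * w + 1) ^ 2 = 16 * norm w ^ 2 + 8 * Re w + 1" "norm (4 * w - 1) ^ 2 = 16 * norm w ^ 2 - 8 * Re w + 1"
      unfolding cmod_power2 by (simp_all add: power2_eq_square algebra_simps)
    have "1 \<le> x ^ 2" if "1 \<le> x" for x :: real using that by simp
    thus ?thesis using assms(4) p by fastforce
  qed
  have "2 * \<bar>Re w\<bar> ^ 2 \<le> \<bar>Re w\<bar> / 2"
    using mult_right_mono[OF assms(1), of "\<bar>Re w\<bar>"] by (simp add: power2_eq_square)
  moreover have "2 * Im w ^ 2 \<le> Im w / 2"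
    using mult_right_mono[of "Im w" "1 / 4" "Im w"] assms by (simp add: power2_eq_square)
  ultimately show ?thesis using n R by linarith
qed

lemma uhp_div4: "z \<in> upper_half_plane \<Longrightarrow> z / 4 \<in> upper_half_plane"
  by (simp add: upper_half_plane_def)

lemma qe_cball: assumes "1 / 8 \<le> Im z" shows "qe z \<in> cball 0 (exp (- pi / 4))"
proof -
  have "pi * (1 / 8) \<le> pi * Im z" using assms by (intro mult_left_mono) auto
  thus ?thesis by (simp add: norm_qe)
qed

text \<open>
  The maximum modulus principle on the compact modular curve. The images under the three local parameters
  of one closed disc cover all values of \<open>G\<close>: high points use the parameter at \<open>\<infinity>\<close>, and low points of
  the fundamental domain lie in horoballs at \<open>0\<close> and \<open>1/2\<close>. So \<open>|G|\<close> attains its supremum in the interior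
  of a parameter disc and \<open>G\<close> is constant. The parameter is \<open>q^(1/4)\<close> at the two finite cusps, as in the
  definition of holomorphy there.
\<close>

lemma Gamma0_4_liouville:
  fixes G :: "complex \<Rightarrow> complex"
  assumes T: "\<And>z. z \<in> upper_half_plane \<Longrightarrow> G (z + 1) = G z"
    and S: "\<And>z. z \<in> upper_half_plane \<Longrightarrow> G (z / (4 * z + 1)) = G z"
    and holo: "gi holomorphic_on ball 0 1" "g0 holomorphic_on ball 0 1" "gh holomorphic_on ball 0 1"
    and gi: "\<And>z. z \<in> upper_half_plane \<Longrightarrow> G z = gi (qe z)"
    and g0: "\<And>z. z \<in> upper_half_plane \<Longrightarrow> G (- 1 / z) = g0 (qe (z / 4))"
    and gh: "\<And>z. z \<in> upper_half_plane \<Longrightarrow> G (z / (2 * z + 1)) = gh (qe (z / 4))"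
    and z: "z \<in> upper_half_plane"
  shows "G z = gi 0"
proof -
  define C where "C = cball (0::complex) (exp (- pi / 4))"
  have e1: "exp (- (pi / 4)) < (1::real)" by simp
  have C: "compact C" "C \<subseteq> ball 0 1" "C \<noteq> {}" "0 \<in> C"
    by (auto simp: C_def dest: le_less_trans[OF _ e1])
  have inv0: "- 1 / z \<in> upper_half_plane" "- 1 / (- 1 / z) = z" if "z \<in> upper_half_plane" for z
    using uhp_moebius[of z 0 0 "-1" 1] that by auto
  have invh: "z / (1 - 2 * z) \<in> upper_half_plane" "(z / (1 - 2 * z)) / (2 * (z / (1 - 2 * z)) + 1) = z"
    "Im (z / (1 - 2 * z)) = Im z / norm (1 - 2 * z) ^ 2"
    if "z \<in> upper_half_plane" for z
  proof -
    show "z / (1 - 2 * z) \<in> upper_half_plane" using uhp_moebius[of z 1 1 0 "-2"] that by simp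
    have "1 - 2 * z \<noteq> 0" using uhp_denominator_nonzero[OF that, of "-2" 1] by simp
    thus "(z / (1 - 2 * z)) / (2 * (z / (1 - 2 * z)) + 1) = z" by (simp add: divide_simps)
    show "Im (z / (1 - 2 * z)) = Im z / norm (1 - 2 * z) ^ 2" using Im_moebius[of 1 z 0 "-2" 1] by simp
  qed
  have I4: "Im (v / 4) = Im v / 4" for v by simp
  \<comment> \<open>The radius \<open>exp (- \<pi> / 4)\<close> is the value of \<open>|q|\<close> at height \<open>1/8\<close>.\<close>
  have cover: "G z \<in> gi ` C \<union> g0 ` C \<union> gh ` C" if zz: "z \<in> upper_half_plane" for z
  proof -
    have half: "G z \<in> gh ` C" if u: "u \<in> upper_half_plane" "G u = G z" "2 * norm (u - 1 / 2) ^ 2 \<le> Im u" for u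
    proof -
      have "1 - 2 * u = - 2 * (u - 1 / 2)" by simp
      hence "norm (1 - 2 * u) = 2 * norm (u - 1 / 2)" by (simp only: norm_mult) simp
      hence "2 * norm (1 - 2 * u) ^ 2 \<le> 4 * Im u" using u(3) by (simp add: power_mult_distrib)
      moreover have "norm (1 - 2 * u) > 0" using uhp_denominator_nonzero[OF u(1), of "-2" 1] by simp
      ultimately have "1 / 2 \<le> Im (u / (1 - 2 * u))" unfolding invh(3)[OF u(1)] by (simp add: field_simps)
      hence "1 / 8 \<le> Im (u / (1 - 2 * u) / 4)"
        using I4[of "u / (1 - 2 * u)"] by linarith
      hence "qe (u / (1 - 2 * u) / 4) \<in> C" unfolding C_def by (rule qe_cball)
      moreover have "G z = gh (qe (u / (1 - 2 * u) / 4))"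
        using gh[OF invh(1)[OF u(1)]] unfolding invh(2)[OF u(1)] u(2) .
      ultimately show ?thesis by (intro image_eqI)
    qed
    obtain w where w: "w \<in> upper_half_plane" "G w = G z" "\<bar>Re w\<bar> \<le> 1 / 2" "norm (4 * w + 1) \<ge> 1" "norm (4 * w - 1) \<ge> 1"
      by (rule orbit_reduction[where G = G, OF zz T S])
    have Imw: "Im w > 0" using w(1) by (simp add: upper_half_plane_def)
    consider "Im w \<ge> 1 / 4" | "Im w < 1 / 4" "\<bar>Re w\<bar> \<le> 1 / 4" | "Im w < 1 / 4" "Re w > 1 / 4" | "Im w < 1 / 4" "Re w < - 1 / 4"
      by linarith
    thus ?thesis
    proof cases
      case 1
      hence "qe w \<in> C" unfolding C_def by (intro qe_cball) simp
      thus ?thesis using gi[OF w(1)] w(2) by auto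
    next
      case 2
      hence "2 * norm w ^ 2 \<le> Im w" using w Imw by (intro horoball_bound) auto
      moreover have "norm w > 0" using uhp_nonzero[OF w(1)] by simp
      moreover have "Im (- 1 / w) = Im w / norm w ^ 2" using Im_moebius[of 0 w "-1" 1 0] by simp
      ultimately have "2 \<le> Im (- 1 / w)" by (simp only: pos_le_divide_eq zero_less_power)
      hence "1 / 8 \<le> Im (- 1 / w / 4)" using I4[of "- 1 / w"] by linarith
      hence "qe (- 1 / w / 4) \<in> C" unfolding C_def by (rule qe_cball)
      moreover have "G z = g0 (qe (- 1 / w / 4))"
        using g0[OF inv0(1)[OF w(1)]] unfolding inv0(2)[OF w(1)] w(2) .
      ultimately show ?thesis by (intro UnI1 UnI2 image_eqI)
    next
      case 3
      have "2 * norm (w - 1 / 2) ^ 2 \<le> Im (w - 1 / 2)"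
        using 3 w Imw by (intro horoball_bound) (auto simp: algebra_simps)
      thus ?thesis using half[OF w(1,2)] by simp
    next
      case 4
      have "2 * norm (w + 1 / 2) ^ 2 \<le> Im (w + 1 / 2)"
        using 4 w Imw by (intro horoball_bound) (auto simp: algebra_simps)
      moreover have "w + 1 - 1 / 2 = w + 1 / 2" by simp
      ultimately show ?thesis using half[of "w + 1"] uhp_shift[OF w(1), of 1] T[OF w(1)] w(2) by (simp add: add.commute)
    qed
  qed
  have sup: "\<exists>p\<in>C. \<forall>q\<in>C. norm (g q) \<le> norm (g p)" if "g holomorphic_on ball 0 1" for g :: "complex \<Rightarrow> complex"
    using continuous_attains_sup[OF C(1) C(3), of "\<lambda>q. norm (g q)"] C(2) that
    by (metis continuous_on_norm continuous_on_subset holomorphic_on_imp_continuous_on)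
  obtain p1 p2 p3 where p: "p1 \<in> C" "\<forall>q\<in>C. norm (gi q) \<le> norm (gi p1)" "p2 \<in> C" "\<forall>q\<in>C. norm (g0 q) \<le> norm (g0 p2)"
    "p3 \<in> C" "\<forall>q\<in>C. norm (gh q) \<le> norm (gh p3)" using sup[OF holo(1)] sup[OF holo(2)] sup[OF holo(3)] by metis
  define M where "M = max (norm (gi p1)) (max (norm (g0 p2)) (norm (gh p3)))"
  have leM: "norm (gi q) \<le> M" "norm (g0 q) \<le> M" "norm (gh q) \<le> M" if "q \<in> C" for q
    using p that by (auto simp: M_def le_max_iff_disj)
  have GM: "norm (G z) \<le> M" if "z \<in> upper_half_plane" for z using cover[OF that] leM by auto
  have uhp4: "4 * z \<in> upper_half_plane" if "z \<in> upper_half_plane" for z using that by (simp add: upper_half_plane_def)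
  have "norm (gi q) \<le> M \<and> norm (g0 q) \<le> M \<and> norm (gh q) \<le> M" if q: "q \<in> ball 0 1" for q
  proof (cases "q = 0")
    case False
    then obtain z where z: "z \<in> upper_half_plane" "qe z = q" using qe_surj q by auto
    have "norm (gi q) \<le> M" using GM[OF z(1)] gi[OF z(1)] z(2) by simp
    moreover have "norm (g0 q) \<le> M" using GM[OF inv0(1)[OF uhp4[OF z(1)]]] g0[OF uhp4[OF z(1)]] z(2) by simp
    moreover have "4 * z / (2 * (4 * z) + 1) \<in> upper_half_plane" using uhp_moebius[OF uhp4[OF z(1)], of 1 1 0 2] by simp
    hence "norm (gh q) \<le> M" using GM gh[OF uhp4[OF z(1)]] z(2) by fastforce
    ultimately show ?thesis by blast
  qed (use leM C(4) in auto)
  hence cst: "g constant_on ball 0 1" if "g = gi \<or> g = g0 \<or> g = gh" "norm (g p) = M" "p \<in> C" for g p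
    using that holo C(2) by (intro maximum_modulus_principle[of g "ball 0 1" "ball 0 1" p]) auto
  have q4: "qe (z / 4) \<in> ball 0 1" "qe z \<in> ball 0 1" if "z \<in> upper_half_plane" for z
    using that norm_qe_less_1 uhp_div4 by auto
  have "\<exists>c. \<forall>z\<in>upper_half_plane. G z = c"
  proof -
    consider "M = norm (gi p1)" | "M = norm (g0 p2)" | "M = norm (gh p3)" unfolding M_def by linarith
    thus ?thesis
    proof cases
      case 1
      then obtain c where "\<And>q. q \<in> ball 0 1 \<Longrightarrow> gi q = c" using cst[of gi p1] p by (auto simp: constant_on_def)
      thus ?thesis using gi q4 by auto
    next
      case 2
      then obtain c where c: "\<And>q. q \<in> ball 0 1 \<Longrightarrow> g0 q = c" using cst[of g0 p2] p by (auto simp: constant_on_def)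
      have "G z = c" if "z \<in> upper_half_plane" for z
        using g0[OF inv0(1)[OF that]] inv0(2)[OF that] c[OF q4(1)[OF inv0(1)[OF that]]] by simp
      thus ?thesis by blast
    next
      case 3
      then obtain c where c: "\<And>q. q \<in> ball 0 1 \<Longrightarrow> gh q = c" using cst[of gh p3] p by (auto simp: constant_on_def)
      have "G z = c" if "z \<in> upper_half_plane" for z
        using gh[OF invh(1)[OF that]] invh(2)[OF that] c[OF q4(1)[OF invh(1)[OF that]]] by simp
      thus ?thesis by blast
    qed
  qed
  then obtain c where c: "\<And>z. z \<in> upper_half_plane \<Longrightarrow> G z = c" by blast
  have "\<forall>\<^sub>F q in at 0. q \<in> ball 0 1 - {0::complex}" by (rule eventually_at_in_open) auto
  hence "\<forall>\<^sub>F q in at 0. gi q = c"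
  proof eventually_elim
    case (elim q)
    then obtain z where "z \<in> upper_half_plane" "qe z = q" using qe_surj by auto
    thus ?case using gi c by auto
  qed
  hence "(gi \<longlongrightarrow> c) (at 0)" by (rule tendsto_eventually)
  moreover have "(gi \<longlongrightarrow> gi 0) (at 0)" using isCont_ball[OF holo(1), of 0] by (simp add: isCont_def)
  ultimately have "gi 0 = c" using LIM_unique by blast
  thus ?thesis using c z by simp
qed

section \<open>The basis forms as polynomials in a Hauptmodul\<close>

lemma qpow_eq: "h > 0 \<Longrightarrow> qpow h n z = qe (z / of_nat h) powi n"
  by (simp add: qpow_def qe_def exp_power_int mult_ac)

lemma Fourier_expansion_holomorphic:
  assumes "has_Fourier_expansion h N a g" "h > 0"
  obtains \<phi> where "\<phi> holomorphic_on ball 0 1"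
    "\<And>z. z \<in> upper_half_plane \<Longrightarrow> g z = qe (z / of_nat h) powi N * \<phi> (qe (z / of_nat h))"
proof -
  have ev: "(\<lambda>j. a (N + int j) * q ^ j) sums (g (of_nat h * z) / q powi N)"
    if z: "z \<in> upper_half_plane" "q = qe z" for z q
  proof -
    have hz: "of_nat h * z \<in> upper_half_plane" using z(1) assms(2) by (simp add: upper_half_plane_def)
    have q0: "q \<noteq> 0" using z by simp
    have "((\<lambda>n. a n * q powi n) has_sum g (of_nat h * z)) {N..}"
      using bspec[OF assms(1)[unfolded has_Fourier_expansion_def] hz] z(2) assms(2) by (simp add: qpow_eq)
    moreover have "range (\<lambda>j. N + int j) = {N..}"
    proof -
      have "x = N + int (nat (x - N))" if "x \<ge> N" for x using that by simp
      thus ?thesis by fastforce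
    qed
    ultimately have "((\<lambda>j. a (N + int j) * q powi (N + int j)) has_sum g (of_nat h * z)) UNIV"
      using has_sum_reindex[of "\<lambda>j. N + int j" UNIV "\<lambda>n. a n * q powi n"] by (simp add: o_def inj_on_def)
    hence "(\<lambda>j. a (N + int j) * q powi (N + int j)) sums g (of_nat h * z)" by (rule has_sum_imp_sums)
    hence "(\<lambda>j. a (N + int j) * q powi (N + int j) / q powi N) sums (g (of_nat h * z) / q powi N)" by (rule sums_divide)
    moreover have "a (N + int j) * q powi (N + int j) / q powi N = a (N + int j) * q ^ j" for j
      using q0 by (simp add: power_int_add)
    ultimately show ?thesis by simp
  qed
  define \<phi> where "\<phi> q = (\<Sum>j. a (N + int j) * q ^ j)" for q
  have "(\<lambda>j. a (N + int j) * (q - 0) ^ j) sums \<phi> q" if qb: "q \<in> ball 0 1" for q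
  proof (cases "q = 0")
    case True
    thus ?thesis unfolding \<phi>_def by (simp add: powser_sums_zero summable_sums[OF powser_sums_zero[THEN sums_summable]])
  next
    case False
    then obtain z where "z \<in> upper_half_plane" "qe z = q" using qe_surj[of q] qb by auto
    from sums_summable[OF ev[OF this(1) this(2)[symmetric]]] show ?thesis
      unfolding \<phi>_def by (simp add: summable_sums)
  qed
  hence "\<phi> holomorphic_on ball 0 1" by (rule power_series_holomorphic)
  moreover have "g z = qe (z / of_nat h) powi N * \<phi> (qe (z / of_nat h))" if z: "z \<in> upper_half_plane" for z
  proof -
    have "z / of_nat h \<in> upper_half_plane" using z assms(2) by (simp add: upper_half_plane_def)
    from ev[OF this refl] have "\<phi> (qe (z / of_nat h)) = g z / qe (z / of_nat h) powi N"
      using assms(2) by (simp add: \<phi>_def sums_iff)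
    thus ?thesis by simp
  qed
  ultimately show ?thesis by (rule that)
qed

text \<open>
  The Hauptmodul: \<open>1 / (16 q) + \<dots>\<close> at \<open>\<infinity>\<close>, with value \<open>1\<close> at the cusp \<open>0\<close> and \<open>0\<close> at the cusp
  \<open>1/2\<close>. On the imaginary axis it is the reciprocal of the classical modular function \<open>\<lambda>\<close>.
\<close>

definition psi :: "complex \<Rightarrow> complex" where "psi q = theta3 q ^ 4 / (16 * eis q)"

text \<open>
  The symmetry on the punctured disc extends to \<open>0\<close> by continuity.
\<close>

lemma real_at_0:
  fixes h :: "complex \<Rightarrow> complex"
  assumes "h holomorphic_on ball 0 1" "\<And>q. norm q < 1 \<Longrightarrow> q \<noteq> 0 \<Longrightarrow> h (cnj q) = cnj (h q)"
  shows "h 0 = cnj (h 0)"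
proof -
  have "((\<lambda>q. cnj (h (cnj q))) \<longlongrightarrow> cnj (h (cnj 0))) (at 0)"
    using isCont_ball[OF assms(1), of 0]
    by (intro tendsto_intros isCont_tendsto_compose[of _ h]) (auto intro!: tendsto_eq_intros)
  moreover have "\<forall>\<^sub>F q in at 0. q \<in> ball 0 1 - {0::complex}" by (rule eventually_at_in_open) auto
  hence "\<forall>\<^sub>F q in at 0. cnj (h (cnj q)) = h q" by eventually_elim (use assms(2) in auto)
  ultimately have "(h \<longlongrightarrow> cnj (h 0)) (at 0)" using Lim_transform_eventually by (auto simp: tendsto_cong)
  moreover have "(h \<longlongrightarrow> h 0) (at 0)" using isCont_ball[OF assms(1), of 0] by (simp add: isCont_def)
  ultimately show ?thesis using LIM_unique by blast
qed

text \<open>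
  Peeling off the leading coefficient: \<open>psi^n\<close> has a pole of order \<open>n\<close> with leading coefficient
  \<open>16^(-n)\<close>. The symmetry of \<open>h\<close> keeps \<open>P\<close> real on the real line, and the constant term goes into \<open>P\<close>,
  so that the remainder vanishes at \<open>0\<close>.
\<close>

lemma polynomial_part:
  assumes "h holomorphic_on ball 0 1" "\<And>q. norm q < 1 \<Longrightarrow> q \<noteq> 0 \<Longrightarrow> h (cnj q) = cnj (h q)"
  shows "\<exists>P r. (\<forall>x. poly P (of_real x) \<in> \<real>) \<and> r holomorphic_on ball 0 1 \<and> r 0 = 0 \<and>
    (\<forall>q. norm q < 1 \<longrightarrow> q \<noteq> 0 \<longrightarrow> h q / q ^ n = poly P (psi q) + r q)"
  using assms
proof (induction n arbitrary: h)
  case h: (0 h)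
  have "h 0 = cnj (h 0)" by (rule real_at_0[OF h])
  hence r0: "of_real (Re (h 0)) = h 0" by (simp add: complex_eq_iff)
  have "(\<lambda>q. h q - h 0) holomorphic_on ball 0 1" by (intro holomorphic_intros h)
  moreover have "h q / q ^ 0 = poly [:of_real (Re (h 0)):] (psi q) + (h q - h 0)" for q
    by (simp add: r0)
  moreover have "\<forall>x. poly [:of_real (Re (h 0)):] (complex_of_real x) \<in> \<real>" by simp
  ultimately show ?case
    by (intro exI[of _ "[:of_real (Re (h 0)):]"] exI[of _ "\<lambda>q. h q - h 0"]) (simp add: r0)
next
  case (Suc n h)
  define g where "g = (\<lambda>q. (theta3 q ^ 4 / (16 * tri q ^ 4)) ^ Suc n)"
  have g: "g holomorphic_on ball 0 1" unfolding g_def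
    by (intro holomorphic_intros theta3_holomorphic tri_holomorphic) (simp add: tri_nonzero)
  have gc: "g (cnj q) = cnj (g q)" if "norm q < 1" for q
    using that by (simp add: g_def theta3_cnj tri_cnj)
  have psig: "psi q ^ Suc n = g q / q ^ Suc n" if "q \<noteq> 0" for q
    by (simp add: psi_def g_def eis_def power_divide power_mult_distrib)
  have g0: "g 0 = (1 / 16) ^ Suc n" by (simp add: g_def)
  have "h 0 = cnj (h 0)" by (rule real_at_0[OF Suc.prems])
  hence r0: "of_real (Re (h 0)) = h 0" by (simp add: complex_eq_iff)
  define \<alpha> where "\<alpha> = Re (h 0) * 16 ^ Suc n"
  define f where "f = (\<lambda>q. h q - of_real \<alpha> * g q)"
  have f: "f holomorphic_on ball 0 1" unfolding f_def by (intro holomorphic_intros Suc.prems g)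
  have f0: "f 0 = 0" by (simp add: f_def g0 \<alpha>_def r0 power_one_over)
  have h0: "of_real \<alpha> * g 0 = h 0" using f0 by (simp add: f_def)
  define h1 where "h1 = (\<lambda>q. if q = 0 then deriv f 0 else (f q - f 0) / (q - 0))"
  \<comment> \<open>Off \<open>0\<close> this is \<open>f q / q\<close>; the value at \<open>0\<close> removes the singularity.\<close>
  have h1: "h1 holomorphic_on ball 0 1" unfolding h1_def by (rule pole_lemma[OF f]) simp
  have "h1 (cnj q) = cnj (h1 q)" if "norm q < 1" "q \<noteq> 0" for q
    using that Suc.prems(2)[OF that] gc by (simp add: h1_def f0) (simp add: f_def)
  from Suc.IH[OF h1 this] obtain P r where P: "r holomorphic_on ball 0 1" "r 0 = 0"
    "\<And>q. norm q < 1 \<Longrightarrow> q \<noteq> 0 \<Longrightarrow> h1 q / q ^ n = poly P (psi q) + r q"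
    "\<And>x. poly P (of_real x) \<in> \<real>" by blast
  define P' where "P' = P + monom (of_real \<alpha>) (Suc n)"
  have "h q / q ^ Suc n = poly P' (psi q) + r q" if q: "norm q < 1" "q \<noteq> 0" for q
  proof -
    have "h q / q ^ Suc n = h1 q / q ^ n + of_real \<alpha> * psi q ^ Suc n"
      unfolding psig[OF q(2)] using q by (simp add: h1_def f_def h0 field_simps)
    also have "h1 q / q ^ n = poly P (psi q) + r q" by (rule P(3)[OF q])
    finally show ?thesis by (simp add: P'_def poly_monom)
  qed
  moreover have "poly P' (of_real x) \<in> \<real>" for x
    using P(4) by (auto simp: P'_def poly_monom intro!: Reals_add Reals_mult Reals_power)
  ultimately have "(\<forall>x. poly P' (of_real x) \<in> \<real>) \<and> r holomorphic_on ball 0 1 \<and> r 0 = 0 \<and>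
    (\<forall>q. norm q < 1 \<longrightarrow> q \<noteq> 0 \<longrightarrow> h q / q ^ Suc n = poly P' (psi q) + r q)"
    using P(1,2) by simp
  thus ?case by (rule exI[where x = P', OF exI[where x = r]])
qed

text \<open>
  The quotient of the leading term \<open>q^(-m)\<close> of the basis form by \<open>eis^l\<close>.
\<close>

definition seed :: "int \<Rightarrow> int \<Rightarrow> complex \<Rightarrow> complex" where
  "seed l m q = q powi (- m) * eis q powi (- l)"

lemma slash_matrix:
  "slash k f (vector [vector [a, b], vector [c, d]]) z =
    (of_int c * z + of_int d) powi (- k) * f ((of_int a * z + of_int b) / (of_int c * z + of_int d))"
  by (simp add: slash_def moebius_def vector_2)

lemma Gamma0_matrix:
  "a * d - b * c = 1 \<Longrightarrow> 4 dvd c \<Longrightarrow> vector [vector [a, b], vector [c, d]] \<in> Gamma0 4"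
  by (simp add: Gamma0_def SL2Z_def det_2 vector_2)

text \<open>
  The difference \<open>G\<close> of \<open>f / eis^l\<close> and the polynomial part of the seed has weight 0 and is holomorphic
  at all three cusps. At \<open>\<infinity>\<close> it equals \<open>r + q \<phi> q t\<close>, because \<open>f - q^(-m) = O(q^(l+1))\<close> and \<open>eis^(-l)\<close>
  contributes \<open>q^(-l)\<close>; hence its constant value is \<open>0\<close>.
\<close>

theorem basis_form_polynomial:
  assumes bf: "basis_form4 l m f" and lm: "m \<ge> - l"
  obtains P r where "\<And>x. poly P (of_real x) \<in> \<real>" "r holomorphic_on ball 0 1" "r 0 = 0"
    "\<And>q. norm q < 1 \<Longrightarrow> q \<noteq> 0 \<Longrightarrow> seed l m q = poly P (psi q) + r q"
    "\<And>z. z \<in> upper_half_plane \<Longrightarrow> f z = eis (qe z) powi l * poly P (psi (qe z))"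
proof -
  have f: "f \<in> sharp_forms4 (2 * l)" using bf by (simp add: basis_form4_def)
  have inv: "slash (2 * l) f A z = f z" if "A \<in> Gamma0 4" "z \<in> upper_half_plane" for A z
    using f that by (simp add: sharp_forms4_def weakly_holomorphic_forms4_def)
  have fT: "f (z + 1) = f z" if "z \<in> upper_half_plane" for z
    using inv[OF Gamma0_matrix[of 1 1 1 0] that] by (simp add: slash_matrix)
  have fS: "f (z / (4 * z + 1)) = (4 * z + 1) powi (2 * l) * f z" if z: "z \<in> upper_half_plane" for z
  proof -
    have "(4 * z + 1) powi (- (2 * l)) * f (z / (4 * z + 1)) = f z"
      using inv[OF Gamma0_matrix[of 1 1 0 4] z] by (simp add: slash_matrix)
    moreover have "4 * z + 1 \<noteq> 0" using uhp_denominator_nonzero[OF z, of 4 1] by simp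
    ultimately show ?thesis by (simp add: power_int_minus field_simps)
  qed
  obtain a0 where "has_Fourier_expansion 4 0 a0 (slash (2 * l) f (vector [vector [0, -1], vector [1, 0]]))"
    using f by (auto simp: sharp_forms4_def holomorphic_at_cusp_def)
  then obtain \<phi>0 where \<phi>0: "\<phi>0 holomorphic_on ball 0 1"
    "\<And>z. z \<in> upper_half_plane \<Longrightarrow> z powi (- (2 * l)) * f (- 1 / z) = \<phi>0 (qe (z / 4))"
    by (rule Fourier_expansion_holomorphic) (auto simp: slash_matrix)
  obtain ah where "has_Fourier_expansion 4 0 ah (slash (2 * l) f (vector [vector [1, 0], vector [2, 1]]))"
    using f by (auto simp: sharp_forms4_def holomorphic_at_cusp_def)
  then obtain \<phi>h where \<phi>h: "\<phi>h holomorphic_on ball 0 1"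
    "\<And>z. z \<in> upper_half_plane \<Longrightarrow> (2 * z + 1) powi (- (2 * l)) * f (z / (2 * z + 1)) = \<phi>h (qe (z / 4))"
    by (rule Fourier_expansion_holomorphic) (auto simp: slash_matrix)
  obtain ai where "has_Fourier_expansion 1 (l + 1) ai (\<lambda>z. f z - qpow 1 (- m) z)"
    using bf by (auto simp: basis_form4_def)
  then obtain \<phi> where \<phi>: "\<phi> holomorphic_on ball 0 1"
    "\<And>z. z \<in> upper_half_plane \<Longrightarrow> f z - qe z powi (- m) = qe z powi (l + 1) * \<phi> (qe z)"
    by (rule Fourier_expansion_holomorphic) (auto simp: qpow_eq)
  define N where "N = nat (m + l)"
  have N: "int N = m + l" using lm by (simp add: N_def)
  define t where "t = (\<lambda>q. (tri q ^ 4) powi (- l))"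
  have t: "t holomorphic_on ball 0 1" unfolding t_def
    by (intro holomorphic_intros tri_holomorphic) (simp add: tri_nonzero)
  have tc: "t (cnj q) = cnj (t q)" if "norm q < 1" for q using that by (simp add: t_def tri_cnj power_int_def)
  have seed_eq: "seed l m q = t q / q ^ N" if "q \<noteq> 0" for q
  proof -
    have "q powi (- m) * q powi (- l) = q powi (- int N)" using that unfolding N by (simp flip: power_int_add)
    thus ?thesis
      by (simp add: seed_def eis_def t_def power_int_mult_distrib power_int_minus field_simps)
  qed
  obtain P r where P: "r holomorphic_on ball 0 1" "r 0 = 0"
    "\<And>q. norm q < 1 \<Longrightarrow> q \<noteq> 0 \<Longrightarrow> t q / q ^ N = poly P (psi q) + r q"
    "\<And>x. poly P (of_real x) \<in> \<real>"
    using polynomial_part[OF t tc, of N] by auto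
  define p where "p = (\<lambda>x. poly P x)"
  define G where "G z = f z * eis (qe z) powi (- l) - p (psi (qe z))" for z
  have p_holo: "(\<lambda>q. p (g q)) holomorphic_on S" if "g holomorphic_on S" for g S
    unfolding p_def using that by (intro holomorphic_intros)
  have qz: "norm (qe z) < 1" "eis (qe z) \<noteq> 0" if "z \<in> upper_half_plane" for z
    using norm_qe_less_1[OF that] eis_nonzero by auto
  have sqc: "w powi (2 * l) * (w ^ 2) powi (- l) = 1" if "w \<noteq> 0" for w :: complex
    using that by (simp add: power_int_minus power_int_mult)
  have regroup: "A * (b * c) = w * v * c" if "A = a * v" "a * b = w" for A a b c v w :: complex
    unfolding that(1) that(2)[symmetric] by (simp only: mult_ac)
  have "G z = 0" if z: "z \<in> upper_half_plane" for z
  proof -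
    \<comment> \<open>The functions \<open>G\<close> becomes in the local parameters at \<open>\<infinity>\<close>, \<open>0\<close> and \<open>1/2\<close>. At \<open>0\<close>, with
      \<open>u = z / 4\<close>, the law for \<open>eis\<close> has the factor \<open>- z^2 / 64\<close>, whence \<open>(-64)^l\<close>; at \<open>1/2\<close>, with
      \<open>u = z + 1/2\<close>, it has \<open>(2 u)^2 / 16\<close>, whence \<open>16^l\<close>.\<close>
    define gi where "gi = (\<lambda>q. r q + q * \<phi> q * t q)"
    define g0 where "g0 = (\<lambda>q. (- 64) powi l * \<phi>0 q * (theta3 (- q) ^ 4) powi (- l) - p (theta3 q ^ 4 / theta3 (- q) ^ 4))"
    define gh where "gh = (\<lambda>q. 16 powi l * \<phi>h q * (theta3 (q ^ 4) ^ 4) powi (- l) - p (16 * eis (q ^ 4) / theta3 (q ^ 4) ^ 4))"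
    have q4: "norm (q ^ 4) < 1" if "norm q < 1" for q :: complex
      using that by (simp add: norm_power power_less_one_iff)
    have c4: "(\<lambda>q. g (q ^ 4)) holomorphic_on ball 0 1" if "g holomorphic_on ball 0 1" for g :: "complex \<Rightarrow> complex"
    proof -
      have "(g \<circ> (\<lambda>q. q ^ 4)) holomorphic_on ball 0 1"
        by (rule holomorphic_on_compose_gen[OF _ that]) (use q4 in \<open>auto intro!: holomorphic_intros\<close>)
      thus ?thesis by (simp add: o_def)
    qed
    have "G z = gi 0"
    proof (rule Gamma0_4_liouville[OF _ _ _ _ _ _ _ _ z])
      show "gi holomorphic_on ball 0 1" unfolding gi_def by (intro holomorphic_intros P(1) \<phi>(1) t)
      show "g0 holomorphic_on ball 0 1" unfolding g0_def
        by (intro holomorphic_intros p_holo \<phi>0(1) theta3_holomorphic theta4_holomorphic) (auto simp: theta3_nonzero)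
      show "gh holomorphic_on ball 0 1" unfolding gh_def
        by (intro holomorphic_intros p_holo \<phi>h(1) c4[OF theta3_holomorphic] c4[OF eis_holomorphic])
           (use q4 theta3_nonzero in auto)
      show "G (z + 1) = G z" if "z \<in> upper_half_plane" for z
        using fT[OF that] by (simp add: G_def qe_add_1)
      show "G (z / (4 * z + 1)) = G z" if z: "z \<in> upper_half_plane" for z
      proof -
        have nz: "4 * z + 1 \<noteq> 0" using uhp_denominator_nonzero[OF z, of 4 1] by simp
        have "psi (qe (z / (4 * z + 1))) = psi (qe z)"
          unfolding psi_def eis_S[OF z] theta3_S[OF z] using nz by simp
        moreover have "(4 * z + 1) powi (2 * l) * ((4 * z + 1) ^ 2) powi (- l) = 1"
          using nz by (simp add: power_int_minus power_int_mult)
        hence "f (z / (4 * z + 1)) * eis (qe (z / (4 * z + 1))) powi (- l) = f z * eis (qe z) powi (- l)"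
          unfolding fS[OF z] eis_S[OF z] by (simp add: power_int_mult_distrib algebra_simps)
        ultimately show ?thesis by (simp add: G_def)
      qed
      show "G z = gi (qe z)" if z: "z \<in> upper_half_plane" for z
      proof -
        have fz: "f z = qe z powi (- m) + qe z powi (l + 1) * \<phi> (qe z)"
          using \<phi>(2)[OF z] by (simp add: algebra_simps)
        have "qe z powi (l + 1) * eis (qe z) powi (- l) = qe z * t (qe z)"
          by (simp add: eis_def t_def power_int_mult_distrib power_int_add power_int_minus)
        hence "f z * eis (qe z) powi (- l) = seed l m (qe z) + qe z * t (qe z) * \<phi> (qe z)"
          unfolding fz by (simp add: seed_def distrib_right)
        also have "seed l m (qe z) = p (psi (qe z)) + r (qe z)"
          using P(3)[OF qz(1)[OF z]] by (simp add: seed_eq p_def)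
        finally show ?thesis by (simp add: G_def gi_def mult_ac)
      qed
      show "G (- 1 / z) = g0 (qe (z / 4))" if z: "z \<in> upper_half_plane" for z
      proof -
        define u where "u = z / 4"
        have u: "u \<in> upper_half_plane" unfolding u_def by (rule uhp_div4[OF z])
        have z0: "z \<noteq> 0" using uhp_nonzero[OF z] .
        have e: "- 1 / z = - 1 / (4 * u)" by (simp add: u_def)
        have th: "theta3 (- qe u) \<noteq> 0" using theta3_nonzero[of "- qe u"] qz(1)[OF u] by simp
        have eq: "eis (qe (- 1 / z)) = (- (z ^ 2) / 64) * theta3 (- qe u) ^ 4"
        proof -
          have "16 * eis (qe (- 1 / z)) = 16 * ((- (z ^ 2) / 64) * theta3 (- qe u) ^ 4)"
            unfolding e eis_inversion[OF u] by (simp add: u_def power_divide)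
          thus ?thesis by (simp only: mult_cancel_left) simp
        qed
        have ps: "psi (qe (- 1 / z)) = theta3 (qe u) ^ 4 / theta3 (- qe u) ^ 4"
          unfolding psi_def e eis_inversion[OF u] theta3_inversion[OF u] using uhp_nonzero[OF u] th by simp
        have "f (- 1 / z) = z powi (2 * l) * \<phi>0 (qe u)"
          using \<phi>0(2)[OF z] z0 by (simp add: u_def power_int_minus field_simps)
        moreover have "z powi (2 * l) * (- (z ^ 2) / 64) powi (- l) = (- 64) powi l"
        proof -
          have "(- (z ^ 2) / 64) powi (- l) = (z ^ 2) powi (- l) * (- 1 / 64) powi (- l)"
            by (simp flip: power_int_mult_distrib)
          moreover have "(- 1 / 64 :: complex) powi (- l) = (- 64) powi l"
            by (simp add: power_int_minus flip: power_int_inverse)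
          moreover have "z powi (2 * l) * (z ^ 2) powi (- l) = 1"
            using z0 by (simp add: power_int_minus power_int_mult)
          ultimately show ?thesis by simp
        qed
        ultimately have "f (- 1 / z) * eis (qe (- 1 / z)) powi (- l) = (- 64) powi l * \<phi>0 (qe u) * (theta3 (- qe u) ^ 4) powi (- l)"
          unfolding eq power_int_mult_distrib[of "- (z ^ 2) / 64"] by (rule regroup)
        thus ?thesis unfolding G_def g0_def ps by (simp add: u_def)
      qed
      show "G (z / (2 * z + 1)) = gh (qe (z / 4))" if z: "z \<in> upper_half_plane" for z
      proof -
        define u where "u = z + 1 / 2"
        have u: "u \<in> upper_half_plane" using uhp_shift[OF z, of "1 / 2"] by (simp add: u_def)
        have nz: "2 * z + 1 \<noteq> 0" using uhp_denominator_nonzero[OF z, of 2 1] by simp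
        have u2: "2 * z + 1 = 2 * u" by (simp add: u_def)
        have e: "z / (2 * z + 1) = - 1 / (4 * u) + 1 / 2"
        proof -
          have "v / (w::complex) = - 1 / (2 * w) + 1 / 2" if "w \<noteq> 0" "2 * v + 1 = w" for v w
            using that by (simp add: field_simps)
          from this[OF nz refl] show ?thesis by (simp add: u_def algebra_simps)
        qed
        have q: "qe (z / (2 * z + 1)) = - qe (- 1 / (4 * u))" unfolding e by (rule qe_add_half)
        have qu: "qe u = - qe z" unfolding u_def by (rule qe_add_half)
        have th: "theta3 (qe z) \<noteq> 0" using theta3_nonzero qz(1)[OF z] by simp
        have em: "16 * eis (qe (z / (2 * z + 1))) = 4 * u ^ 2 * theta3 (qe z) ^ 4"
          using eis_inversion[OF u] unfolding q eis_minus[OF qz(1)[OF uhp_inv4[OF u]]] qu by simp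
        hence eq: "eis (qe (z / (2 * z + 1))) = (u ^ 2 / 4) * theta3 (qe z) ^ 4" by (simp add: mult.commute)
        have ps: "psi (qe (z / (2 * z + 1))) = 16 * eis (qe z) / theta3 (qe z) ^ 4"
          unfolding psi_def em unfolding q theta4_inversion[OF u] unfolding qu eis_minus[OF qz(1)[OF z]]
          using uhp_nonzero[OF u] th by simp
        have qq: "qe z = qe (z / 4) ^ 4" by (simp add: qe_def mult_ac flip: exp_of_nat_mult)
        have "f (z / (2 * z + 1)) = (2 * u) powi (2 * l) * \<phi>h (qe (z / 4))"
          unfolding u2[symmetric] using \<phi>h(2)[OF z] nz by (simp add: power_int_minus field_simps)
        moreover have "(2 * u) powi (2 * l) * (u ^ 2 / 4) powi (- l) = 16 powi l"
        proof -
          have "(u ^ 2 / 4) powi (- l) = (((2 * u) ^ 2) * (1 / 16)) powi (- l)" by (simp add: power_mult_distrib)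
          also have "\<dots> = ((2 * u) ^ 2) powi (- l) * (1 / 16) powi (- l)" by (rule power_int_mult_distrib)
          also have "(1 / 16 :: complex) powi (- l) = 16 powi l" by (simp add: power_int_minus flip: power_int_inverse)
          finally have "(u ^ 2 / 4) powi (- l) = ((2 * u) ^ 2) powi (- l) * 16 powi l" .
          moreover have "(2 * u) powi (2 * l) * ((2 * u) ^ 2) powi (- l) = 1"
            using uhp_nonzero[OF u] by (intro sqc) simp
          ultimately show ?thesis by (simp only: mult.assoc[symmetric] mult_1_left)
        qed
        ultimately have "f (z / (2 * z + 1)) * eis (qe (z / (2 * z + 1))) powi (- l) = 16 powi l * \<phi>h (qe (z / 4)) * (theta3 (qe z) ^ 4) powi (- l)"
          unfolding eq power_int_mult_distrib[of "u ^ 2 / 4"] by (rule regroup)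
        thus ?thesis unfolding G_def gh_def ps by (simp add: qq)
      qed
    qed
    thus ?thesis by (simp add: gi_def P(2))
  qed
  hence fP: "f z = eis (qe z) powi l * p (psi (qe z))" if "z \<in> upper_half_plane" for z
  proof -
    have "f z * eis (qe z) powi (- l) = p (psi (qe z))" using \<open>\<And>z. z \<in> upper_half_plane \<Longrightarrow> G z = 0\<close>[OF that] by (simp add: G_def)
    hence "f z * (eis (qe z) powi (- l) * eis (qe z) powi l) = p (psi (qe z)) * eis (qe z) powi l"
      by (simp add: mult.assoc)
    thus ?thesis using qz[OF that] by (simp add: power_int_minus mult.commute)
  qed
  thus ?thesis using that[of P r] P seed_eq fP unfolding p_def by simp
qed

section \<open>The residue formula\<close>

definition zeros_within :: "real \<Rightarrow> (complex \<Rightarrow> complex) \<Rightarrow> complex set" where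
  "zeros_within \<rho> f = {w. norm w < \<rho> \<and> f w = 0}"

lemma argument_principle_circle:
  assumes \<rho>: "0 < \<rho>" "\<rho> < 1" and f: "f holomorphic_on ball 0 1" and h: "h holomorphic_on ball 0 1"
    and nz: "\<And>q. norm q = \<rho> \<Longrightarrow> f q \<noteq> 0"
  shows "finite (zeros_within \<rho> f)"
    and "contour_integral (circlepath 0 \<rho>) (\<lambda>q. deriv f q * h q / f q) =
      2 * pi * \<i> * (\<Sum>p\<in>zeros_within \<rho> f. h p * of_int (zorder f p))"
    and "\<And>p. p \<in> zeros_within \<rho> f \<Longrightarrow> zorder f p > 0"
proof -
  define R where "R = (1 + \<rho>) / 2"
  have R: "\<rho> < R" "R < 1" "0 < R" using \<rho> by (auto simp: R_def)
  define pz where "pz = {w \<in> ball 0 R. f w = 0 \<or> w \<in> {}}"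
  have nc: "\<not> f constant_on ball 0 1" if "f p = 0" "norm p < 1" for p
  proof
    assume "f constant_on ball 0 1"
    then obtain c where c: "\<And>q. q \<in> ball 0 1 \<Longrightarrow> f q = c" by (auto simp: constant_on_def)
    have "f (of_real \<rho>) = f p" using c[of "of_real \<rho>"] c[of p] that \<rho> by simp
    thus False using nz[of "of_real \<rho>"] that \<rho> by simp
  qed
  have fin: "finite pz"
  proof (cases "pz = {}")
    case False
    then obtain p where "f p = 0" "norm p < 1" using R by (auto simp: pz_def)
    have "finite {z \<in> cball 0 R. f z = 0}"
      by (rule holomorphic_compact_finite_zeros[OF f]) (use R nc \<open>f p = 0\<close> \<open>norm p < 1\<close> in auto)
    thus ?thesis by (rule finite_subset[rotated]) (auto simp: pz_def)
  qed simp
  have sub: "zeros_within \<rho> f \<subseteq> pz" using R by (auto simp: zeros_within_def pz_def)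
  thus "finite (zeros_within \<rho> f)" using fin finite_subset by blast
  have ns: "norm p \<noteq> \<rho>" if "p \<in> pz" for p using nz that by (auto simp: pz_def)
  have "contour_integral (circlepath 0 \<rho>) (\<lambda>q. deriv f q * h q / f q) =
      2 * pi * \<i> * (\<Sum>p\<in>pz. winding_number (circlepath 0 \<rho>) p * h p * of_int (zorder f p))"
    unfolding pz_def
  proof (rule argument_principle)
    have "ball 0 R \<subseteq> (ball 0 1 :: complex set)" using R by auto
    thus "f holomorphic_on ball 0 R - {}" "h holomorphic_on ball 0 R"
      using f h holomorphic_on_subset by auto
    show "path_image (circlepath 0 \<rho>) \<subseteq> ball 0 R - {w \<in> ball 0 R. f w = 0 \<or> w \<in> {}}"
      using nz \<rho> R by (auto simp: sphere_def)
    show "\<forall>z. z \<notin> ball 0 R \<longrightarrow> winding_number (circlepath 0 \<rho>) z = 0"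
    proof (intro allI impI)
      fix z assume "z \<notin> ball (0::complex) R"
      hence "z \<notin> cball 0 \<rho>" using R by auto
      thus "winding_number (circlepath 0 \<rho>) z = 0"
        by (intro winding_number_zero_outside[of _ "cball 0 \<rho>"]) (use \<rho> in \<open>auto simp: sphere_def\<close>)
    qed
    show "finite {w \<in> ball 0 R. f w = 0 \<or> w \<in> {}}" using fin by (simp add: pz_def)
  qed auto
  also have "(\<Sum>p\<in>pz. winding_number (circlepath 0 \<rho>) p * h p * of_int (zorder f p)) =
      (\<Sum>p\<in>zeros_within \<rho> f. h p * of_int (zorder f p))"
  proof (rule sum.mono_neutral_cong_right[OF fin sub])
    show "\<forall>p\<in>pz - zeros_within \<rho> f. winding_number (circlepath 0 \<rho>) p * h p * of_int (zorder f p) = 0"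
    proof
      fix p assume p: "p \<in> pz - zeros_within \<rho> f"
      hence "p \<notin> cball 0 \<rho>" using ns[of p] by (auto simp: zeros_within_def pz_def)
      hence "winding_number (circlepath 0 \<rho>) p = 0"
        by (intro winding_number_zero_outside[of _ "cball 0 \<rho>"]) (use \<rho> in \<open>auto simp: sphere_def\<close>)
      thus "winding_number (circlepath 0 \<rho>) p * h p * of_int (zorder f p) = 0" by simp
    qed
    show "winding_number (circlepath 0 \<rho>) p * h p * of_int (zorder f p) = h p * of_int (zorder f p)" if "p \<in> zeros_within \<rho> f" for p
      using winding_number_circlepath[of p 0 \<rho>] that by (simp add: zeros_within_def)
  qed
  finally show "contour_integral (circlepath 0 \<rho>) (\<lambda>q. deriv f q * h q / f q) =
      2 * pi * \<i> * (\<Sum>p\<in>zeros_within \<rho> f. h p * of_int (zorder f p))" .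
  fix p assume p: "p \<in> zeros_within \<rho> f"
  hence p1: "f p = 0" "norm p < 1" using \<rho> by (auto simp: zeros_within_def)
  have "\<exists>\<^sub>F z in at p. f z \<noteq> 0"
  proof (rule ccontr)
    assume "\<not> (\<exists>\<^sub>F z in at p. f z \<noteq> 0)"
    hence "\<forall>\<^sub>F z in at p. f z = 0" by (simp add: frequently_def)
    then obtain e where e: "e > 0" "\<And>z. z \<noteq> p \<Longrightarrow> dist z p < e \<Longrightarrow> f z = 0"
      by (auto simp: eventually_at)
    have "f (of_real \<rho>) = 0"
    proof (rule analytic_continuation[OF f, of "ball p e \<inter> ball 0 1" p])
      show "f z = 0" if "z \<in> ball p e \<inter> ball 0 1" for z
        using e(2)[of z] p1 that by (cases "z = p") (auto simp: dist_commute)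
      show "p islimpt ball p e \<inter> ball 0 1" using e(1) p1
        by (intro interior_limit_point) (simp add: interior_open open_Int)
    qed (use p1 \<rho> in auto)
    thus False using nz[of "of_real \<rho>"] \<rho> by simp
  qed
  thus "zorder f p > 0" using zorder_pos_iff[OF f open_ball, of p] p1 by simp
qed

lemma winding_number_circle_image:
  assumes \<rho>: "0 < \<rho>" "\<rho> < 1" and f: "f holomorphic_on ball 0 1" and nz: "\<And>q. norm q = \<rho> \<Longrightarrow> f q \<noteq> 0"
  shows "winding_number (f \<circ> circlepath 0 \<rho>) 0 = of_int (\<Sum>p\<in>zeros_within \<rho> f. zorder f p)"
proof -
  have im: "path_image (circlepath 0 \<rho>) \<subseteq> ball 0 1" using \<rho> by (auto simp: sphere_def)
  have vp: "valid_path (f \<circ> circlepath 0 \<rho>)"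
    by (rule valid_path_compose_holomorphic[OF _ f _ im]) auto
  have z: "0 \<notin> path_image (f \<circ> circlepath 0 \<rho>)"
    using nz \<rho> by (auto simp: path_image_compose sphere_def)
  have "winding_number (f \<circ> circlepath 0 \<rho>) 0 =
      1 / (2 * pi * \<i>) * contour_integral (f \<circ> circlepath 0 \<rho>) (\<lambda>w. 1 / (w - 0))"
    by (rule winding_number_valid_path[OF vp z])
  also have "contour_integral (f \<circ> circlepath 0 \<rho>) (\<lambda>w. 1 / (w - 0)) =
      contour_integral (circlepath 0 \<rho>) (\<lambda>q. deriv f q * (1 / (f q - 0)))"
    by (rule contour_integral_comp_analyticW[OF _ _ im]) (use f in \<open>auto simp: analytic_on_open\<close>)
  also have "\<dots> = 2 * pi * \<i> * (\<Sum>p\<in>zeros_within \<rho> f. 1 * of_int (zorder f p))"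
  proof -
    have "contour_integral (circlepath 0 \<rho>) (\<lambda>q. deriv f q * 1 / f q) =
      2 * pi * \<i> * (\<Sum>p\<in>zeros_within \<rho> f. 1 * of_int (zorder f p))"
      by (rule argument_principle_circle(2)[OF \<rho> f holomorphic_on_const]) (rule nz)
    thus ?thesis by simp
  qed
  finally show ?thesis by (simp add: o_def)
qed

text \<open>
  The linear homotopy keeps the image of the circle away from \<open>0\<close>, hence its winding number fixed.
\<close>

lemma zero_count_homotopy:
  assumes \<rho>: "0 < \<rho>" "\<rho> < 1" and f: "f holomorphic_on ball 0 1" and g: "g holomorphic_on ball 0 1"
    and nz: "\<And>q u. norm q = \<rho> \<Longrightarrow> 0 \<le> u \<Longrightarrow> u \<le> 1 \<Longrightarrow> (1 - of_real u) * f q + of_real u * g q \<noteq> 0"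
  shows "(\<Sum>p\<in>zeros_within \<rho> f. zorder f p) = (\<Sum>p\<in>zeros_within \<rho> g. zorder g p)"
proof -
  have im: "path_image (circlepath 0 \<rho>) \<subseteq> ball 0 1" using \<rho> by (auto simp: sphere_def)
  have pth: "path (F \<circ> circlepath 0 \<rho>)" if "F holomorphic_on ball 0 1" for F
    using valid_path_compose_holomorphic[OF _ that _ im] valid_path_imp_path by auto
  have "homotopic_loops (- {0}) (f \<circ> circlepath 0 \<rho>) (g \<circ> circlepath 0 \<rho>)"
  proof (rule homotopic_loops_linear)
    show "closed_segment ((f \<circ> circlepath 0 \<rho>) t) ((g \<circ> circlepath 0 \<rho>) t) \<subseteq> - {0}"
      if "t \<in> {0..1}" for t
    proof
      fix y assume "y \<in> closed_segment ((f \<circ> circlepath 0 \<rho>) t) ((g \<circ> circlepath 0 \<rho>) t)"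
      then obtain u where u: "0 \<le> u" "u \<le> 1"
        "y = (1 - of_real u) * f (circlepath 0 \<rho> t) + of_real u * g (circlepath 0 \<rho> t)"
        by (auto simp: closed_segment_def scaleR_conv_of_real)
      have "norm (circlepath 0 \<rho> t) = \<rho>" using \<rho> by (simp add: circlepath norm_mult)
      thus "y \<in> - {0}" using nz u by auto
    qed
  qed (auto simp: pth f g pathfinish_compose pathstart_compose)
  hence "winding_number (f \<circ> circlepath 0 \<rho>) 0 = winding_number (g \<circ> circlepath 0 \<rho>) 0"
    by (rule winding_number_homotopic_loops)
  thus ?thesis
    using winding_number_circle_image[OF \<rho> f] winding_number_circle_image[OF \<rho> g] nz[of _ 0] nz[of _ 1]
    by (simp flip: of_int_sum)
qed

text \<open>
  The Wronskian of \<open>theta3^4\<close> and \<open>eis\<close>: by Jacobi's quartic identity and his derivative identity it is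
  a monomial in the three theta functions. Equivalently \<open>q d\<psi>/dq = - \<psi> theta3 (- q)^4\<close>.
\<close>

lemma eis_deriv_relation:
  assumes q: "norm q < 1" "q \<noteq> 0"
  shows "q * (4 * theta3 q ^ 3 * deriv theta3 q * eis q - theta3 q ^ 4 * deriv eis q) = - (theta3 q ^ 4 * theta3 (- q) ^ 4 * eis q)"
proof -
  define a b x y where "a = theta3 q" and "b = theta3 (- q)" and "x = deriv theta3 q" and "y = deriv theta3 (- q)"
  have nz: "a \<noteq> 0" "b \<noteq> 0" using q theta3_nonzero by (auto simp: a_def b_def)
  have J: "a ^ 4 - b ^ 4 = 16 * eis q" using jacobi_quartic[OF q(1)] by (simp add: a_def b_def)
  have "((\<lambda>q. (theta3 q ^ 4 - theta3 (- q) ^ 4) / 16) has_field_derivative (a ^ 3 * x + b ^ 3 * y) / 4) (at q)"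
    by (auto intro!: derivative_eq_intros theta3_deriv theta4_deriv q simp: a_def b_def x_def y_def algebra_simps)
  hence "(eis has_field_derivative (a ^ 3 * x + b ^ 3 * y) / 4) (at q)"
    by (rule has_field_derivative_transform_within_open[OF _ open_ball[of 0 1]])
       (use q jacobi_quartic in auto)
  hence d: "deriv eis q = (a ^ 3 * x + b ^ 3 * y) / 4" by (rule DERIV_imp_deriv)
  have "q * (x / a + y / b) = 4 * eis q" using theta_log_derivative[OF q(1)]
    by (simp add: eis_def a_def b_def x_def y_def)
  hence L: "q * (x * b + y * a) = 4 * eis q * (a * b)" using nz by (simp add: field_simps)
  have "16 * (q * (4 * a ^ 3 * x * eis q - a ^ 4 * deriv eis q)) =
      q * (4 * a ^ 3 * x * (a ^ 4 - b ^ 4) - 4 * a ^ 4 * (a ^ 3 * x + b ^ 3 * y))"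
    unfolding J d by (simp add: algebra_simps)
  also have "\<dots> = - 4 * a ^ 3 * b ^ 3 * (q * (x * b + y * a))"
    by (simp add: algebra_simps power_numeral_reduce)
  also have "\<dots> = 16 * (- (a ^ 4 * b ^ 4 * eis q))" unfolding L by (simp add: algebra_simps power_numeral_reduce)
  finally show ?thesis by (simp add: a_def b_def x_def)
qed

lemma poly_antiderivative: fixes Q :: "complex poly" obtains R where "pderiv R = Q"
proof
  define R where "R = (\<Sum>i\<le>degree Q. monom (coeff Q i / of_nat (Suc i)) (Suc i))"
  have "pderiv (\<Sum>i\<in>A. f i) = (\<Sum>i\<in>A. pderiv (f i))" for f :: "nat \<Rightarrow> complex poly" and A
    by (induction A rule: infinite_finite_induct) (auto simp: pderiv_add)
  hence "pderiv R = (\<Sum>i\<le>degree Q. monom (coeff Q i) i)"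
    by (simp add: R_def pderiv_monom del: of_nat_Suc)
  thus "pderiv R = Q" by (simp add: poly_as_sum_of_monoms)
qed

text \<open>
  The numerator of \<open>psi - x\<close>, written as a combination of \<open>\<vartheta>_3^4\<close> and \<open>\<vartheta>_4^4\<close> so that for \<open>x\<close>
  in \<open>[0, 1]\<close> it is a convex combination.
\<close>

definition pencil :: "complex \<Rightarrow> complex \<Rightarrow> complex" where
  "pencil x q = (1 - x) * theta3 q ^ 4 + x * theta3 (- q) ^ 4"

lemma pencil_eq: "norm q < 1 \<Longrightarrow> pencil x q = theta3 q ^ 4 - 16 * x * eis q"
  using jacobi_quartic[of q] by (simp add: pencil_def algebra_simps)

lemma pencil_holomorphic: "pencil x holomorphic_on ball 0 1"
  unfolding pencil_def[abs_def] by (intro holomorphic_intros theta3_holomorphic theta4_holomorphic)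

lemma pencil_psi: "norm q < 1 \<Longrightarrow> q \<noteq> 0 \<Longrightarrow> psi q - x = pencil x q / (16 * eis q)"
  using eis_nonzero[of q] by (simp add: psi_def pencil_eq field_simps)

text \<open>
  Integrate \<open>s d log (psi - x)\<close> over the circle and split \<open>s = P(x) + (psi - x) Q(psi) + r\<close>. The
  logarithmic derivative has residue \<open>1\<close> at \<open>q1\<close> and \<open>q2\<close> and residue \<open>-1\<close> at \<open>0\<close>, so the first part gives
  \<open>P(x)\<close> and the last one \<open>r q1 + r q2\<close>; the middle part is the exact differential \<open>Q(psi) d psi\<close>. As
  \<open>s q1 + s q2 = 2 P(x) + r q1 + r q2\<close>, the integral is \<open>s q1 + s q2 - P(x)\<close>.
\<close>

theorem seed_residue_formula:
  assumes \<rho>: "0 < \<rho>" "\<rho> < 1" and r: "r holomorphic_on ball 0 1" "r 0 = 0"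
    and s: "\<And>q. norm q < 1 \<Longrightarrow> q \<noteq> 0 \<Longrightarrow> s q = poly P (psi q) + r q"
    and nz: "\<And>q. norm q = \<rho> \<Longrightarrow> pencil x q \<noteq> 0"
    and count: "(\<Sum>p\<in>zeros_within \<rho> (pencil x). zorder (pencil x) p) = 2"
    and q12: "q1 \<noteq> q2" "psi q1 = x" "psi q2 = x" "norm q1 < \<rho>" "norm q2 < \<rho>" "q1 \<noteq> 0" "q2 \<noteq> 0"
    and B: "B \<ge> 0" "\<And>q. norm q = \<rho> \<Longrightarrow> norm (s q * (theta3 q ^ 4 * theta3 (- q) ^ 4 / pencil x q)) \<le> B"
  shows "norm (poly P x - (s q1 + s q2)) \<le> B"
proof -
  let ?\<gamma> = "circlepath 0 \<rho>"
  have zer: "q1 \<in> zeros_within \<rho> (pencil x)" "q2 \<in> zeros_within \<rho> (pencil x)"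
    using q12 \<rho> pencil_psi[of q1 x] pencil_psi[of q2 x] eis_nonzero[of q1] eis_nonzero[of q2]
    by (auto simp: zeros_within_def)
  have fin: "finite (zeros_within \<rho> (pencil x))"
    by (rule argument_principle_circle(1)[OF \<rho> pencil_holomorphic holomorphic_on_const]) (rule nz)
  have pos: "zorder (pencil x) p > 0" if "p \<in> zeros_within \<rho> (pencil x)" for p
    by (rule argument_principle_circle(3)[OF \<rho> pencil_holomorphic holomorphic_on_const _ that]) (rule nz)
  \<comment> \<open>Two zeros are known and their orders add up to 2, so there are no others.\<close>
  have Z: "zeros_within \<rho> (pencil x) = {q1, q2} \<and> zorder (pencil x) q1 = 1 \<and> zorder (pencil x) q2 = 1"
  proof -
    let ?Z = "zeros_within \<rho> (pencil x)"
    have z1: "zorder (pencil x) p \<ge> 1" if "p \<in> ?Z" for p using pos[OF that] by linarith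
    have "(\<Sum>p\<in>?Z. zorder (pencil x) p) =
        (\<Sum>p\<in>{q1, q2}. zorder (pencil x) p) + (\<Sum>p\<in>?Z - {q1, q2}. zorder (pencil x) p)"
      using zer fin by (metis (no_types, lifting) add.commute empty_subsetI insert_subset sum.subset_diff)
    hence e: "2 = zorder (pencil x) q1 + zorder (pencil x) q2 + (\<Sum>p\<in>?Z - {q1, q2}. zorder (pencil x) p)"
      using count q12(1) by simp
    have "(\<Sum>p\<in>?Z - {q1, q2}. 1) \<le> (\<Sum>p\<in>?Z - {q1, q2}. zorder (pencil x) p)"
      by (intro sum_mono z1) auto
    hence "int (card (?Z - {q1, q2})) \<le> 0" using e z1[OF zer(1)] z1[OF zer(2)] by simp
    hence emp: "?Z - {q1, q2} = {}" using fin by simp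
    have "2 = zorder (pencil x) q1 + zorder (pencil x) q2" using e unfolding emp by simp
    thus ?thesis using zer emp z1[OF zer(1)] z1[OF zer(2)] by auto
  qed
  have Ipen: "contour_integral ?\<gamma> (\<lambda>q. deriv (pencil x) q * h q / pencil x q) = 2 * pi * \<i> * (h q1 + h q2)"
    if "h holomorphic_on ball 0 1" for h
  proof -
    have "contour_integral ?\<gamma> (\<lambda>q. deriv (pencil x) q * h q / pencil x q) =
        2 * pi * \<i> * (\<Sum>p\<in>zeros_within \<rho> (pencil x). h p * of_int (zorder (pencil x) p))"
      by (rule argument_principle_circle(2)[OF \<rho> pencil_holomorphic that]) (rule nz)
    thus ?thesis using Z q12(1) by simp
  qed
  have eis_nz: "eis q \<noteq> 0" if "norm q = \<rho>" for q using that \<rho> eis_nonzero[of q] by auto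
  \<comment> \<open>\<open>eis\<close> has a simple zero at \<open>0\<close>, the pole of \<open>psi\<close>, and no other zero.\<close>
  have Ieis: "contour_integral ?\<gamma> (\<lambda>q. deriv eis q * h q / eis q) = 2 * pi * \<i> * h 0"
    if "h holomorphic_on ball 0 1" for h
  proof -
    have "zeros_within \<rho> eis = {0}" using eis_nonzero \<rho> by (force simp: zeros_within_def eis_def)
    moreover have "zorder eis 0 = 1"
      by (rule zorder_eqI[of "ball 0 1" 0 "\<lambda>q. tri q ^ 4"])
         (auto intro!: holomorphic_intros tri_holomorphic simp: eis_def)
    moreover have "contour_integral ?\<gamma> (\<lambda>q. deriv eis q * h q / eis q) =
        2 * pi * \<i> * (\<Sum>p\<in>zeros_within \<rho> eis. h p * of_int (zorder eis p))"
      by (rule argument_principle_circle(2)[OF \<rho> eis_holomorphic that]) (rule eis_nz)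
    ultimately show ?thesis by simp
  qed
  have d_hol: "deriv (pencil x) holomorphic_on ball 0 1" "deriv eis holomorphic_on ball 0 1"
    by (intro holomorphic_deriv pencil_holomorphic eis_holomorphic open_ball)+
  have sph: "sphere 0 \<rho> \<subseteq> ball (0::complex) 1" using \<rho> by auto
  have ci: "g contour_integrable_on ?\<gamma>" if "continuous_on (sphere 0 \<rho>) g" for g
    by (rule contour_integrable_continuous_circlepath) (use that \<rho> in simp)
  have cont: "continuous_on (sphere 0 \<rho>) g" if "g holomorphic_on ball 0 1" for g
    using that sph holomorphic_on_imp_continuous_on continuous_on_subset by blast
  define w where "w = (\<lambda>q. deriv (pencil x) q / pencil x q - deriv eis q / eis q)"
  have w_cont: "continuous_on (sphere 0 \<rho>) w" unfolding w_def
    by (intro continuous_intros cont d_hol pencil_holomorphic eis_holomorphic) (use nz eis_nz in auto)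
  have Iw: "contour_integral ?\<gamma> (\<lambda>q. h q * w q) = 2 * pi * \<i> * (h q1 + h q2 - h 0)"
    if h: "h holomorphic_on ball 0 1" for h
  proof -
    have "contour_integral ?\<gamma> (\<lambda>q. h q * w q) =
        contour_integral ?\<gamma> (\<lambda>q. deriv (pencil x) q * h q / pencil x q - deriv eis q * h q / eis q)"
      by (simp add: w_def algebra_simps)
    also have "\<dots> = contour_integral ?\<gamma> (\<lambda>q. deriv (pencil x) q * h q / pencil x q) -
        contour_integral ?\<gamma> (\<lambda>q. deriv eis q * h q / eis q)"
      by (intro contour_integral_diff ci continuous_intros cont d_hol pencil_holomorphic eis_holomorphic h)
         (use nz eis_nz in auto)
    finally show ?thesis unfolding Ipen[OF h] Ieis[OF h] by (simp add: algebra_simps)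
  qed
  have wk: "w q = - (theta3 q ^ 4 * theta3 (- q) ^ 4 / pencil x q) / q" if q: "norm q = \<rho>" for q
  proof -
    have q1: "norm q < 1" "q \<noteq> 0" using q \<rho> by auto
    have n: "pencil x q \<noteq> 0" "eis q \<noteq> 0" using nz[OF q] eis_nz[OF q] by auto
    have "((\<lambda>q. theta3 q ^ 4 - 16 * x * eis q) has_field_derivative
        4 * theta3 q ^ 3 * deriv theta3 q - 16 * x * deriv eis q) (at q)"
      using holomorphic_derivI[OF eis_holomorphic open_ball, of q] q1
      by (auto intro!: derivative_eq_intros theta3_deriv q1)
    hence "(pencil x has_field_derivative 4 * theta3 q ^ 3 * deriv theta3 q - 16 * x * deriv eis q) (at q)"
      by (rule has_field_derivative_transform_within_open[OF _ open_ball[of 0 1]])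
         (use q1 pencil_eq in auto)
    hence d: "deriv (pencil x) q = 4 * theta3 q ^ 3 * deriv theta3 q - 16 * x * deriv eis q" by (rule DERIV_imp_deriv)
    have "q * (deriv (pencil x) q * eis q - pencil x q * deriv eis q) =
        q * (4 * theta3 q ^ 3 * deriv theta3 q * eis q - theta3 q ^ 4 * deriv eis q)"
      unfolding d pencil_eq[OF q1(1)] by (simp add: algebra_simps)
    also have "\<dots> = - (theta3 q ^ 4 * theta3 (- q) ^ 4 * eis q)" by (rule eis_deriv_relation[OF q1])
    finally have e: "q * (deriv (pencil x) q * eis q - pencil x q * deriv eis q) = - (theta3 q ^ 4 * theta3 (- q) ^ 4 * eis q)" .
    have "w q = q * (deriv (pencil x) q * eis q - pencil x q * deriv eis q) / (q * pencil x q * eis q)"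
      using n q1 by (simp add: w_def field_simps)
    thus ?thesis unfolding e using n q1 by (simp add: field_simps)
  qed
  obtain Q where Q: "P - [:poly P x:] = [:- x, 1:] * Q"
  proof -
    have "poly (P - [:poly P x:]) x = 0" by simp
    hence "[:- x, 1:] dvd P - [:poly P x:]" by (simp only: poly_eq_0_iff_dvd)
    thus ?thesis using that by (auto elim: dvdE)
  qed
  obtain R where R: "pderiv R = Q" by (rule poly_antiderivative)
  have psi_d: "(psi has_field_derivative (psi q - x) * (deriv (pencil x) q / pencil x q - deriv eis q / eis q)) (at q)"
    if q: "norm q = \<rho>" for q
  proof -
    have q1: "norm q < 1" "q \<noteq> 0" using q \<rho> by auto
    have n: "pencil x q \<noteq> 0" "eis q \<noteq> 0" using nz[OF q] eis_nz[OF q] by auto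
    have "((\<lambda>q. pencil x q / (16 * eis q) + x) has_field_derivative
        (deriv (pencil x) q * (16 * eis q) - pencil x q * (16 * deriv eis q)) / ((16 * eis q) * (16 * eis q))) (at q)"
      using holomorphic_derivI[OF eis_holomorphic open_ball, of q] holomorphic_derivI[OF pencil_holomorphic open_ball, of q x] q1 n
      by (auto intro!: derivative_eq_intros)
    hence "(psi has_field_derivative
        (deriv (pencil x) q * (16 * eis q) - pencil x q * (16 * deriv eis q)) / ((16 * eis q) * (16 * eis q))) (at q)"
      by (rule has_field_derivative_transform_within_open[of _ _ _ "ball 0 1 - {0}"])
         (use q1 in \<open>auto simp flip: pencil_psi\<close>)
    moreover have "(deriv (pencil x) q * (16 * eis q) - pencil x q * (16 * deriv eis q)) / ((16 * eis q) * (16 * eis q)) =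
        (psi q - x) * (deriv (pencil x) q / pencil x q - deriv eis q / eis q)"
      unfolding pencil_psi[OF q1] using n by (simp add: field_simps)
    ultimately show ?thesis by simp
  qed
  \<comment> \<open>An antiderivative \<open>R\<close> of \<open>Q\<close> makes the middle part the derivative of \<open>R(psi)\<close>.\<close>
  have IQ: "((\<lambda>q. poly Q (psi q) * ((psi q - x) * w q)) has_contour_integral 0) ?\<gamma>"
  proof -
    have "((\<lambda>q. poly Q (psi q) * ((psi q - x) * w q)) has_contour_integral
        (poly R (psi (pathfinish ?\<gamma>)) - poly R (psi (pathstart ?\<gamma>)))) ?\<gamma>"
    proof (rule contour_integral_primitive[of "sphere 0 \<rho>" "\<lambda>q. poly R (psi q)"])
      show "((\<lambda>q. poly R (psi q)) has_field_derivative poly Q (psi q) * ((psi q - x) * w q)) (at q within sphere 0 \<rho>)"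
        if "q \<in> sphere 0 \<rho>" for q
        unfolding w_def R[symmetric]
        by (rule has_field_derivative_at_within, rule DERIV_chain2[OF poly_DERIV psi_d]) (use that in simp)
    qed (use \<rho> in auto)
    thus ?thesis by simp
  qed
  have psi_cont: "continuous_on (sphere 0 \<rho>) psi" unfolding psi_def[abs_def]
    by (intro continuous_intros cont theta3_holomorphic eis_holomorphic) (use eis_nz in auto)
  have "contour_integral ?\<gamma> (\<lambda>q. s q * w q) =
      contour_integral ?\<gamma> (\<lambda>q. (poly P x * w q + poly Q (psi q) * ((psi q - x) * w q)) + r q * w q)"
  proof (rule contour_integral_eq)
    fix q assume "q \<in> path_image ?\<gamma>"
    hence q: "norm q < 1" "q \<noteq> 0" using \<rho> by auto
    have "poly P (psi q) - poly P x = (psi q - x) * poly Q (psi q)"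
      using arg_cong[OF Q, of "\<lambda>p. poly p (psi q)"] by (simp add: algebra_simps)
    hence "s q = poly P x + (psi q - x) * poly Q (psi q) + r q" using s[OF q] by (simp add: algebra_simps)
    show "s q * w q = (poly P x * w q + poly Q (psi q) * ((psi q - x) * w q)) + r q * w q"
      unfolding \<open>s q = poly P x + (psi q - x) * poly Q (psi q) + r q\<close> by (simp add: algebra_simps)
  qed
  also have "\<dots> = contour_integral ?\<gamma> (\<lambda>q. poly P x * w q + poly Q (psi q) * ((psi q - x) * w q)) +
      contour_integral ?\<gamma> (\<lambda>q. r q * w q)"
    by (intro contour_integral_add ci continuous_intros w_cont psi_cont cont r)
  also have "contour_integral ?\<gamma> (\<lambda>q. poly P x * w q + poly Q (psi q) * ((psi q - x) * w q)) =
      contour_integral ?\<gamma> (\<lambda>q. poly P x * w q) + contour_integral ?\<gamma> (\<lambda>q. poly Q (psi q) * ((psi q - x) * w q))"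
    by (intro contour_integral_add ci continuous_intros w_cont psi_cont)
  also have "contour_integral ?\<gamma> (\<lambda>q. poly Q (psi q) * ((psi q - x) * w q)) = 0"
    using IQ by (rule contour_integral_unique)
  also have "contour_integral ?\<gamma> (\<lambda>q. poly P x * w q) = 2 * pi * \<i> * poly P x"
    using Iw[of "\<lambda>_. poly P x"] by simp
  also have "contour_integral ?\<gamma> (\<lambda>q. r q * w q) = 2 * pi * \<i> * (r q1 + r q2)"
    using Iw[OF r(1)] r(2) by simp
  also have "r q1 + r q2 = s q1 + s q2 - 2 * poly P x"
    using s[of q1] s[of q2] q12 \<rho> by simp
  finally have main: "contour_integral ?\<gamma> (\<lambda>q. s q * w q) = 2 * pi * \<i> * (s q1 + s q2 - poly P x)"
    by (simp add: algebra_simps)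
  have s_cont: "continuous_on (sphere 0 \<rho>) s"
  proof -
    have "continuous_on (sphere 0 \<rho>) (\<lambda>q. poly P (psi q) + r q)"
      by (intro continuous_intros psi_cont cont r)
    moreover have "poly P (psi q) + r q = s q" if "q \<in> sphere 0 \<rho>" for q using s[of q] that \<rho> by auto
    ultimately show ?thesis by (metis (no_types, lifting) continuous_on_cong)
  qed
  have "norm (2 * pi * \<i> * (s q1 + s q2 - poly P x)) \<le> (B / \<rho>) * (2 * pi * \<rho>)"
  proof (rule has_contour_integral_bound_circlepath[of "\<lambda>q. s q * w q" _ 0])
    show "((\<lambda>q. s q * w q) has_contour_integral 2 * pi * \<i> * (s q1 + s q2 - poly P x)) ?\<gamma>"
      unfolding main[symmetric] by (intro has_contour_integral_integral ci continuous_intros s_cont w_cont)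
    show "norm (s q * w q) \<le> B / \<rho>" if "norm (q - 0) = \<rho>" for q
    proof -
      have q: "norm q = \<rho>" using that by simp
      have "norm (s q * w q) = norm (s q * (theta3 q ^ 4 * theta3 (- q) ^ 4 / pencil x q)) / \<rho>"
        unfolding wk[OF q] using q by (simp add: norm_mult norm_divide)
      thus ?thesis using B(2)[OF q] \<rho> by (simp add: divide_right_mono)
    qed
  qed (use B(1) \<rho> in auto)
  hence "norm (s q1 + s q2 - poly P x) \<le> B" using \<rho> by (simp add: norm_mult)
  thus ?thesis by (simp add: norm_minus_commute)
qed

section \<open>The kernel on the circle of radius exp (-pi/4)\<close>

lemma exp_taylor_bounds:
  fixes x :: real assumes "0 \<le> x" "x \<le> 1"
  shows "(\<Sum>m<n. x ^ m / fact m) \<le> exp x" "exp x \<le> (\<Sum>m<n. x ^ m / fact m) + 3 * x ^ n / fact n"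
proof -
  obtain t where t: "\<bar>t\<bar> \<le> \<bar>x\<bar>" "exp x = (\<Sum>m<n. x ^ m / fact m) + exp t / fact n * x ^ n"
    using Maclaurin_exp_le[of x n] by blast
  have "exp t \<le> exp 1" using t assms by simp
  hence "exp t \<le> 3" using exp_le by linarith
  hence "exp t / fact n * x ^ n \<le> 3 / fact n * x ^ n" using assms by (intro mult_right_mono divide_right_mono) auto
  thus "(\<Sum>m<n. x ^ m / fact m) \<le> exp x" "exp x \<le> (\<Sum>m<n. x ^ m / fact m) + 3 * x ^ n / fact n"
    using t assms by simp_all
qed

text \<open>
  The circle corresponds to \<open>Im z = 1/8\<close>, half the height of the top of the arc. Points of the arc that
  are higher than this have nomes inside the circle, and only these contribute residues.
\<close>

definition rad :: real where "rad = exp (- pi / 4)"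

lemma rad_bounds: "(4558 / 10000) < rad" "rad < (4561 / 10000)"
proof -
  have 1: "exp (pi / 4) \<le> exp ((7854 / 10000) :: real)" "exp ((78539 / 100000) :: real) \<le> exp (pi / 4)" using pi_approx by simp_all
  have "exp ((7854 / 10000) :: real) < (21939 / 10000)"
    using exp_taylor_bounds(2)[of "(7854 / 10000)" 7] by (simp add: eval_nat_numeral fact_numeral)
  hence u: "exp (pi / 4) < (21939 / 10000)" using 1 by linarith
  have "(21926 / 10000) < exp ((78539 / 100000) :: real)"
    using exp_taylor_bounds(1)[of "(78539 / 100000)" 7] by (simp add: eval_nat_numeral fact_numeral)
  hence l: "(21926 / 10000) < exp (pi / 4)" using 1 by linarith
  have e: "rad * exp (pi / 4) = 1" by (simp add: rad_def flip: exp_add)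
  have p: "rad > 0" by (simp add: rad_def)
  have "rad * exp (pi / 4) < rad * (21939 / 10000)" using u p by (intro mult_strict_left_mono)
  thus "(4558 / 10000) < rad" using e by simp
  have "rad * (21926 / 10000) < rad * exp (pi / 4)" using l p by (intro mult_strict_left_mono)
  thus "rad < (4561 / 10000)" using e by simp
qed

lemma rad_pos: "0 < rad" "rad < 1" using rad_bounds by linarith+

lemma theta3_dev:
  assumes "norm q \<le> r" "r < 1" shows "norm (theta3 q - 1 - 2 * q) \<le> 2 * r ^ 4 / (1 - r ^ 5)"
proof -
  have r: "0 \<le> r" using assms norm_ge_zero order_trans by blast
  have "norm (theta3 q - 1 - 2 * q) \<le> 2 * norm q ^ 4 / (1 - norm q ^ 5)"
    by (rule theta3_tail) (use assms in simp)
  also have "\<dots> \<le> 2 * r ^ 4 / (1 - r ^ 5)"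
    using assms r by (intro frac_le mult_left_mono power_mono diff_left_mono) (auto simp: power_less_one_iff)
  finally show ?thesis .
qed

lemma tri_dev:
  assumes "norm q \<le> r" "r < 1" shows "norm (tri q - 1) \<le> r ^ 2 / (1 - r ^ 4)"
proof -
  have r: "0 \<le> r" using assms norm_ge_zero order_trans by blast
  have "norm (tri q - 1) \<le> norm q ^ 2 / (1 - norm q ^ 4)"
    by (rule tri_tail) (use assms in simp)
  also have "\<dots> \<le> r ^ 2 / (1 - r ^ 4)"
    using assms r by (intro frac_le power_mono diff_left_mono) (auto simp: power_less_one_iff)
  finally show ?thesis .
qed

lemma norm_add4: "norm (a + b + c + d) \<le> norm a + norm b + norm c + norm (d::complex)"
  using norm_triangle_ineq[of "a + b + c" d] norm_triangle_ineq[of "a + b" c] norm_triangle_ineq[of a b] by linarith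

lemma norm_pow4_dev:
  fixes a b :: complex assumes "norm (a - b) \<le> d" "norm b \<le> M" shows "norm (a ^ 4 - b ^ 4) \<le> d * (4 * (M + d) ^ 3)"
proof -
  have d: "0 \<le> d" using assms(1) norm_ge_zero order_trans by blast
  have M: "0 \<le> M" using assms(2) norm_ge_zero order_trans by blast
  have a: "norm a \<le> M + d" using norm_triangle_ineq[of "a - b" b] assms by simp
  have b: "norm b \<le> M + d" using assms d by simp
  have "a ^ 4 - b ^ 4 = (a - b) * (a ^ 3 + a ^ 2 * b + a * b ^ 2 + b ^ 3)"
    by (simp add: algebra_simps power_numeral_reduce)
  also have "norm \<dots> \<le> d * (4 * (M + d) ^ 3)" unfolding norm_mult
  proof (rule mult_mono[OF assms(1) _ d])
    define c where "c = (M + d) ^ 3"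
    have c: "(M + d) ^ 2 * (M + d) = c" "(M + d) * (M + d) ^ 2 = c"
      by (simp_all add: c_def power_numeral_reduce)
    have "norm (a ^ 3) \<le> c" "norm (b ^ 3) \<le> c"
      unfolding norm_power c_def using a b by (intro power_mono; simp)+
    moreover have "norm (a ^ 2 * b) \<le> c"
      unfolding norm_power norm_mult c(1)[symmetric] using a b M d by (intro mult_mono power_mono) auto
    moreover have "norm (a * b ^ 2) \<le> c"
      unfolding norm_power norm_mult c(2)[symmetric] using a b M d by (intro mult_mono power_mono) auto
    ultimately show "norm (a ^ 3 + a ^ 2 * b + a * b ^ 2 + b ^ 3) \<le> 4 * (M + d) ^ 3"
      unfolding c_def[symmetric] using norm_add4[of "a ^ 3" "a ^ 2 * b" "a * b ^ 2" "b ^ 3"] by linarith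
  qed simp
  finally show ?thesis .
qed

lemma pencil_half:
  assumes "norm q < 1" shows "pencil (1 / 2) q = theta3 (q ^ 2) ^ 4 + 16 * q ^ 2 * tri (q ^ 2) ^ 4"
proof -
  define a b where "a = theta3 q ^ 2" and "b = theta3 (- q) ^ 2"
  have ab: "a + b = 2 * theta3 (q ^ 2) ^ 2" "a - b = 8 * q * tri (q ^ 2) ^ 2"
    using theta3_sum_squares[OF assms] theta3_diff_squares[OF assms] by (auto simp: a_def b_def)
  have "pencil (1 / 2) q = (a ^ 2 + b ^ 2) / 2" by (simp add: pencil_def a_def b_def flip: power_mult)
  also have "\<dots> = ((a + b) ^ 2 + (a - b) ^ 2) / 4" by (simp add: power2_eq_square algebra_simps)
  also have "\<dots> = theta3 (q ^ 2) ^ 4 + 16 * q ^ 2 * tri (q ^ 2) ^ 4"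
    unfolding ab by (simp add: power_mult_distrib add_divide_distrib flip: power_mult)
  finally show ?thesis .
qed

text \<open>
  At \<open>x = 1/2\<close> the pencil is a function of \<open>p = q^2\<close> with expansion \<open>1 + 24 p + 24 p^2 + \<dots>\<close>. On the
  circle \<open>|p|\<close> is about \<open>0.208\<close>, so \<open>24 p\<close> dominates the rest and the pencil has as many zeros as
  \<open>24 q^2\<close>.
\<close>

lemma pencil_half_zero_count: "(\<Sum>p\<in>zeros_within rad (pencil (1 / 2)). zorder (pencil (1 / 2)) p) = 2"
proof -
  have "(\<Sum>p\<in>zeros_within rad (pencil (1 / 2)). zorder (pencil (1 / 2)) p) =
      (\<Sum>p\<in>zeros_within rad (\<lambda>q. 24 * q ^ 2). zorder (\<lambda>q. 24 * q ^ 2) p)"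
  proof (rule zero_count_homotopy[OF rad_pos pencil_holomorphic])
    fix q :: complex and u :: real assume q: "norm q = rad" and u: "0 \<le> u" "u \<le> 1"
    define p where "p = q ^ 2"
    have p: "norm p = rad ^ 2" using q by (simp add: p_def norm_power)
    have "rad ^ 2 \<le> (4561 / 10000) ^ 2" "(4558 / 10000) ^ 2 \<le> rad ^ 2" using rad_bounds rad_pos by (intro power_mono; simp)+
    hence p_le: "norm p \<le> (2081 / 10000)" and p_ge: "(2077 / 10000) \<le> norm p" unfolding p by (simp_all add: power2_eq_square)
    have e3: "norm (theta3 p - (1 + 2 * p)) \<le> (38 / 10000)"
      using theta3_dev[OF p_le] by (simp add: eval_nat_numeral algebra_simps)
    have n2: "norm (1 + 2 * p) \<le> (14162 / 10000)" using norm_triangle_ineq[of 1 "2 * p"] p_le by (simp add: norm_mult)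
    have d3: "norm (theta3 p ^ 4 - (1 + 2 * p) ^ 4) \<le> (438 / 10000)"
      using norm_pow4_dev[OF e3 n2] by (simp add: eval_nat_numeral)
    have e2: "norm (tri p - 1) \<le> (434 / 10000)" using tri_dev[OF p_le] by (simp add: eval_nat_numeral)
    have d2: "norm (tri p ^ 4 - 1 ^ 4) \<le> (198 / 1000)"
      using norm_pow4_dev[OF e2, of 1] by (simp add: eval_nat_numeral)
    have "pencil (1 / 2) q - 24 * q ^ 2 = (theta3 p ^ 4 - (1 + 2 * p) ^ 4) + (1 + 24 * p ^ 2 + 32 * p ^ 3 + 16 * p ^ 4)
        + 16 * p * (tri p ^ 4 - 1 ^ 4)"
      using q rad_pos by (simp add: pencil_half p_def[symmetric]) (simp add: power_numeral_reduce algebra_simps)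
    hence eqn: "norm (pencil (1 / 2) q - 24 * q ^ 2) = norm ((theta3 p ^ 4 - (1 + 2 * p) ^ 4) + (1 + 24 * p ^ 2 + 32 * p ^ 3 + 16 * p ^ 4)
        + 16 * p * (tri p ^ 4 - 1 ^ 4))" by (rule arg_cong)
    have "norm (pencil (1 / 2) q - 24 * q ^ 2) \<le> norm (theta3 p ^ 4 - (1 + 2 * p) ^ 4) +
        norm (1 + 24 * p ^ 2 + 32 * p ^ 3 + 16 * p ^ 4) + norm (16 * p * (tri p ^ 4 - 1 ^ 4))"
      unfolding eqn using norm_triangle_ineq[of "(theta3 p ^ 4 - (1 + 2 * p) ^ 4) + (1 + 24 * p ^ 2 + 32 * p ^ 3 + 16 * p ^ 4)" "16 * p * (tri p ^ 4 - 1 ^ 4)"]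
        norm_triangle_ineq[of "theta3 p ^ 4 - (1 + 2 * p) ^ 4" "1 + 24 * p ^ 2 + 32 * p ^ 3 + 16 * p ^ 4"] by linarith
    also have "norm (1 + 24 * p ^ 2 + 32 * p ^ 3 + 16 * p ^ 4) \<le> 1 + 24 * norm p ^ 2 + 32 * norm p ^ 3 + 16 * norm p ^ 4"
      using norm_add4[of 1 "24 * p ^ 2" "32 * p ^ 3" "16 * p ^ 4"] by (simp add: norm_mult norm_power)
    also have "\<dots> \<le> 1 + 24 * (2081 / 10000) ^ 2 + 32 * (2081 / 10000) ^ 3 + 16 * (2081 / 10000) ^ 4"
      by (intro add_mono mult_left_mono power_mono p_le) auto
    also have "norm (16 * p * (tri p ^ 4 - 1 ^ 4)) \<le> 16 * (2081 / 10000) * (198 / 1000)"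
      unfolding norm_mult using p_le d2 by (intro mult_mono) auto
    finally have main: "norm (pencil (1 / 2) q - 24 * q ^ 2) \<le> (32 / 10)" using d3 by (simp add: eval_nat_numeral)
    have big: "(49 / 10) \<le> norm (24 * q ^ 2)" using p_ge by (simp add: norm_mult p_def)
    show "(1 - of_real u) * pencil (1 / 2) q + of_real u * (24 * q ^ 2) \<noteq> 0"
    proof
      assume z: "(1 - of_real u) * pencil (1 / 2) q + of_real u * (24 * q ^ 2) = 0"
      have eq: "24 * q ^ 2 = - (of_real (1 - u) * (pencil (1 / 2) q - 24 * q ^ 2))"
        using z by (simp add: algebra_simps eq_neg_iff_add_eq_0)
      have "norm (24 * q ^ 2) = norm (of_real (1 - u) * (pencil (1 / 2) q - 24 * q ^ 2))"
        using arg_cong[OF eq, of norm] by (simp only: norm_minus_cancel)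
      also have "\<dots> = (1 - u) * norm (pencil (1 / 2) q - 24 * q ^ 2)"
        using u by (simp only: norm_mult norm_of_real abs_of_nonneg diff_ge_0_iff_ge)
      also have "\<dots> \<le> 1 * norm (pencil (1 / 2) q - 24 * q ^ 2)" using u by (intro mult_right_mono) auto
      finally show False using main big by linarith
    qed
  qed (intro holomorphic_intros)
  also have "zeros_within rad (\<lambda>q. 24 * q ^ 2) = {0}" using rad_pos by (auto simp: zeros_within_def)
  also have "zorder (\<lambda>q::complex. 24 * q ^ 2) 0 = 2"
    by (rule zorder_eqI[of UNIV 0 "\<lambda>_. 24"]) auto
  hence "(\<Sum>p\<in>{0}. zorder (\<lambda>q::complex. 24 * q ^ 2) p) = 2" by simp
  finally show ?thesis .
qed

text \<open>
  The sector has half-angle \<open>arctan 0.28\<close>, about 15.6 degrees; four times this is less than 63 degrees,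
  whose cosine exceeds \<open>9/20\<close>.
\<close>

lemma Re_pow4_sector:
  fixes a :: complex assumes "\<bar>Im a\<bar> \<le> (28 / 100) * Re a" shows "9 / 20 * norm a ^ 4 \<le> Re (a ^ 4)"
proof -
  define x y where "x = Re a ^ 2" and "y = Im a ^ 2"
  have "\<bar>Im a\<bar> ^ 2 \<le> ((28 / 100) * Re a) ^ 2" using assms by (intro power_mono) auto
  hence y: "0 \<le> y" "y \<le> (784 / 10000) * x" by (auto simp: x_def y_def power_mult_distrib power2_eq_square)
  have "norm a ^ 4 = (norm a ^ 2) ^ 2" by (simp flip: power_mult)
  also have "\<dots> = (x + y) ^ 2" by (simp add: cmod_power2 x_def y_def)
  finally have n: "norm a ^ 4 = x ^ 2 + 2 * (x * y) + y ^ 2" by (simp add: power2_eq_square algebra_simps)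
  have r: "Re (a ^ 4) = x ^ 2 - 6 * (x * y) + y ^ 2"
    by (simp add: x_def y_def power_numeral_reduce algebra_simps)
  have "x * y \<le> x * ((784 / 10000) * x)" using y by (intro mult_left_mono) (auto simp: x_def)
  hence "x * y \<le> (784 / 10000) * x ^ 2" by (simp add: power2_eq_square)
  moreover have "9 / 20 * (X + 2 * p + Y) \<le> X - 6 * p + Y" if "p \<le> 784 / 10000 * X" "0 \<le> X" "0 \<le> Y" for X p Y :: real
    using that by argo
  ultimately show ?thesis unfolding n r using zero_le_power2[of y] zero_le_power2[of x] by blast
qed

text \<open>
  Since \<open>3 + 4 i = i (4 - 3 i)\<close>, the fourth powers of the two rotations agree. So one rotation moves both
  \<open>X^4\<close> and \<open>Y^4\<close> into a sector around the positive axis, and no cancellation can occur in their convex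
  combination.
\<close>

lemma kernel_bound_sector:
  fixes X Y :: complex and x :: real
  assumes X: "\<bar>Im ((4 - 3 * \<i>) * X)\<bar> \<le> (28 / 100) * Re ((4 - 3 * \<i>) * X)"
    and Y: "\<bar>Im ((3 + 4 * \<i>) * Y)\<bar> \<le> (28 / 100) * Re ((3 + 4 * \<i>) * Y)"
    and x: "0 \<le> x" "x \<le> 1" and M: "norm X ^ 4 \<le> M" "norm Y ^ 4 \<le> M"
  shows "9 / 20 * norm (X ^ 4 * Y ^ 4) \<le> M * norm ((1 - x) * X ^ 4 + x * Y ^ 4)"
proof -
  define c where "c = (4 - 3 * \<i>) ^ 4"
  have n5: "norm (4 - 3 * \<i>) = 5" "norm (3 + 4 * \<i>) = 5" by (simp_all add: cmod_def)
  have c: "norm c = 625" by (simp add: c_def norm_power n5)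
  have c2: "(3 + 4 * \<i>) ^ 4 = c" by (simp add: c_def complex_eq_iff power_numeral_reduce)
  have U: "9 / 20 * (625 * norm X ^ 4) \<le> Re (c * X ^ 4)"
    using Re_pow4_sector[OF X] by (simp add: c_def norm_mult norm_power power_mult_distrib n5)
  have V: "9 / 20 * (625 * norm Y ^ 4) \<le> Re (c * Y ^ 4)"
    using Re_pow4_sector[OF Y] by (simp add: c2 norm_mult norm_power power_mult_distrib n5)
  have lin: "625 * (9 / 20 * ((1 - x) * s + x * t)) \<le> (1 - x) * u + x * v"
    if "9 / 20 * (625 * s) \<le> u" "9 / 20 * (625 * t) \<le> v" for s t u v
  proof -
    have "(1 - x) * (9 / 20 * (625 * s)) \<le> (1 - x) * u" "x * (9 / 20 * (625 * t)) \<le> x * v"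
      using that x by (intro mult_left_mono; simp)+
    moreover have "625 * (9 / 20 * ((1 - x) * s + x * t)) = (1 - x) * (9 / 20 * (625 * s)) + x * (9 / 20 * (625 * t))"
      by (simp add: field_simps)
    ultimately show ?thesis by linarith
  qed
  have "625 * (9 / 20 * ((1 - x) * norm X ^ 4 + x * norm Y ^ 4)) \<le> (1 - x) * Re (c * X ^ 4) + x * Re (c * Y ^ 4)"
    using U V by (intro lin) simp_all
  also have "\<dots> = Re (c * ((1 - x) * X ^ 4 + x * Y ^ 4))"
    by (simp add: algebra_simps)
  also have "\<dots> \<le> 625 * norm ((1 - x) * X ^ 4 + x * Y ^ 4)"
    using complex_Re_le_cmod[of "c * ((1 - x) * X ^ 4 + x * Y ^ 4)"] by (simp only: norm_mult c)
  finally have A: "9 / 20 * ((1 - x) * norm X ^ 4 + x * norm Y ^ 4) \<le> norm ((1 - x) * X ^ 4 + x * Y ^ 4)" by linarith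
  have M0: "0 \<le> M" using M(1) zero_le_power[OF norm_ge_zero] order_trans by blast
  have "norm X ^ 4 * norm Y ^ 4 = (1 - x) * norm X ^ 4 * norm Y ^ 4 + x * norm X ^ 4 * norm Y ^ 4"
    by (simp add: algebra_simps)
  also have "\<dots> \<le> (1 - x) * norm X ^ 4 * M + x * M * norm Y ^ 4"
    using M x by (intro add_mono mult_mono mult_left_mono mult_right_mono) auto
  finally have "9 / 20 * (norm X ^ 4 * norm Y ^ 4) \<le> M * (9 / 20 * ((1 - x) * norm X ^ 4 + x * norm Y ^ 4))"
    by (simp add: algebra_simps)
  also have "\<dots> \<le> M * norm ((1 - x) * X ^ 4 + x * Y ^ 4)" by (rule mult_left_mono[OF A M0])
  finally show ?thesis by (simp add: norm_mult norm_power)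
qed

text \<open>
  Near \<open>Re z = 1/4\<close> the nome is close to \<open>0.456 i\<close>, and \<open>1 + 2 q\<close> and \<open>1 - 2 q\<close> have arguments close to
  \<open>42\<close> and \<open>-42\<close> degrees. The rotations by \<open>4 - 3 i\<close> and \<open>3 + 4 i\<close> (about \<open>-37\<close> and \<open>53\<close> degrees) bring
  both theta values near the positive axis. The constant 21 is \<open>9.45\<close>, a bound for \<open>|theta3|^4\<close>,
  divided by \<open>9/20\<close>.
\<close>

lemma kernel_bound_middle:
  assumes r: "1 / 6 \<le> r" "r \<le> 1 / 4" and q: "q = qe (of_real r + \<i> / 8)" and x: "0 \<le> x" "x \<le> 1"
  shows "norm (theta3 q ^ 4 * theta3 (- q) ^ 4) \<le> 21 * norm (pencil (of_real x) q)"
proof -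
  define C S where "C = cos (2 * pi * r)" and "S = sin (2 * pi * r)"
  have CS: "C ^ 2 + S ^ 2 = 1" by (simp add: C_def S_def)
  have "pi * (1 / 6) \<le> pi * r" "pi * r \<le> pi * (1 / 4)" using r by (intro mult_left_mono; simp)+
  hence ang: "pi / 3 \<le> 2 * pi * r" "2 * pi * r \<le> pi / 2" by simp_all
  have "0 \<le> 2 * pi * r" using r by simp
  hence "- (pi / 2) \<le> 2 * pi * r" using pi_gt_zero by linarith
  hence c0: "0 \<le> cos (2 * pi * r)" using ang by (intro cos_ge_zero)
  have C: "0 \<le> C" "C \<le> 1 / 2"
    using ang c0 cos_monotone_0_pi_le[of "pi / 3" "2 * pi * r"] by (auto simp: C_def cos_60)
  have S0: "0 \<le> S" "S \<le> 1" unfolding S_def using ang by (auto intro!: sin_ge_zero)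
  have "C ^ 2 \<le> (1 / 2) ^ 2" using C by (intro power_mono) auto
  hence "(866 / 1000) ^ 2 \<le> S ^ 2" using CS by (simp add: power2_eq_square)
  hence S1: "(866 / 1000) \<le> S" using S0(1) by (rule power2_le_imp_le)
  have "S ^ 2 \<le> S" using S0 mult_left_le[of S S] by (simp add: power2_eq_square)
  hence S2: "1 - C ^ 2 \<le> S" using CS by linarith
  have qe: "q = of_real rad * (of_real C + \<i> * of_real S)"
  proof -
    have "2 * of_real pi * \<i> * (of_real r + \<i> / 8) = of_real (- pi / 4) + \<i> * of_real (2 * pi * r)"
      by (simp add: algebra_simps)
    hence "q = of_real (exp (- pi / 4)) * exp (\<i> * of_real (2 * pi * r))"
      unfolding q qe_def exp_of_real[symmetric] by (simp only: exp_add)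
    thus ?thesis by (simp only: rad_def C_def S_def cis_conv_exp[symmetric]) (simp add: complex_eq_iff)
  qed
  have "norm (of_real C + \<i> * of_real S) = 1" using CS by (simp add: cmod_def)
  hence nq: "norm q = rad" using rad_pos by (simp add: qe norm_mult)
  have nq1: "norm q \<le> (4561 / 10000)" "norm (- q) \<le> (4561 / 10000)" using nq rad_bounds by auto
  have e3: "norm (theta3 q - 1 - 2 * q) \<le> (884 / 10000)" "norm (theta3 (- q) - 1 - 2 * (- q)) \<le> (884 / 10000)"
    using theta3_dev[OF nq1(1)] theta3_dev[OF nq1(2)] by (simp_all add: eval_nat_numeral)
  define e f where "e = theta3 q - 1 - 2 * q" and "f = theta3 (- q) - 1 - 2 * (- q)"
  have n5: "norm (4 - 3 * \<i>) = 5" "norm (3 + 4 * \<i>) = 5" by (simp_all add: cmod_def)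
  have "norm ((4 - 3 * \<i>) * e) \<le> (442 / 1000)" "norm ((3 + 4 * \<i>) * f) \<le> (442 / 1000)"
    unfolding norm_mult n5 using e3 by (simp_all add: e_def f_def)
  hence E: "\<bar>Re ((4 - 3 * \<i>) * e)\<bar> \<le> (442 / 1000)" "\<bar>Im ((4 - 3 * \<i>) * e)\<bar> \<le> (442 / 1000)"
      "\<bar>Re ((3 + 4 * \<i>) * f)\<bar> \<le> (442 / 1000)" "\<bar>Im ((3 + 4 * \<i>) * f)\<bar> \<le> (442 / 1000)"
    using abs_Re_le_cmod abs_Im_le_cmod order_trans by blast+
  have a: "(4 - 3 * \<i>) * theta3 q = (4 - 3 * \<i>) * (1 + 2 * q) + (4 - 3 * \<i>) * e"
    "(3 + 4 * \<i>) * theta3 (- q) = (3 + 4 * \<i>) * (1 - 2 * q) + (3 + 4 * \<i>) * f"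
    by (simp_all add: e_def f_def algebra_simps)
  have RI: "Re ((4 - 3 * \<i>) * (1 + 2 * q)) = 4 + 2 * rad * (4 * C + 3 * S)"
    "Im ((4 - 3 * \<i>) * (1 + 2 * q)) = - 3 + 2 * rad * (4 * S - 3 * C)"
    "Re ((3 + 4 * \<i>) * (1 - 2 * q)) = 3 + 2 * rad * (4 * S - 3 * C)"
    "Im ((3 + 4 * \<i>) * (1 - 2 * q)) = 4 - 2 * rad * (4 * C + 3 * S)"
    by (simp_all add: qe algebra_simps)
  \<comment> \<open>Real and imaginary parts of \<open>(4 - 3 i) (2 q)\<close>: the four numbers above depend on \<open>g\<close> and \<open>h\<close> only.\<close>
  define g h where "g = 2 * rad * (4 * C + 3 * S)" and "h = 2 * rad * (4 * S - 3 * C)"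
  have rb: "(9116 / 10000) \<le> 2 * rad" "2 * rad \<le> (9122 / 10000)" using rad_bounds by auto
  have g1: "(9116 / 10000) * (4 * C + 3 * S) \<le> g" unfolding g_def using rb C S0 by (intro mult_right_mono) auto
  have h1: "(9116 / 10000) * (4 * S - 3 * C) \<le> h" unfolding h_def using rb C S1 by (intro mult_right_mono) auto
  have h2: "h \<le> (9122 / 10000) * (4 * S - 3 * C)" unfolding h_def using rb C S1 by (intro mult_right_mono) auto
  have g2: "g \<le> (4561 / 1000)"
  proof -
    have "(4 * C + 3 * S) ^ 2 + (4 * S - 3 * C) ^ 2 = 25 * (C ^ 2 + S ^ 2)" by (simp add: power2_eq_square algebra_simps)
    hence "(4 * C + 3 * S) ^ 2 = 5 ^ 2 - (4 * S - 3 * C) ^ 2" unfolding CS by simp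
    hence "(4 * C + 3 * S) ^ 2 \<le> 5 ^ 2" by simp
    hence "4 * C + 3 * S \<le> 5" by (rule power2_le_imp_le) simp
    hence "g \<le> 2 * rad * 5" unfolding g_def using rad_pos by (intro mult_left_mono) auto
    thus ?thesis using rb by linarith
  qed
  have CC: "C ^ 2 \<le> (5 / 10) * C" using C mult_right_mono[of C "1/2" C] by (simp add: power2_eq_square)
  have X: "\<bar>Im ((4 - 3 * \<i>) * theta3 q)\<bar> \<le> (28 / 100) * Re ((4 - 3 * \<i>) * theta3 q)"
  proof -
    have h: "h \<le> 365 / 100" "179 / 100 \<le> h" "236 / 100 \<le> g" using h1 h2 g1 C S0 S1 by argo+
    have gen: "\<bar>- 3 + h + v\<bar> \<le> 28 / 100 * (4 + g + u)" if "- u \<le> 442 / 1000" "v \<le> 442 / 1000" "- v \<le> 442 / 1000" for u v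
    proof (rule abs_leI)
      show "- 3 + h + v \<le> 28 / 100 * (4 + g + u)" "- (- 3 + h + v) \<le> 28 / 100 * (4 + g + u)"
        using h that by argo+
    qed
    show ?thesis unfolding a plus_complex.sel RI g_def[symmetric] h_def[symmetric]
      by (rule gen[OF abs_le_D2[OF E(1)] abs_le_D1[OF E(2)] abs_le_D2[OF E(2)]])
  qed
  have Y: "\<bar>Im ((3 + 4 * \<i>) * theta3 (- q))\<bar> \<le> (28 / 100) * Re ((3 + 4 * \<i>) * theta3 (- q))"
  proof -
    have h: "179 / 100 \<le> h" using h1 C S1 by argo
    have key: "9116 / 10000 * (316 / 100 * C + 412 / 100 * S) \<le> g + 28 / 100 * h" using g1 h1 by argo
    have "412 / 100 \<le> 316 / 100 * C + 412 / 100 * S" using S2 CC C by argo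
    hence key': "3755 / 1000 \<le> g + 28 / 100 * h" using key by argo
    have gen: "\<bar>4 - g + v\<bar> \<le> 28 / 100 * (3 + h + u)" if "- u \<le> 442 / 1000" "v \<le> 442 / 1000" "- v \<le> 442 / 1000" for u v
    proof (rule abs_leI)
      show "4 - g + v \<le> 28 / 100 * (3 + h + u)" "- (4 - g + v) \<le> 28 / 100 * (3 + h + u)"
        using h key' g2 that by argo+
    qed
    show ?thesis unfolding a plus_complex.sel RI g_def[symmetric] h_def[symmetric]
      by (rule gen[OF abs_le_D2[OF E(3)] abs_le_D1[OF E(4)] abs_le_D2[OF E(4)]])
  qed
  have nX: "norm (1 + 2 * q) \<le> (1657 / 1000)" "norm (1 - 2 * q) \<le> (1657 / 1000)"
  proof -
    have n: "norm (1 + 2 * q) ^ 2 = 1 + 4 * (rad * C) + 4 * rad ^ 2" "norm (1 - 2 * q) ^ 2 = 1 - 4 * (rad * C) + 4 * rad ^ 2"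
    proof -
      have "norm (1 + 2 * q) ^ 2 = 1 + 4 * (rad * C) + 4 * rad ^ 2 * (C ^ 2 + S ^ 2)"
        "norm (1 - 2 * q) ^ 2 = 1 - 4 * (rad * C) + 4 * rad ^ 2 * (C ^ 2 + S ^ 2)"
        unfolding cmod_power2 by (simp_all add: qe power2_eq_square algebra_simps)
      thus "norm (1 + 2 * q) ^ 2 = 1 + 4 * (rad * C) + 4 * rad ^ 2" "norm (1 - 2 * q) ^ 2 = 1 - 4 * (rad * C) + 4 * rad ^ 2"
        using CS by simp_all
    qed
    have "rad * C \<le> (4561 / 10000) * (1 / 2)" using rad_bounds C rad_pos by (intro mult_mono) auto
    moreover have "0 \<le> rad * C" using rad_pos C by simp
    moreover have "rad ^ 2 \<le> (4561 / 10000) ^ 2" using rad_bounds rad_pos by (intro power_mono) auto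
    ultimately have "norm (1 + 2 * q) ^ 2 \<le> (1657 / 1000) ^ 2" "norm (1 - 2 * q) ^ 2 \<le> (1657 / 1000) ^ 2"
      unfolding n by (simp_all add: power2_eq_square)
    thus "norm (1 + 2 * q) \<le> (1657 / 1000)" "norm (1 - 2 * q) \<le> (1657 / 1000)" by (auto intro: power2_le_imp_le)
  qed
  have "norm (theta3 q) \<le> (17454 / 10000)" "norm (theta3 (- q)) \<le> (17454 / 10000)"
    using norm_triangle_ineq[of e "1 + 2 * q"] norm_triangle_ineq[of f "1 - 2 * q"] nX e3
    by (simp_all add: e_def f_def)
  hence "norm (theta3 q) ^ 4 \<le> (17454 / 10000) ^ 4" "norm (theta3 (- q)) ^ 4 \<le> (17454 / 10000) ^ 4" by (auto intro!: power_mono)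
  hence M: "norm (theta3 q) ^ 4 \<le> (945 / 100)" "norm (theta3 (- q)) ^ 4 \<le> (945 / 100)" by (simp_all add: eval_nat_numeral)
  from kernel_bound_sector[OF X Y x M] show ?thesis by (simp add: pencil_def)
qed

lemma exp_decay_bound: "exp (- (16 / 5) * pi) \<le> 44 / 1000000"
proof -
  have 1: "exp (- (16 / 5) * pi) = rad ^ 12 * exp (- pi / 5)"
    unfolding rad_def by (simp add: algebra_simps flip: exp_of_nat_mult exp_add)
  have "exp (628 / 1000 :: real) \<le> exp (pi / 5)" using pi_approx by simp
  moreover have "187 / 100 < exp (628 / 1000 :: real)"
    using exp_taylor_bounds(1)[of "628 / 1000" 7] by (simp add: eval_nat_numeral fact_numeral)
  ultimately have "187 / 100 \<le> exp (pi / 5)" by linarith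
  hence "exp (- pi / 5) \<le> 100 / 187" by (simp add: exp_minus field_simps)
  moreover have "rad ^ 12 \<le> (4561 / 10000) ^ 12" using rad_bounds rad_pos by (intro power_mono) auto
  ultimately have "rad ^ 12 * exp (- pi / 5) \<le> (4561 / 10000) ^ 12 * (100 / 187)"
    by (intro mult_mono) auto
  also have "\<dots> \<le> 44 / 1000000" by (simp add: eval_nat_numeral)
  finally show ?thesis unfolding 1 .
qed

lemma exp_decay_mono: "a \<le> b \<Longrightarrow> exp (- 2 * pi * b) \<le> exp (- 2 * pi * a)" by simp

text \<open>
  For \<open>z\<close> with small real part the nome of \<open>- 1 / (4 z)\<close> is much smaller than that of \<open>z\<close>, so the
  bounds near the cusp \<open>0\<close> are proved after inversion.
\<close>

lemma inversion_data:
  assumes z: "z \<in> upper_half_plane"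
  defines "z' \<equiv> - 1 / (4 * z)"
  shows "theta3 (qe z) ^ 4 = - 4 * z' ^ 2 * theta3 (qe z') ^ 4"
    "theta3 (- qe z) ^ 4 = - 4 * z' ^ 2 * (16 * eis (qe z'))"
    "16 * eis (qe z) = - 4 * z' ^ 2 * theta3 (- qe z') ^ 4"
    "pencil x (qe z) = - 4 * z' ^ 2 * ((1 - x) * theta3 (qe z') ^ 4 + x * (16 * eis (qe z')))"
proof -
  have z': "z' \<in> upper_half_plane" unfolding z'_def by (rule uhp_inv4[OF z])
  have b: "- 1 / (4 * z') = z" using uhp_nonzero[OF z] by (simp add: z'_def)
  show 1: "theta3 (qe z) ^ 4 = - 4 * z' ^ 2 * theta3 (qe z') ^ 4" using theta3_inversion[OF z'] unfolding b .
  show 2: "theta3 (- qe z) ^ 4 = - 4 * z' ^ 2 * (16 * eis (qe z'))" using theta4_inversion[OF z'] unfolding b .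
  show "16 * eis (qe z) = - 4 * z' ^ 2 * theta3 (- qe z') ^ 4" using eis_inversion[OF z'] unfolding b .
  show "pencil x (qe z) = - 4 * z' ^ 2 * ((1 - x) * theta3 (qe z') ^ 4 + x * (16 * eis (qe z')))"
    unfolding pencil_def 1 2 by (simp add: algebra_simps)
qed

lemma line_point:
  fixes r :: real
  defines "z \<equiv> of_real r + \<i> / 8" and "D \<equiv> 4 * (r ^ 2 + 1 / 64)"
  shows "z \<in> upper_half_plane" "norm (- 4 * (- 1 / (4 * z)) ^ 2) = 1 / D"
    "Im (- 1 / (4 * z)) = 1 / (8 * D)" "Re (- 1 / (4 * z)) = - r / D" "norm (qe z) = rad"
proof -
  show zH: "z \<in> upper_half_plane" by (simp add: z_def upper_half_plane_def)
  have n: "norm z ^ 2 = D / 4" unfolding cmod_power2 by (simp add: z_def D_def power2_eq_square)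
  have D: "D > 0" unfolding D_def by (simp add: add_nonneg_pos)
  show "norm (- 4 * (- 1 / (4 * z)) ^ 2) = 1 / D"
    using n D by (simp add: norm_mult norm_power norm_divide power_divide power_mult_distrib)
  have e: "- 1 / (4 * z) = of_real (- 1 / D) * cnj z"
  proof -
    have "z * cnj z = of_real (D / 4)" unfolding n[symmetric] by (rule complex_norm_square[symmetric])
    moreover have "z \<noteq> 0" by (rule uhp_nonzero[OF zH])
    ultimately show ?thesis using D by (simp add: field_simps)
  qed
  show "Im (- 1 / (4 * z)) = 1 / (8 * D)" unfolding e by (simp add: z_def)
  show "Re (- 1 / (4 * z)) = - r / D" unfolding e by (simp add: z_def)
  show "norm (qe z) = rad" by (simp add: norm_qe z_def rad_def)
qed

text \<open>
  After inversion \<open>\<vartheta>_3^4\<close> is nearly \<open>1\<close> and \<open>\<vartheta>_4^4\<close> has become \<open>16 eis\<close>, which is at most \<open>0.000705\<close>. The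
  distance \<open>0.0014\<close> of \<open>x\<close> from \<open>1\<close> is just enough to keep \<open>(1 - x) \<vartheta>_3^4\<close> ahead of it.
\<close>

lemma kernel_bound_cusp:
  assumes r: "0 \<le> r" "r \<le> 1 / 16" and q: "q = qe (of_real r + \<i> / 8)" and x: "0 \<le> x" "x \<le> 1 - 14 / 10000"
  shows "norm (theta3 q ^ 4 * theta3 (- q) ^ 4) \<le> 21 * norm (pencil (of_real x) q)"
proof -
  define D where "D = 4 * (r ^ 2 + 1 / 64)"
  define c A E q' where "c = - 4 * (- 1 / (4 * (of_real r + \<i> / 8))) ^ 2"
    and "A = theta3 (qe (- 1 / (4 * (of_real r + \<i> / 8)))) ^ 4"
    and "E = 16 * eis (qe (- 1 / (4 * (of_real r + \<i> / 8))))"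
    and "q' = qe (- 1 / (4 * (of_real r + \<i> / 8)))"
  note lp = line_point[of r, folded D_def] and id = inversion_data[OF line_point(1)[of r]]
  have "r ^ 2 \<le> (1 / 16) ^ 2" using r by (intro power_mono)
  hence D: "1 / 16 \<le> D" "D \<le> 5 / 64" by (simp_all add: D_def power2_eq_square)
  have "norm c = 1 / D" using lp(2) by (simp only: c_def)
  hence cn: "norm c \<le> 16" using D frac_le[of 1 1 "1 / 16" D] by simp
  have "norm q' = exp (- 2 * pi * (1 / (8 * D)))" unfolding q'_def norm_qe lp(3) by simp
  also have "8 / 5 \<le> 1 / (8 * D)" using D by (simp add: field_simps)
  hence "exp (- 2 * pi * (1 / (8 * D))) \<le> exp (- 2 * pi * (8 / 5))" by (rule exp_decay_mono)
  also have "exp (- 2 * pi * (8 / 5)) = exp (- (16 / 5) * pi)" by simp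
  also note exp_decay_bound
  finally have q': "norm q' \<le> 44 / 1000000" .
  have "norm (tri q' - 1) \<le> 1 / 10000" using tri_dev[OF q'] by (simp add: eval_nat_numeral)
  hence "norm (tri q') \<le> 10001 / 10000" using norm_triangle_ineq[of "tri q' - 1" 1] by simp
  hence "norm (tri q') ^ 4 \<le> (10001 / 10000) ^ 4" by (intro power_mono) auto
  hence "norm (16 * q' * tri q' ^ 4) \<le> 16 * (44 / 1000000) * (10001 / 10000) ^ 4"
    unfolding norm_mult norm_power using q' by (intro mult_mono) auto
  hence E: "norm E \<le> 705 / 1000000"
    unfolding E_def eis_def q'_def[symmetric] by (simp add: eval_nat_numeral mult.assoc)
  have "norm (theta3 q' - 1 - 2 * q') \<le> 1 / 1000000" using theta3_dev[OF q'] by (simp add: eval_nat_numeral)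
  moreover have "norm (theta3 q' - 1) \<le> norm (theta3 q' - 1 - 2 * q') + norm (2 * q')"
    using norm_triangle_ineq[of "theta3 q' - 1 - 2 * q'" "2 * q'"] by simp
  ultimately have "norm (theta3 q' - 1) \<le> 1 / 10000" using q' by (simp add: norm_mult)
  hence "norm (theta3 q' ^ 4 - 1 ^ 4) \<le> 5 / 10000"
    using norm_pow4_dev[of "theta3 q'" 1 "1 / 10000" 1] by (simp add: eval_nat_numeral)
  hence A: "norm (A - 1) \<le> 5 / 10000" by (simp add: A_def q'_def)
  have A1: "norm A \<le> 10005 / 10000" "9995 / 10000 \<le> norm A"
    using norm_triangle_ineq[of "A - 1" 1] norm_triangle_ineq2[of 1 "1 - A"] A by (simp_all add: norm_minus_commute)
  have "14 / 10000 * (9995 / 10000) \<le> (1 - x) * norm A" using x A1 by (intro mult_mono) auto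
  moreover have "x * norm E \<le> 1 * (705 / 1000000)" using x E by (intro mult_mono) auto
  moreover have "norm ((1 - of_real x) * A + of_real x * E) \<ge> norm ((1 - of_real x) * A) - norm (of_real x * E)"
    by (metis diff_minus_eq_add norm_minus_cancel norm_triangle_ineq2)
  moreover have "norm ((1 - of_real x) * A) = (1 - x) * norm A" "norm (of_real x * E) = x * norm E"
  proof -
    have "norm (1 - complex_of_real x) = \<bar>1 - x\<bar>" by (metis norm_of_real of_real_1 of_real_diff)
    thus "norm ((1 - of_real x) * A) = (1 - x) * norm A" "norm (of_real x * E) = x * norm E"
      using x by (simp_all add: norm_mult)
  qed
  ultimately have L: "69 / 100000 \<le> norm ((1 - of_real x) * A + of_real x * E)" by linarith
  have "norm c * norm A * norm E \<le> 16 * (10005 / 10000) * (705 / 1000000)"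
    using cn A1 E by (intro mult_mono) auto
  also have "\<dots> \<le> 21 * (69 / 100000)" by simp
  also have "\<dots> \<le> 21 * norm ((1 - of_real x) * A + of_real x * E)" using L by simp
  finally have F: "norm c * norm A * norm E \<le> 21 * norm ((1 - of_real x) * A + of_real x * E)" .
  have "norm (theta3 q ^ 4 * theta3 (- q) ^ 4) = norm c * (norm c * norm A * norm E)"
    unfolding q id(1,2) A_def[symmetric] E_def[symmetric] c_def[symmetric] by (simp add: norm_mult)
  also have "\<dots> \<le> norm c * (21 * norm ((1 - of_real x) * A + of_real x * E))" by (rule mult_left_mono[OF F]) simp
  also have "\<dots> = 21 * norm (pencil (of_real x) q)"
    unfolding q id(4) A_def[symmetric] E_def[symmetric] c_def[symmetric] by (simp add: norm_mult)
  finally show ?thesis .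
qed

lemma cos_ge_quadratic: "1 - t ^ 2 / 2 \<le> cos (t::real)"
proof -
  have "sin (t / 2) ^ 2 \<le> (t / 2) ^ 2" using abs_sin_x_le_abs_x[of "t / 2"] unfolding abs_le_square_iff .
  moreover have "cos t = 1 - 2 * sin (t / 2) ^ 2" using cos_double_sin[of "t / 2"] by simp
  ultimately show ?thesis by (simp add: power_divide)
qed

text \<open>
  Adding a nonnegative multiple of a vector that makes no obtuse angle with \<open>E\<close> cannot shorten \<open>E\<close>.
\<close>

lemma norm_add_obtuse:
  fixes B E :: complex assumes "0 \<le> Re (E * cnj B)" "0 \<le> t" shows "norm E \<le> norm (of_real t * B + E)"
proof -
  have "norm (of_real t * B + E) ^ 2 = t ^ 2 * norm B ^ 2 + 2 * t * Re (E * cnj B) + norm E ^ 2"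
    unfolding cmod_power2 by (simp add: power2_eq_square algebra_simps)
  moreover have "0 \<le> t ^ 2 * norm B ^ 2" "0 \<le> 2 * t * Re (E * cnj B)" using assms by simp_all
  ultimately have "norm E ^ 2 \<le> norm (of_real t * B + E) ^ 2" by linarith
  thus ?thesis by (rule power2_le_imp_le) simp
qed

text \<open>
  In the inverted variable \<open>q'\<close> the pencil is \<open>(1 - x) B + E\<close> with \<open>B = \<vartheta>_4^4\<close> near \<open>1\<close> and
  \<open>E = 16 eis\<close>, nearly \<open>16 q'\<close>. The argument of \<open>q'\<close> lies between \<open>0\<close> and \<open>2 \<pi> / 5\<close>, so \<open>E\<close> and \<open>B\<close> do not
  oppose each other and the pencil is at least \<open>|E|\<close>. What remains of the quotient is \<open>|theta3 q|^4\<close>.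
\<close>

lemma kernel_bound_horn:
  assumes r: "1 / 16 \<le> r" "r \<le> 1 / 6" and q: "q = qe (of_real r + \<i> / 8)" and x: "0 \<le> x" "x \<le> 1"
  shows "norm (theta3 q ^ 4 * theta3 (- q) ^ 4) \<le> 21 * norm (pencil (of_real x) q)"
proof -
  define D where "D = 4 * (r ^ 2 + 1 / 64)"
  define z' where "z' = - 1 / (4 * (of_real r + \<i> / 8))"
  define q' where "q' = qe z'"
  define c A B E where "c = - 4 * z' ^ 2" and "A = theta3 q' ^ 4" and "B = theta3 (- q') ^ 4" and "E = 16 * eis q'"
  note lp = line_point[of r, folded D_def z'_def] and id = inversion_data[OF line_point(1)[of r], folded z'_def q'_def, folded c_def A_def B_def E_def]
  have zH: "z' \<in> upper_half_plane" unfolding z'_def by (rule uhp_inv4[OF line_point(1)])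
  have D0: "D > 0" unfolding D_def by (simp add: add_nonneg_pos)
  have "r ^ 2 \<le> (1 / 6) ^ 2" using r by (intro power_mono) auto
  hence D1: "D \<le> 1 / 5" by (simp add: D_def power2_eq_square)
  have rD: "4 / 5 * D \<le> r" "r \<le> D"
  proof -
    have "(r - 1 / 16) * (r - 1 / 4) \<le> 0" using r by (intro mult_nonneg_nonpos) auto
    thus "4 / 5 * D \<le> r" by (simp add: D_def power2_eq_square algebra_simps) argo
    have "0 \<le> (2 * r - 1 / 4) ^ 2" by simp
    thus "r \<le> D" by (simp add: D_def power2_eq_square algebra_simps)
  qed
  have q'n: "norm q' \<le> 198 / 10000"
  proof -
    have "norm q' = exp (- 2 * pi * (1 / (8 * D)))" unfolding q'_def norm_qe lp(3) by simp
    also have "5 / 8 \<le> 1 / (8 * D)" using D0 D1 by (simp add: field_simps)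
    hence "exp (- 2 * pi * (1 / (8 * D))) \<le> exp (- 2 * pi * (5 / 8))" by (rule exp_decay_mono)
    also have "\<dots> = rad ^ 5" unfolding rad_def by (simp flip: exp_of_nat_mult)
    also have "\<dots> \<le> (4561 / 10000) ^ 5" using rad_bounds rad_pos by (intro power_mono) auto
    finally show ?thesis by (simp add: eval_nat_numeral)
  qed
  have req: "1 / 5 * norm q' \<le> Re q'"
  proof -
    define t where "t = 2 * pi * (Re z' + 1)"
    have "0 \<le> Re z' + 1" "Re z' + 1 \<le> 1 / 5" using rD D0 by (simp_all add: lp(4) field_simps)
    hence "2 * pi * 0 \<le> t" "t \<le> 2 * pi * (1 / 5)" unfolding t_def by (intro mult_left_mono; simp)+
    hence t: "0 \<le> t" "t \<le> 12567 / 10000" using pi_approx by simp_all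
    hence "t ^ 2 \<le> (12567 / 10000) ^ 2" by (intro power_mono)
    hence "1 / 5 \<le> cos t" using cos_ge_quadratic[of t] by (simp add: power2_eq_square)
    moreover have "Re q' = norm q' * cos t"
    proof -
      have "cos t = cos (2 * pi * Re z' + 2 * pi)" by (simp add: t_def algebra_simps)
      also have "\<dots> = cos (2 * pi * Re z')" by simp
      finally have "cos t = cos (2 * pi * Re z')" .
      thus ?thesis unfolding q'_def norm_qe by (simp add: qe_def Re_exp)
    qed
    ultimately show ?thesis using mult_left_mono[of "1 / 5" "cos t" "norm q'"] by simp
  qed
  define T where "T = tri q' ^ 4"
  have "norm (tri q' - 1) \<le> 4 / 10000" using tri_dev[OF q'n] by (simp add: eval_nat_numeral)
  hence T: "norm (T - 1) \<le> 2 / 1000"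
    using norm_pow4_dev[of "tri q'" 1 "4 / 10000" 1] by (simp add: T_def eval_nat_numeral)
  have "norm (- q') \<le> 198 / 10000" using q'n by simp
  from theta3_dev[OF this] have "norm (theta3 (- q') - 1 - 2 * (- q')) \<le> 1 / 10000" by (simp add: eval_nat_numeral)
  moreover have "norm (theta3 (- q') - 1) \<le> norm (theta3 (- q') - 1 - 2 * (- q')) + norm (2 * (- q'))"
    by (metis diff_add_cancel norm_triangle_ineq)
  ultimately have "norm (theta3 (- q') - 1) \<le> 397 / 10000" using q'n by (simp add: norm_mult)
  hence B: "norm (B - 1) \<le> 18 / 100"
    using norm_pow4_dev[of "theta3 (- q')" 1 "397 / 10000" 1] by (simp add: B_def eval_nat_numeral)
  define w where "w = T * cnj B"
  have "w - 1 = (T - 1) * cnj B + cnj (B - 1)" by (simp add: w_def algebra_simps)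
  hence "norm (w - 1) \<le> norm (T - 1) * norm B + norm (B - 1)"
    using norm_triangle_ineq[of "(T - 1) * cnj B" "cnj (B - 1)"] by (simp only: norm_mult complex_mod_cnj)
  also have "norm B \<le> 2" using norm_triangle_ineq[of "B - 1" 1] B by simp
  hence "norm (T - 1) * norm B \<le> 2 / 1000 * 2" using T by (intro mult_mono) auto
  finally have w: "norm (w - 1) \<le> 1 / 5" using B by linarith
  have "Re (q' * (w - 1)) \<ge> - norm (q' * (w - 1))" using abs_Re_le_cmod[of "q' * (w - 1)"] by linarith
  moreover have "norm (q' * (w - 1)) \<le> norm q' * (1 / 5)" unfolding norm_mult by (rule mult_left_mono[OF w]) simp
  moreover have "Re (q' * w) = Re q' + Re (q' * (w - 1))" by (simp add: algebra_simps)
  ultimately have pos: "0 \<le> Re (q' * w)" using req by linarith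
  have "E * cnj B = of_real 16 * (q' * w)" by (simp add: E_def eis_def w_def T_def algebra_simps)
  moreover have "Re (of_real 16 * v) = 16 * Re v" for v by simp
  ultimately have "Re (E * cnj B) = 16 * Re (q' * w)" by (simp only:)
  hence EB: "0 \<le> Re (E * cnj B)" using pos by linarith
  have q'1: "norm q' < 1" unfolding q'_def by (rule norm_qe_less_1[OF zH])
  have "(1 - of_real x) * A + of_real x * E = of_real (1 - x) * B + E"
    using jacobi_quartic[OF q'1] by (simp add: A_def B_def E_def algebra_simps)
  hence F: "norm E \<le> norm ((1 - of_real x) * A + of_real x * E)"
    using norm_add_obtuse[OF EB, of "1 - x"] x by simp
  have nq: "norm q \<le> 4561 / 10000" using lp(5) rad_bounds unfolding q by simp
  have "norm (theta3 q - 1 - 2 * q) \<le> 884 / 10000" using theta3_dev[OF nq] by (simp add: eval_nat_numeral)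
  moreover have "norm (theta3 q) \<le> norm (theta3 q - 1 - 2 * q) + norm (1 + 2 * q)"
    using norm_triangle_ineq[of "theta3 q - 1 - 2 * q" "1 + 2 * q"] by simp
  moreover have "norm (1 + 2 * q) \<le> 1 + 2 * norm q" using norm_triangle_ineq[of 1 "2 * q"] by (simp add: norm_mult)
  ultimately have "norm (theta3 q) \<le> 20006 / 10000" using nq by linarith
  hence "norm (theta3 q) ^ 4 \<le> (20006 / 10000) ^ 4" by (intro power_mono) auto
  hence t21: "norm (theta3 q ^ 4) \<le> 21" unfolding norm_power by (simp add: eval_nat_numeral)
  have "norm (theta3 q ^ 4 * theta3 (- q) ^ 4) = norm (theta3 q ^ 4) * (norm c * norm E)"
    unfolding q id(2) by (simp only: norm_mult)
  also have "\<dots> \<le> 21 * (norm c * norm ((1 - of_real x) * A + of_real x * E))"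
    by (intro mult_mono t21 mult_left_mono F) auto
  also have "\<dots> = 21 * norm (pencil (of_real x) q)" unfolding q id(4) by (simp only: norm_mult)
  finally show ?thesis .
qed

lemma kernel_bound_quarter:
  assumes r: "0 \<le> r" "r \<le> 1 / 4" and q: "q = qe (of_real r + \<i> / 8)" and x: "14 / 10000 \<le> x" "x \<le> 1 - 14 / 10000"
  shows "norm (theta3 q ^ 4 * theta3 (- q) ^ 4) \<le> 21 * norm (pencil (of_real x) q)"
proof -
  consider "r \<le> 1 / 16" | "1 / 16 \<le> r" "r \<le> 1 / 6" | "1 / 6 \<le> r" by linarith
  thus ?thesis
    using kernel_bound_cusp[of r q x] kernel_bound_horn[of r q x] kernel_bound_middle[of r q x] r q x by cases auto
qed

text \<open>
  Conjugation and \<open>q \<mapsto> - q\<close>, which exchanges \<open>x\<close> and \<open>1 - x\<close>, reduce the circle to a quarter of it.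
\<close>

theorem kernel_bound:
  assumes q: "norm q = rad" and x: "14 / 10000 \<le> x" "x \<le> 1 - 14 / 10000"
  shows "norm (theta3 q ^ 4 * theta3 (- q) ^ 4) \<le> 21 * norm (pencil (of_real x) q)"
proof -
  have q0: "norm q < 1" "q \<noteq> 0" using q rad_pos by auto
  obtain z where z: "z \<in> upper_half_plane" "qe z = q" using qe_surj[OF q0] .
  have "exp (- 2 * pi * Im z) = exp (- pi / 4)" using q norm_qe[of z] z(2) by (simp add: rad_def)
  hence im: "Im z = 1 / 8" by simp
  define n r where "n = \<lfloor>Re z\<rfloor>" and "r = Re z - of_int n"
  have r: "0 \<le> r" "r < 1" unfolding r_def n_def by linarith+
  have qr: "q = qe (of_real r + \<i> / 8)"
  proof -
    have "z = (of_real r + \<i> / 8) + of_int n" using im by (simp add: complex_eq_iff r_def)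
    moreover have "qe (w + of_int n) = qe w" for w
    proof -
      have "2 * of_real pi * \<i> * (w + of_int n) = 2 * of_real pi * \<i> * w + of_int (2 * n) * (of_real pi * \<i>)"
        by (simp add: algebra_simps)
      thus ?thesis unfolding qe_def by (simp only:) (simp add: exp_add exp_integer_2pi mult_ac)
    qed
    ultimately show ?thesis using z(2) by simp
  qed
  have cn: "qe (of_real (- r) + \<i> / 8) = cnj (qe (of_real r + \<i> / 8))" for r
  proof -
    have "2 * of_real pi * \<i> * (of_real (- r) + \<i> / 8) = cnj (2 * of_real pi * \<i> * (of_real r + \<i> / 8))"
      by (simp add: complex_eq_iff)
    thus ?thesis unfolding qe_def exp_cnj by (rule arg_cong)
  qed
  have hf: "qe (of_real (r + 1 / 2) + \<i> / 8) = - qe (of_real r + \<i> / 8)" for r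
    using qe_add_half[of "of_real r + \<i> / 8"] by (simp add: add_ac)
  have on: "qe (of_real (r + 1) + \<i> / 8) = qe (of_real r + \<i> / 8)" for r
    using qe_add_1[of "of_real r + \<i> / 8"] by (simp add: add_ac)
  have pm: "pencil x (- q) = pencil (1 - x) q" for x q by (simp add: pencil_def)
  have pc: "pencil (of_real x) (cnj q) = cnj (pencil (of_real x) q)" if "norm q < 1" for x q
    using that theta3_cnj[of q] theta3_cnj[of "- q"] by (simp add: pencil_def)
  have sym: "?thesis" if p: "p = qe (of_real s + \<i> / 8)" "0 \<le> s" "s \<le> 1 / 4" "q \<in> {p, - p, cnj p, - cnj p}" for p s
  proof -
    have b: "norm (theta3 p ^ 4 * theta3 (- p) ^ 4) \<le> 21 * norm (pencil (of_real x) p)"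
      using kernel_bound_quarter[OF p(2,3,1) x] .
    have "14 / 10000 \<le> 1 - x" "1 - x \<le> 1 - 14 / 10000" using x by auto
    from kernel_bound_quarter[OF p(2,3,1) this]
    have b': "norm (theta3 p ^ 4 * theta3 (- p) ^ 4) \<le> 21 * norm (pencil (1 - of_real x) p)" by simp
    have np: "norm p < 1" using p(1) line_point(5)[of s] rad_pos by simp
    have tc: "theta3 (cnj p) = cnj (theta3 p)" "theta3 (- cnj p) = cnj (theta3 (- p))"
      using theta3_cnj[OF np] theta3_cnj[of "- p"] np by simp_all
    have pc': "norm (pencil (of_real x) (cnj p)) = norm (pencil (of_real x) p)" "norm (pencil (1 - of_real x) (cnj p)) = norm (pencil (1 - of_real x) p)"
      using pc[OF np, of x] pc[OF np, of "1 - x"] by (simp_all add: pm)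
    show ?thesis using p(4) b b' by (auto simp: pm tc pc' norm_mult norm_power mult.commute)
  qed
  consider "r \<le> 1 / 4" | "1 / 4 \<le> r" "r \<le> 1 / 2" | "1 / 2 \<le> r" "r \<le> 3 / 4" | "3 / 4 \<le> r" by linarith
  thus ?thesis
  proof cases
    case 1
    thus ?thesis using sym[of q r] qr r by simp
  next
    case 2
    have "q = - cnj (qe (of_real (1 / 2 - r) + \<i> / 8))"
      using cn[of "1 / 2 - r"] hf[of "r - 1 / 2"] qr by simp
    thus ?thesis using sym[OF refl, of "1 / 2 - r"] 2 by simp
  next
    case 3
    have "q = - qe (of_real (r - 1 / 2) + \<i> / 8)" using hf[of "r - 1 / 2"] qr by simp
    thus ?thesis using sym[OF refl, of "r - 1 / 2"] 3 by simp
  next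
    case 4
    have "q = cnj (qe (of_real (1 - r) + \<i> / 8))" using cn[of "1 - r"] on[of "r - 1"] qr by simp
    thus ?thesis using sym[OF refl, of "1 - r"] 4 r by simp
  qed
qed

lemma pencil_nonzero:
  assumes "norm q = rad" "14 / 10000 \<le> x" "x \<le> 1 - 14 / 10000" shows "pencil (of_real x) q \<noteq> 0"
proof
  assume "pencil (of_real x) q = 0"
  hence "theta3 q ^ 4 * theta3 (- q) ^ 4 = 0" using kernel_bound[OF assms] by simp
  thus False using theta3_nonzero[of q] theta3_nonzero[of "- q"] assms(1) rad_pos by simp
qed

text \<open>
  The lower bound for the pencil is uniform in \<open>x\<close>, so the number of zeros does not change as \<open>x\<close> moves
  to \<open>1/2\<close>.
\<close>

lemma pencil_zero_count:
  assumes x: "14 / 10000 \<le> x" "x \<le> 1 - 14 / 10000"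
  shows "(\<Sum>p\<in>zeros_within rad (pencil (of_real x)). zorder (pencil (of_real x)) p) = 2"
proof -
  have "(\<Sum>p\<in>zeros_within rad (pencil (of_real x)). zorder (pencil (of_real x)) p) =
      (\<Sum>p\<in>zeros_within rad (pencil (1 / 2)). zorder (pencil (1 / 2)) p)"
  proof (rule zero_count_homotopy[OF rad_pos pencil_holomorphic pencil_holomorphic])
    fix q :: complex and u :: real assume q: "norm q = rad" and u: "0 \<le> u" "u \<le> 1"
    define y where "y = (1 - u) * x + u * (1 / 2)"
    have "(1 - u) * (14 / 10000) \<le> (1 - u) * x" "(1 - u) * x \<le> (1 - u) * (1 - 14 / 10000)"
      using u x by (intro mult_left_mono; simp)+
    hence y: "14 / 10000 \<le> y" "y \<le> 1 - 14 / 10000" using u unfolding y_def by argo+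
    have "(1 - of_real u) * pencil (of_real x) q + of_real u * pencil (1 / 2) q = pencil (of_real y) q"
      by (simp add: pencil_def y_def algebra_simps)
    thus "(1 - of_real u) * pencil (of_real x) q + of_real u * pencil (1 / 2) q \<noteq> 0"
      using pencil_nonzero[OF q y] by simp
  qed
  thus ?thesis using pencil_half_zero_count by simp
qed

section \<open>The lower boundary arc\<close>

text \<open>
  The classical modular function \<open>\<lambda>\<close> at \<open>i y\<close>.
\<close>

definition modular_lambda :: "real \<Rightarrow> real" where "modular_lambda y = R2 y ^ 2 / R3 y ^ 4"

lemma one_minus_modular_lambda: assumes "y > 0" shows "1 - modular_lambda y = R4 y ^ 4 / R3 y ^ 4"
proof -
  have "R3 y ^ 4 \<noteq> 0" using R3_ge_1[OF assms] by simp
  hence "1 - modular_lambda y = (R3 y ^ 4 - R2 y ^ 2) / R3 y ^ 4" by (simp add: modular_lambda_def diff_divide_distrib)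
  thus ?thesis using R_double(5)[OF assms] by simp
qed

text \<open>
  The value determines both moduli, these determine the two arithmetic-geometric means \<open>1 / R3^2\<close> and
  \<open>1 / (y R3^2)\<close>, and their quotient is \<open>y\<close>.
\<close>

lemma modular_lambda_inj: assumes "x > 0" "y > 0" "modular_lambda x = modular_lambda y" shows "x = y"
proof -
  have pos: "R2 t / R3 t ^ 2 > 0" "R4 t ^ 2 / R3 t ^ 2 > 0" if "t > 0" for t
    using R2_pos[OF that] R3_ge_1[OF that] R4_pos[OF that] by simp_all
  have "(R2 x / R3 x ^ 2) ^ 2 = (R2 y / R3 y ^ 2) ^ 2"
    using assms(3) by (simp add: modular_lambda_def power_divide flip: power_mult)
  hence k: "R2 x / R3 x ^ 2 = R2 y / R3 y ^ 2" using pos assms by (simp add: power2_eq_iff_nonneg less_imp_le)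
  have "(R4 x ^ 2 / R3 x ^ 2) ^ 2 = (R4 y ^ 2 / R3 y ^ 2) ^ 2"
    using one_minus_modular_lambda[OF assms(1)] one_minus_modular_lambda[OF assms(2)] assms(3) by (simp add: power_divide flip: power_mult)
  hence p: "R4 x ^ 2 / R3 x ^ 2 = R4 y ^ 2 / R3 y ^ 2" using pos assms by (simp add: power2_eq_iff_nonneg less_imp_le)
  have e1: "1 / R3 x ^ 2 = 1 / R3 y ^ 2"
    using LIMSEQ_unique[OF agm_limit_R4[OF assms(1)]] agm_limit_R4[OF assms(2)] p by simp
  have "1 / (x * R3 x ^ 2) = 1 / (y * R3 y ^ 2)"
    using LIMSEQ_unique[OF agm_limit_R2[OF assms(1)]] agm_limit_R2[OF assms(2)] k by simp
  thus ?thesis using e1 R3_ge_1[OF assms(1)] R3_ge_1[OF assms(2)] assms by simp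
qed

text \<open>
  The absolute value of \<open>eis\<close> at the point of the lower arc with parameter \<open>y\<close>; see \<open>eis_arc\<close>.
\<close>

definition arc_modulus :: "real \<Rightarrow> real" where "arc_modulus y = (1 + y ^ 2) * R3 y ^ 4 / 16"

lemma eis_nome: assumes "y > 0" shows "16 * eis (nome y) = of_real (R2 y ^ 2)"
proof -
  have "complex_of_real (R3 y ^ 4 - R4 y ^ 4) = of_real (R2 y ^ 2)" using R_double(5)[OF assms] by simp
  thus ?thesis using jacobi_quartic[OF norm_nome[OF assms]] assms by (simp add: theta_nome)
qed

text \<open>
  A real Moebius transformation carries the positive imaginary axis, parametrized by \<open>i y\<close>, to the left
  lower arc. The angle \<open>\<theta>\<close> at the centre \<open>-1/4\<close> satisfies \<open>y = tan (\<theta> / 2)\<close>.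
\<close>

definition lower_arc :: "real \<Rightarrow> complex" where "lower_arc y = \<i> * of_real y / (2 * (1 - \<i> * of_real y))"

lemma one_minus_iy [simp]: "1 - \<i> * complex_of_real y \<noteq> 0" "1 + \<i> * complex_of_real y \<noteq> 0"
  by (simp_all add: complex_eq_iff)

lemma arc_uhp: assumes "y > 0" shows "lower_arc y \<in> upper_half_plane"
  using assms by (simp add: lower_arc_def upper_half_plane_def Im_divide power2_eq_square add_pos_nonneg divide_pos_pos)

text \<open>
  The transformation \<open>w \<mapsto> w / (1 - 2 w)\<close> from \<open>w = i y / 2\<close> to the arc is a Fricke involution, a
  translation by \<open>1/2\<close> and another Fricke involution; each of them permutes the three theta functions up
  to weight factors. Hence \<open>psi\<close> on the arc is \<open>\<lambda>\<close> on the imaginary axis, and in particular real.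
\<close>

lemma
  assumes y: "y > 0"
  shows eis_arc: "16 * eis (qe (lower_arc y)) = (1 - \<i> * of_real y) ^ 2 * of_real (R3 y ^ 4)"
    and psi_arc: "psi (qe (lower_arc y)) = of_real (modular_lambda y)"
proof -
  define w where "w = \<i> * complex_of_real y / 2"
  have wH: "w \<in> upper_half_plane" using y by (simp add: w_def upper_half_plane_def)
  define v where "v = - 1 / (4 * w)"
  have vH: "v \<in> upper_half_plane" unfolding v_def by (rule uhp_inv4[OF wH])
  have uH: "v + 1 / 2 \<in> upper_half_plane" using uhp_shift[OF vH, of "1 / 2"] by simp
  have w0: "w \<noteq> 0" "v + 1 / 2 \<noteq> 0" "2 * w - 1 \<noteq> 0"
    using uhp_nonzero[OF wH] uhp_nonzero[OF uH] uhp_denominator_nonzero[OF wH, of 2 "-1"] by simp_all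
  have v2: "(v + 1 / 2) * (4 * w) = 2 * w - 1" using w0 by (simp add: v_def field_simps)
  have a: "lower_arc y = - 1 / (4 * (v + 1 / 2))"
  proof -
    obtain u where u: "u = v + 1 / 2" by simp
    have h: "- 1 * (1 - 2 * w) = w * (4 * u)" "4 * u \<noteq> 0" "1 - 2 * w \<noteq> 0"
      using v2 w0 unfolding u[symmetric] by (simp_all add: algebra_simps)
    have "- 1 / (4 * (v + 1 / 2)) = w / (1 - 2 * w)"
      unfolding u[symmetric] by (rule frac_eq_eq[THEN iffD2, OF h(2,3,1)])
    also have "\<dots> = lower_arc y" by (simp add: w_def lower_arc_def field_simps)
    finally show ?thesis by simp
  qed
  have m: "(- 4 * (v + 1 / 2) ^ 2) * (- 4 * w ^ 2) = (1 - \<i> * of_real y) ^ 2"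
  proof -
    have "(- 4 * (v + 1 / 2) ^ 2) * (- 4 * w ^ 2) = ((v + 1 / 2) * (4 * w)) ^ 2" by (simp add: power_mult_distrib)
    also have "\<dots> = (2 * w - 1) ^ 2" by (simp only: v2)
    also have "\<dots> = (1 - \<i> * of_real y) ^ 2" by (simp add: w_def power2_commute)
    finally show ?thesis .
  qed
  have qw: "qe w = nome y" unfolding w_def by (rule qe_imaginary)
  have t3: "theta3 (- qe (v + 1 / 2)) ^ 4 = - 4 * w ^ 2 * theta3 (nome y) ^ 4"
    using theta3_inversion[OF wH] unfolding qe_add_half v_def[symmetric] qw minus_minus .
  have t4: "theta3 (qe (v + 1 / 2)) ^ 4 = - 4 * w ^ 2 * (16 * eis (nome y))"
    using theta4_inversion[OF wH] unfolding qe_add_half v_def[symmetric] qw by (simp only: mult.assoc)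
  have "16 * eis (qe (lower_arc y)) = - 4 * (v + 1 / 2) ^ 2 * theta3 (- qe (v + 1 / 2)) ^ 4"
    unfolding a by (rule eis_inversion[OF uH])
  also have "\<dots> = (- 4 * (v + 1 / 2) ^ 2) * (- 4 * w ^ 2) * theta3 (nome y) ^ 4"
    unfolding t3 by (simp only: mult.assoc)
  finally show 1: "16 * eis (qe (lower_arc y)) = (1 - \<i> * of_real y) ^ 2 * of_real (R3 y ^ 4)"
    unfolding m using y by (simp add: theta_nome)
  have "theta3 (qe (lower_arc y)) ^ 4 = - 4 * (v + 1 / 2) ^ 2 * theta3 (qe (v + 1 / 2)) ^ 4"
    unfolding a by (rule theta3_inversion[OF uH])
  also have "\<dots> = (- 4 * (v + 1 / 2) ^ 2) * (- 4 * w ^ 2) * (16 * eis (nome y))"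
    unfolding t4 by (simp only: mult.assoc)
  finally have 2: "theta3 (qe (lower_arc y)) ^ 4 = (1 - \<i> * of_real y) ^ 2 * of_real (R2 y ^ 2)"
    unfolding m eis_nome[OF y] .
  show "psi (qe (lower_arc y)) = of_real (modular_lambda y)" unfolding psi_def 1 2 by (simp add: modular_lambda_def)
qed

lemma arc_angle: assumes "\<theta> \<in> {0<..<pi}" shows "lower_arc (tan (\<theta> / 2)) = - 1 / 4 + 1 / 4 * exp (\<i> * of_real \<theta>)"
  and "(1 - \<i> * of_real (tan (\<theta> / 2))) ^ 2 = of_real (1 + tan (\<theta> / 2) ^ 2) * exp (- (\<i> * of_real \<theta>))"
  and "tan (\<theta> / 2) > 0"
proof -
  define c s where "c = cos (\<theta> / 2)" and "s = sin (\<theta> / 2)"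
  have c: "c > 0" "s > 0" using assms by (auto simp: c_def s_def intro!: cos_gt_zero_pi sin_gt_zero)
  have cs: "c ^ 2 + s ^ 2 = 1" by (simp add: c_def s_def)
  have t: "tan (\<theta> / 2) = s / c" by (simp add: tan_def c_def s_def)
  thus "tan (\<theta> / 2) > 0" using c by simp
  define E where "E = of_real c + \<i> * complex_of_real s"
  define F where "F = of_real c - \<i> * complex_of_real s"
  have EF: "E * F = 1"
  proof -
    have "E * F = of_real (c ^ 2 + s ^ 2)" by (simp add: E_def F_def algebra_simps power2_eq_square)
    thus ?thesis unfolding cs by simp
  qed
  have e2: "exp (\<i> * of_real \<theta>) = E ^ 2"
  proof -
    have "E = cis (\<theta> / 2)" by (simp add: complex_eq_iff E_def c_def s_def)
    hence "E ^ 2 = cis \<theta>" by (simp add: Complex.DeMoivre)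
    thus ?thesis by (simp add: cis_conv_exp)
  qed
  have e3: "exp (- (\<i> * of_real \<theta>)) = F ^ 2"
  proof -
    have "exp (- (\<i> * of_real \<theta>)) * E ^ 2 = 1" by (simp flip: e2 exp_add)
    moreover have "F ^ 2 * E ^ 2 = 1" using EF by (simp add: mult.commute flip: power_mult_distrib)
    ultimately show ?thesis by (metis mult.commute mult_cancel_right1 mult.assoc)
  qed
  have F0: "F \<noteq> 0" "E \<noteq> 0" using EF by auto
  have den: "1 - \<i> * of_real (tan (\<theta> / 2)) = F / of_real c" using c by (simp add: t F_def diff_divide_distrib)
  have "lower_arc (tan (\<theta> / 2)) = \<i> * of_real s / (2 * F)" unfolding lower_arc_def den using c by (simp add: t)
  also have "\<i> * of_real s = (E - F) / 2" by (simp add: E_def F_def)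
  also have "(E - F) / 2 / (2 * F) = - 1 / 4 + 1 / 4 * (E / F)" using F0 by (simp add: field_simps)
  also have "E / F = E ^ 2" using EF F0 by (simp add: field_simps power2_eq_square)
  finally show "lower_arc (tan (\<theta> / 2)) = - 1 / 4 + 1 / 4 * exp (\<i> * of_real \<theta>)" unfolding e2 .
  have "1 + tan (\<theta> / 2) ^ 2 = 1 / c ^ 2" using cs c by (simp add: t field_simps power_divide)
  thus "(1 - \<i> * of_real (tan (\<theta> / 2))) ^ 2 = of_real (1 + tan (\<theta> / 2) ^ 2) * exp (- (\<i> * of_real \<theta>))"
    unfolding den e3 by (simp add: power_divide)
qed

lemma pos_powi: "(x::real) > 0 \<Longrightarrow> x powi n = exp (of_int n * ln x)"
  using exp_power_int[of "ln x" n] by simp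

text \<open>
  On the arc \<open>Im z = sin \<theta> / 4\<close> and \<open>Re z = (cos \<theta> - 1) / 4\<close>, which gives the factor \<open>q^(-m)\<close>; by
  \<open>eis_arc\<close> the argument of \<open>eis\<close> is \<open>- \<theta>\<close>.
\<close>

theorem seed_arc:
  assumes \<theta>: "\<theta> \<in> {0<..<pi}"
  defines "y \<equiv> tan (\<theta> / 2)"
  shows "seed l m (qe (lower_arc y)) = of_real (exp (pi * m * sin \<theta> / 2 - l * ln (arc_modulus y))) *
    exp (\<i> * of_real (pi * m / 2 - pi * m / 2 * cos \<theta> + l * \<theta>))"
proof -
  have y: "y > 0" unfolding y_def by (rule arc_angle(3)[OF \<theta>])
  have h: "arc_modulus y > 0" using R3_ge_1[OF y] by (simp add: arc_modulus_def add_pos_nonneg)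
  have "16 * eis (qe (lower_arc y)) = 16 * (of_real (arc_modulus y) * exp (- (\<i> * of_real \<theta>)))"
    unfolding eis_arc[OF y] using arc_angle(2)[OF \<theta>] by (simp add: y_def arc_modulus_def)
  hence "eis (qe (lower_arc y)) = of_real (arc_modulus y) * exp (- (\<i> * of_real \<theta>))" by (simp only: mult_cancel_left) simp
  hence "eis (qe (lower_arc y)) powi (- l) = of_real (arc_modulus y powi (- l)) * exp (of_int l * (\<i> * of_real \<theta>))"
    by (simp add: power_int_mult_distrib exp_power_int)
  also have "arc_modulus y powi (- l) = exp (- of_int l * ln (arc_modulus y))" using pos_powi[OF h, of "- l"] by simp
  finally have e: "eis (qe (lower_arc y)) powi (- l) =
      of_real (exp (- of_int l * ln (arc_modulus y))) * exp (of_int l * (\<i> * of_real \<theta>))" .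
  have "qe (lower_arc y) powi (- m) = exp (- of_int m * (2 * of_real pi * \<i> * (- 1 / 4 + 1 / 4 * exp (\<i> * of_real \<theta>))))"
    unfolding y_def arc_angle(1)[OF \<theta>] qe_def exp_power_int by simp
  also have "- of_int m * (2 * of_real pi * \<i> * (- 1 / 4 + 1 / 4 * exp (\<i> * of_real \<theta>))) =
      of_real (pi * m * sin \<theta> / 2) + \<i> * of_real (pi * m / 2 - pi * m / 2 * cos \<theta>)"
    by (simp add: exp_Euler cos_of_real sin_of_real complex_eq_iff algebra_simps)
  finally have q: "qe (lower_arc y) powi (- m) =
      exp (of_real (pi * m * sin \<theta> / 2) + \<i> * of_real (pi * m / 2 - pi * m / 2 * cos \<theta>))" .
  show ?thesis unfolding seed_def e q
    by (simp add: exp_of_real[symmetric] algebra_simps flip: exp_add)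
qed

lemma arc_modulus_inverse: "y > 0 \<Longrightarrow> arc_modulus (1 / y) = arc_modulus y"
proof -
  assume y: "y > 0"
  have "R3 (1 / y) ^ 4 = (R3 (1 / y) ^ 2) ^ 2" by (simp flip: power_mult)
  also have "\<dots> = y ^ 2 * R3 y ^ 4" by (simp add: R3_inversion[OF y] power_mult_distrib flip: power_mult)
  finally show ?thesis using y by (simp add: arc_modulus_def field_simps)
qed

lemma modular_lambda_inverse: "y > 0 \<Longrightarrow> modular_lambda (1 / y) = 1 - modular_lambda y"
proof -
  assume y: "y > 0"
  have "R3 (1 / y) ^ 4 = (R3 (1 / y) ^ 2) ^ 2" by (simp flip: power_mult)
  also have "\<dots> = y ^ 2 * R3 y ^ 4" by (simp add: R3_inversion[OF y] power_mult_distrib flip: power_mult)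
  finally show ?thesis using y unfolding one_minus_modular_lambda[OF y]
    by (simp add: modular_lambda_def R2_inversion power_mult_distrib flip: power_mult)
qed

lemma R3_upper: assumes "y > 0" "exp (- pi * y) \<le> r" "r \<le> 44 / 1000" shows "R3 y ^ 4 \<le> (1 + 2 * r + 1 / 10000) ^ 4"
proof -
  have r: "0 \<le> r" using assms(2) exp_ge_zero order_trans by blast
  have n: "norm (nome y) \<le> r" using assms(2) by (simp add: nome_def)
  hence "norm (nome y) \<le> 44 / 1000" using assms(3) by linarith
  from theta3_dev[OF this] have "norm (theta3 (nome y) - 1 - 2 * nome y) \<le> 1 / 10000" by (simp add: eval_nat_numeral)
  moreover have "norm (theta3 (nome y)) \<le> norm (theta3 (nome y) - 1 - 2 * nome y) + norm (1 + 2 * nome y)"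
    using norm_triangle_ineq[of "theta3 (nome y) - 1 - 2 * nome y" "1 + 2 * nome y"] by simp
  moreover have "norm (1 + 2 * nome y) \<le> 1 + 2 * norm (nome y)"
    using norm_triangle_ineq[of 1 "2 * nome y"] by (simp add: norm_mult)
  ultimately have "norm (theta3 (nome y)) \<le> 1 + 2 * r + 1 / 10000" using n by linarith
  hence "R3 y \<le> 1 + 2 * r + 1 / 10000" using theta_nome(1)[OF assms(1)] by simp
  thus ?thesis using R3_ge_1[OF assms(1)] by (intro power_mono) auto
qed

text \<open>
  At parameters at least \<open>1\<close> the nome \<open>exp (- \<pi> y)\<close> is at most \<open>0.0433\<close> and the theta values are close
  to \<open>1\<close>. The upper limit on \<open>y\<close> is what keeps \<open>\<lambda>\<close> at the distance from \<open>0\<close> that \<open>kernel_bound\<close> asks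
  for.
\<close>

lemma arc_modulus_bounds:
  assumes y: "1 \<le> y" "1 + y ^ 2 \<le> 8865 / 1000"
  shows "(1 + y ^ 2) / 16 \<le> arc_modulus y" "arc_modulus y \<le> 57 / 100" "14 / 10000 \<le> modular_lambda y" "modular_lambda y \<le> 1 - 14 / 10000"
proof -
  have y0: "y > 0" using y by simp
  have "1 \<le> R3 y ^ 4" using R3_ge_1[OF y0] by simp
  hence "(1 + y ^ 2) * 1 \<le> (1 + y ^ 2) * R3 y ^ 4" by (intro mult_left_mono) auto
  thus "(1 + y ^ 2) / 16 \<le> arc_modulus y" by (simp add: arc_modulus_def)
  have "exp (- pi * y) \<le> exp (- pi * 1)" using y by simp
  also have "\<dots> = rad ^ 4" unfolding rad_def by (simp flip: exp_of_nat_mult)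
  also have "\<dots> \<le> (4561 / 10000) ^ 4" using rad_bounds rad_pos by (intro power_mono) auto
  finally have e1: "exp (- pi * y) \<le> 433 / 10000" by (simp add: eval_nat_numeral)
  have "R3 y ^ 4 \<le> (1 + 2 * (433 / 10000) + 1 / 10000) ^ 4" using R3_upper[OF y0 e1] by simp
  hence R1: "R3 y ^ 4 \<le> 14 / 10" by (simp add: eval_nat_numeral)
  show "arc_modulus y \<le> 57 / 100"
  proof (cases "y \<le> 2")
    case True
    have "y ^ 2 \<le> 2 ^ 2" using True y by (intro power_mono) auto
    hence "(1 + y ^ 2) * R3 y ^ 4 \<le> 5 * (14 / 10)" using R1 by (intro mult_mono) auto
    thus ?thesis by (simp add: arc_modulus_def)
  next
    case False
    hence "exp (- pi * y) \<le> exp (- pi * 2)" by simp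
    also have "\<dots> = rad ^ 8" unfolding rad_def by (simp flip: exp_of_nat_mult)
    also have "\<dots> \<le> (4561 / 10000) ^ 8" using rad_bounds rad_pos by (intro power_mono) auto
    finally have e2: "exp (- pi * y) \<le> 19 / 10000" by (simp add: eval_nat_numeral)
    have "R3 y ^ 4 \<le> (1 + 2 * (19 / 10000) + 1 / 10000) ^ 4" using R3_upper[OF y0 e2] by simp
    hence "R3 y ^ 4 \<le> 1017 / 1000" by (simp add: eval_nat_numeral)
    hence "(1 + y ^ 2) * R3 y ^ 4 \<le> 8865 / 1000 * (1017 / 1000)" using y by (intro mult_mono) auto
    thus ?thesis by (simp add: arc_modulus_def)
  qed
  show "14 / 10000 \<le> modular_lambda y"
  proof -
    have "y ^ 2 \<le> (2806 / 1000) ^ 2" using y by (simp add: power2_eq_square)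
    hence y2: "y \<le> 2806 / 1000" by (rule power2_le_imp_le) simp
    have "pi * y \<le> 3141593 / 1000000 * (2806 / 1000)" using pi_approx y y2 by (intro mult_mono) auto
    hence py: "pi * y \<le> 8816 / 1000" by simp
    \<comment> \<open>\<open>\<pi> y\<close> is at most \<open>8.816\<close>, which is \<open>11 \<pi> / 4\<close> up to less than \<open>0.177\<close>.\<close>
    have r11: "rad ^ 11 = exp (- (11 / 4) * pi)" unfolding rad_def by (simp flip: exp_of_nat_mult)
    have "- (11 / 4) * pi + - (177 / 1000) \<le> - pi * y" using py pi_approx by simp
    hence "exp (- (11 / 4) * pi + - (177 / 1000)) \<le> exp (- pi * y)" by (rule exp_le_cancel_iff[THEN iffD2])
    hence "rad ^ 11 * exp (- (177 / 1000)) \<le> exp (- pi * y)" unfolding r11 exp_add .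
    moreover have "1 + - (177 / 1000) \<le> exp (- (177 / 1000) :: real)" by (rule exp_ge_add_one_self)
    hence "(4558 / 10000) ^ 11 * (823 / 1000) \<le> rad ^ 11 * exp (- (177 / 1000))"
      using rad_bounds by (intro mult_mono power_mono) auto
    ultimately have ey: "14 / 100000 \<le> exp (- pi * y)" by (simp add: eval_nat_numeral)
    have T1: "1 \<le> Tr y"
    proof -
      have "Tr y = 1 + Re (tri (nome y) - 1)" by (simp add: Tr_def)
      moreover have "tri (nome y) = (\<Sum>n. of_real (exp (- pi * y) ^ (n * (n + 1))))" by (simp add: tri_def nome_def)
      moreover have s: "summable (\<lambda>n. exp (- pi * y) ^ (n * (n + 1)))"
        using tri_summable[of "exp (- pi * y)"] y0 by simp
      hence "(\<Sum>n. complex_of_real (exp (- pi * y) ^ (n * (n + 1)))) = of_real (\<Sum>n. exp (- pi * y) ^ (n * (n + 1)))"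
        by (simp add: suminf_of_real)
      moreover have "sum (\<lambda>n. exp (- pi * y) ^ (n * (n + 1))) {..<1} \<le> (\<Sum>n. exp (- pi * y) ^ (n * (n + 1)))"
        by (rule sum_le_suminf[OF s]) auto
      ultimately show ?thesis by (simp add: Tr_def)
    qed
    have "exp (- pi * y / 2) ^ 2 = exp (- pi * y)" by (simp flip: exp_double)
    hence "R2 y ^ 2 = 16 * exp (- pi * y) * Tr y ^ 4" by (simp add: R2_def power_mult_distrib flip: power_mult)
    also have "16 * exp (- pi * y) * Tr y ^ 4 \<ge> 16 * (14 / 100000) * 1" using ey T1 by (intro mult_mono) auto
    finally have "16 * (14 / 100000) / (14 / 10) \<le> modular_lambda y"
      unfolding modular_lambda_def using R1 \<open>1 \<le> R3 y ^ 4\<close> by (intro frac_le) auto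
    thus ?thesis by simp
  qed
  have "R4 y \<ge> 9 / 10"
  proof -
    have n: "norm (nome y) \<le> 433 / 10000" using e1 by (simp add: nome_def)
    hence n': "norm (- nome y) \<le> 433 / 10000" by simp
    from theta3_dev[OF n'] have "norm (theta3 (- nome y) - 1 - 2 * (- nome y)) \<le> 1 / 10000" by (simp add: eval_nat_numeral)
    moreover have "norm (theta3 (- nome y) - 1) \<le> norm (theta3 (- nome y) - 1 - 2 * (- nome y)) + norm (2 * (- nome y))"
      by (metis diff_add_cancel norm_triangle_ineq)
    ultimately have "norm (theta3 (- nome y) - 1) \<le> 1 / 10" using n by (simp add: norm_mult)
    moreover have "norm (theta3 (- nome y) - 1) = \<bar>R4 y - 1\<bar>"
      unfolding theta_nome(2)[OF y0] by (metis norm_of_real of_real_1 of_real_diff)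
    ultimately show ?thesis by linarith
  qed
  hence "(9 / 10) ^ 4 \<le> R4 y ^ 4" by (intro power_mono) auto
  hence "(9 / 10) ^ 4 / (14 / 10) \<le> R4 y ^ 4 / R3 y ^ 4" using R1 \<open>1 \<le> R3 y ^ 4\<close> by (intro frac_le) auto
  thus "modular_lambda y \<le> 1 - 14 / 10000" using one_minus_modular_lambda[OF y0] by (simp add: eval_nat_numeral)
qed

lemma eis_circle:
  assumes q: "norm q = rad" shows "17 / 100 \<le> norm (eis q)" "norm (eis q) \<le> 1003 / 1000"
proof -
  have n: "norm q \<le> 4561 / 10000" using q rad_bounds by simp
  have d: "norm (tri q - 1) \<le> 2175 / 10000" using tri_dev[OF n] by (simp add: eval_nat_numeral)
  have t: "7825 / 10000 \<le> norm (tri q)" "norm (tri q) \<le> 12175 / 10000"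
    using norm_triangle_ineq[of "tri q - 1" 1] norm_triangle_ineq2[of 1 "1 - tri q"] d by (simp_all add: norm_minus_commute)
  have "(7825 / 10000) ^ 4 \<le> norm (tri q) ^ 4" "norm (tri q) ^ 4 \<le> (12175 / 10000) ^ 4"
    using t by (auto intro!: power_mono)
  note p4 = this
  have b: "4558 / 10000 \<le> norm q" using q rad_bounds by simp
  have "4558 / 10000 * (7825 / 10000) ^ 4 \<le> norm q * norm (tri q) ^ 4"
    by (intro mult_mono b p4) auto
  moreover have "norm q * norm (tri q) ^ 4 \<le> 4561 / 10000 * (12175 / 10000) ^ 4"
    by (intro mult_mono n p4) auto
  ultimately show "17 / 100 \<le> norm (eis q)" "norm (eis q) \<le> 1003 / 1000"
    by (simp_all add: eis_def norm_mult norm_power eval_nat_numeral)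
qed

section \<open>Main term against error\<close>

lemma sin_cos_tenth:
  shows "998 / 10000 \<le> sin (1 / 10 :: real)" "995 / 1000 \<le> cos (1 / 10 :: real)" "cos (1 / 10 :: real) \<le> 99501 / 100000"
proof -
  have s: "x - x ^ 3 / 6 - x ^ 5 / 120 \<le> sin x" if "0 \<le> x" for x :: real
  proof -
    have "\<bar>sin x - (x - x ^ 3 / 6)\<bar> \<le> x ^ 5 / 120"
    proof -
      have c: "sin_coeff 2 = (0::real)" "sin_coeff 3 = - (1 / 6 :: real)" "sin_coeff 4 = (0::real)" "sin_coeff (Suc 0) = (1::real)"
        by (simp_all add: sin_coeff_def fact_numeral)
      have "{..<5} = {0, 1, 2, 3, 4::nat}" by auto
      hence e: "(\<Sum>m<5. sin_coeff m * x ^ m) = x - x ^ 3 / 6" by (simp add: c)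
      show ?thesis using Maclaurin_sin_bound[of x 5] that unfolding e by (simp add: fact_numeral)
    qed
    thus ?thesis by linarith
  qed
  show "998 / 10000 \<le> sin (1 / 10 :: real)" using s[of "1 / 10"] by (simp add: eval_nat_numeral)
  show "995 / 1000 \<le> cos (1 / 10 :: real)" using cos_ge_quadratic[of "1 / 10"] by (simp add: eval_nat_numeral)
  have "49979 / 1000000 \<le> sin (1 / 20 :: real)" using s[of "1 / 20"] by (simp add: eval_nat_numeral)
  hence "(49979 / 1000000) ^ 2 \<le> sin (1 / 20 :: real) ^ 2" by (intro power_mono) auto
  moreover have "cos (1 / 10 :: real) = 1 - 2 * sin (1 / 20) ^ 2" using cos_double_sin[of "1 / 20"] by simp
  ultimately show "cos (1 / 10 :: real) \<le> 99501 / 100000" by (simp add: power2_eq_square)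
qed

lemma sqrt2_half: "70710 / 100000 \<le> sqrt 2 / 2" "sqrt 2 / 2 \<le> 70711 / 100000"
  using real_le_rsqrt[of "141420 / 100000" 2] real_le_lsqrt[of "141422 / 100000" 2] by (simp_all add: power2_eq_square)

lemma sin_cos_range:
  assumes "\<bar>b\<bar> \<le> pi / 4 + 1 / 10"
  shows "6 / 10 \<le> cos b" "sin \<bar>b\<bar> \<le> 7743 / 10000"
proof -
  have p: "pi / 4 + 1 / 10 \<le> pi / 2" using pi_gt3 by argo
  have "sin \<bar>b\<bar> \<le> sin (pi / 4 + 1 / 10)" using assms p by (intro sin_monotone_2pi_le) auto
  also have "\<dots> = sqrt 2 / 2 * (sin (1 / 10) + cos (1 / 10))" by (simp add: sin_add sin_45 cos_45 algebra_simps)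
  also have "\<dots> \<le> 70711 / 100000 * (1 / 10 + 99501 / 100000)"
    using sqrt2_half sin_cos_tenth sin_x_le_x[of "1 / 10"] by (intro mult_mono) auto
  finally show "sin \<bar>b\<bar> \<le> 7743 / 10000" by simp
  have "70710 / 100000 * (995 / 1000 - 1 / 10) \<le> sqrt 2 / 2 * (cos (1 / 10) - sin (1 / 10))"
    using sqrt2_half sin_cos_tenth sin_x_le_x[of "1 / 10"] by (intro mult_mono) auto
  also have "\<dots> = cos (pi / 4 + 1 / 10)" by (simp add: cos_add sin_45 cos_45 algebra_simps)
  also have "\<dots> \<le> cos \<bar>b\<bar>" using assms p pi_gt_zero by (intro cos_monotone_0_pi_le) argo+
  finally show "6 / 10 \<le> cos b" by simp
qed

text \<open>
  The angle is measured from the top of the arc: \<open>b = \<pi>/2 - \<theta>\<close>. The symmetry \<open>b \<mapsto> - b\<close> is \<open>y \<mapsto> 1 / y\<close>,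
  so the bounds for \<open>y \<ge> 1\<close> suffice; there \<open>1 + y^2 = 2 / (1 - sin |b|)\<close>. The range of \<open>b\<close> exceeds
  \<open>\<pi>/4\<close> by \<open>1/10\<close> to leave room for rounding in the count.
\<close>

lemma arc_parameter:
  assumes b: "\<bar>b\<bar> \<le> pi / 4 + 1 / 10"
  defines "y \<equiv> tan ((pi / 2 - b) / 2)"
  shows "y > 0" "1 / (8 * (1 - sin \<bar>b\<bar>)) \<le> arc_modulus y" "arc_modulus y \<le> 57 / 100"
    "14 / 10000 \<le> modular_lambda y" "modular_lambda y \<le> 1 - 14 / 10000"
proof -
  define Y where "Y = tan ((pi / 2 + \<bar>b\<bar>) / 2)"
  have p: "pi / 4 + 1 / 10 < pi / 2" using pi_gt3 by argo
  have t: "tan (\<theta> / 2) > 0" if "0 < \<theta>" "\<theta> < pi" for \<theta> using arc_angle(3)[of \<theta>] that by simp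
  show y0: "y > 0" unfolding y_def by (rule t) (use b p in argo)+
  have Y0: "Y > 0" unfolding Y_def by (rule t) (use b p in argo)+
  have yY: "y = Y \<or> y = 1 / Y"
  proof (cases "b \<ge> 0")
    case True
    have "y = tan (pi / 2 - (pi / 2 + b) / 2)" unfolding y_def by (rule arg_cong[of _ _ tan]) argo
    thus ?thesis unfolding tan_cot using True by (simp add: Y_def inverse_eq_divide)
  qed (simp add: y_def Y_def)
  have s: "sin \<bar>b\<bar> \<le> 7743 / 10000" by (rule sin_cos_range(2)[OF b])
  have s0: "0 \<le> sin \<bar>b\<bar>" using b p by (intro sin_ge_zero) auto
  have Y2: "1 + Y ^ 2 = 2 / (1 - sin \<bar>b\<bar>)"
  proof -
    have c0: "cos ((pi / 2 + \<bar>b\<bar>) / 2) > 0" by (rule cos_gt_zero_pi) (use b p in argo)+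
    have "2 * cos ((pi / 2 + \<bar>b\<bar>) / 2) ^ 2 = 1 + cos (2 * ((pi / 2 + \<bar>b\<bar>) / 2))" unfolding cos_double_cos by simp
    also have "2 * ((pi / 2 + \<bar>b\<bar>) / 2) = pi / 2 + \<bar>b\<bar>" by simp
    also have "1 + cos (pi / 2 + \<bar>b\<bar>) = 1 - sin \<bar>b\<bar>" unfolding cos_add by simp
    finally have c2: "cos ((pi / 2 + \<bar>b\<bar>) / 2) ^ 2 = (1 - sin \<bar>b\<bar>) / 2" by simp
    have "1 + Y ^ 2 = 1 / cos ((pi / 2 + \<bar>b\<bar>) / 2) ^ 2"
      unfolding Y_def using tan_sec[of "(pi / 2 + \<bar>b\<bar>) / 2"] c0 by (simp add: power_divide inverse_eq_divide)
    thus ?thesis unfolding c2 by simp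
  qed
  have "2 / 1 \<le> 2 / (1 - sin \<bar>b\<bar>)" using s s0 by (intro divide_left_mono) auto
  hence "1 ^ 2 \<le> Y ^ 2" using Y2 by simp
  hence Y1: "1 \<le> Y" by (rule power2_le_imp_le) (use Y0 in simp)
  have "2 / (1 - sin \<bar>b\<bar>) \<le> 2 / (2257 / 10000)" using s by (intro divide_left_mono) auto
  hence Y3: "1 + Y ^ 2 \<le> 8865 / 1000" using Y2 by simp
  note hb = arc_modulus_bounds[OF Y1 Y3]
  have "1 / (8 * (1 - sin \<bar>b\<bar>)) = (1 + Y ^ 2) / 16" unfolding Y2 using s by (simp add: field_simps)
  hence h: "1 / (8 * (1 - sin \<bar>b\<bar>)) \<le> arc_modulus Y" using hb(1) by simp
  have "arc_modulus y = arc_modulus Y" using yY arc_modulus_inverse[OF Y0] by auto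
  thus "1 / (8 * (1 - sin \<bar>b\<bar>)) \<le> arc_modulus y" "arc_modulus y \<le> 57 / 100" using h hb(2) by simp_all
  show "14 / 10000 \<le> modular_lambda y" "modular_lambda y \<le> 1 - 14 / 10000" using yY modular_lambda_inverse[OF Y0] hb(3,4) by auto
qed

text \<open>
  Up to sign and a constant, the phase of the seed at the angle \<open>b\<close> from the top; see \<open>seed_arc\<close>.
\<close>

definition turning :: "int \<Rightarrow> int \<Rightarrow> real \<Rightarrow> real" where
  "turning l m b = pi * of_int m / 2 * sin b + of_int l * b"

definition large_order :: "int \<Rightarrow> int \<Rightarrow> bool" where
  "large_order l m \<longleftrightarrow> (l \<ge> 0 \<and> m \<ge> 4 * l + 16) \<or> (l < 0 \<and> m \<ge> 5 * \<bar>l\<bar> + 16)"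

lemma exp_lower_square: assumes "0 \<le> (x::real)" shows "(1 + x / of_nat n + (x / of_nat n) ^ 2 / 2) ^ n \<le> exp x"
proof (cases "n = 0")
  case False
  have "(1 + x / of_nat n + (x / of_nat n) ^ 2 / 2) ^ n \<le> exp (x / of_nat n) ^ n"
    using assms exp_lower_Taylor_quadratic[of "x / of_nat n"] by (intro power_mono) (auto intro!: add_nonneg_nonneg)
  also have "\<dots> = exp x" using False by (simp flip: exp_of_nat_mult)
  finally show ?thesis .
qed (use assms in simp)

lemma exp_numerals:
  "21 / 2 < exp (236 / 100 :: real)" "57 / 17 \<le> exp (125 / 100 :: real)" "2351 / 1000 \<le> exp (9 / 10 :: real)"
  "8024 / 1000 \<le> exp (22 / 10 :: real)"
proof -
  show "21 / 2 < exp (236 / 100 :: real)" using exp_lower_square[of "236 / 100" 16] by (simp add: power_divide eval_nat_numeral)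
  show "57 / 17 \<le> exp (125 / 100 :: real)" using exp_lower_square[of "125 / 100" 5] by (simp add: power_divide eval_nat_numeral)
  show "2351 / 1000 \<le> exp (9 / 10 :: real)" using exp_lower_square[of "9 / 10" 4] by (simp add: power_divide eval_nat_numeral)
  show "8024 / 1000 \<le> exp (22 / 10 :: real)" using exp_lower_square[of "22 / 10" 8] by (simp add: power_divide eval_nat_numeral)
qed

text \<open>
  Going beyond \<open>\<pi>/4\<close> by \<open>d\<close> costs the main term \<open>X (1 - cos d + sin d)\<close> in the exponent and gains
  \<open>X (sin d + cos d - 1)\<close> in the phase, where \<open>X\<close> is the common size of both at \<open>\<pi>/4\<close>. For \<open>d \<le> 1/10\<close>
  the cost is at most \<open>1.106\<close> times the gain, which the last hypothesis limits to \<open>\<pi>/2 - l d\<close>.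
\<close>

lemma turning_loss:
  assumes lm: "large_order l m" and b: "pi / 4 \<le> b" "b \<le> pi / 4 + 1 / 10"
    and t: "turning l m b \<le> turning l m (pi / 4) + pi / 2"
  shows "pi * m / 2 * cos b \<ge> pi * m / 2 * (sqrt 2 / 2) - 1106 / 1000 * (pi / 2 - l * (b - pi / 4))"
proof -
  define d X where "d = b - pi / 4" and "X = pi * m / 2 * (sqrt 2 / 2)"
  have m: "m \<ge> 16" using lm by (auto simp: large_order_def)
  have X: "X \<ge> 0" using m by (simp add: X_def)
  have d: "0 \<le> d" "d \<le> 1 / 10" using b by (simp_all add: d_def)
  have bd: "b = pi / 4 + d" by (simp add: d_def)
  have sb: "pi * m / 2 * sin b = X * (cos d + sin d)" unfolding bd X_def by (simp add: sin_add sin_45 cos_45 algebra_simps)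
  have cb: "pi * m / 2 * cos b = X * (cos d - sin d)" unfolding bd X_def by (simp add: cos_add sin_45 cos_45 algebra_simps)
  have s4: "pi * m / 2 * sin (pi / 4) = X" by (simp add: X_def sin_45)
  have "X * (cos d + sin d) - X \<le> pi / 2 - l * d" using t unfolding turning_def sb s4 by (simp add: d_def algebra_simps)
  moreover have "1 - cos d + sin d \<le> 1106 / 1000 * (cos d + sin d - 1)"
  proof -
    have h: "0 \<le> sin (d / 2)" "sin (d / 2) \<le> 1 / 20" using d sin_x_le_x[of "d / 2"] pi_gt3 by (auto intro!: sin_ge_zero)
    have "d ^ 2 \<le> (1 / 10) ^ 2" using d by (intro power_mono)
    hence c: "99875 / 100000 \<le> cos (d / 2)" using cos_ge_quadratic[of "d / 2"] by (simp add: power2_eq_square)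
    have "2106 / 1000 * sin (d / 2) \<le> 106 / 1000 * cos (d / 2)" using h c by argo
    hence "(2 * sin (d / 2)) * (2106 / 1000 * sin (d / 2)) \<le> (2 * sin (d / 2)) * (106 / 1000 * cos (d / 2))"
      using h by (intro mult_left_mono) auto
    moreover have "sin d = 2 * sin (d / 2) * cos (d / 2)" using sin_double[of "d / 2"] by simp
    moreover have "cos d = 1 - 2 * sin (d / 2) ^ 2" using cos_double_sin[of "d / 2"] by simp
    ultimately show ?thesis by (simp add: power2_eq_square algebra_simps)
  qed
  hence "X * (1 - cos d + sin d) \<le> X * (1106 / 1000 * (cos d + sin d - 1))" using X by (intro mult_left_mono)
  moreover have "X * (cos d + sin d) = X * cos d + X * sin d" "X * (cos d - sin d) = X * cos d - X * sin d"
    "X * (1 - cos d + sin d) = X - X * cos d + X * sin d"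
    "X * (1106 / 1000 * (cos d + sin d - 1)) = 1106 / 1000 * (X * cos d + X * sin d - X)"
    by (simp_all add: algebra_simps)
  ultimately show ?thesis unfolding cb X_def[symmetric] d_def[symmetric] by argo
qed

text \<open>
  The exponential margin at \<open>b = \<pi>/4\<close>, where \<open>cos b / 2\<close> exceeds the \<open>1/4\<close> of the circle by more
  than \<open>0.1\<close>.
\<close>

lemma cos_excess:
  assumes lm: "large_order l m"
  shows "pi * m / 2 * (sqrt 2 / 2) - pi * m / 4 \<ge> 3253 / 10000 * m"
proof -
  have m: "real_of_int m \<ge> 16" using lm by (auto simp: large_order_def)
  have "(31415 / 10000) * (20710 / 100000) \<le> pi * (sqrt 2 / 2 - 1 / 2)" using pi_approx sqrt2_half by (intro mult_mono) auto
  hence "m / 2 * ((31415 / 10000) * (20710 / 100000)) \<le> m / 2 * (pi * (sqrt 2 / 2 - 1 / 2))" using m by (intro mult_left_mono) auto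
  also have "\<dots> = pi * m / 2 * (sqrt 2 / 2) - pi * m / 4" by (simp add: algebra_simps)
  finally show ?thesis using m by simp
qed

text \<open>
  Compare exponents; \<open>ln (21 / 2)\<close> is below \<open>2.36\<close>, and \<open>m \<ge> 16\<close> makes the margin \<open>0.3253 m\<close> at least
  \<open>5.2\<close>, of which at most \<open>1.74\<close> is lost beyond \<open>\<pi>/4\<close> in the absence of a weight. The weight enters
  through the ratio of \<open>eis\<close> on the arc and on the circle. For \<open>l \<ge> 0\<close> that ratio costs at most \<open>1.25 l\<close>,
  covered by \<open>m \<ge> 4 l + 16\<close>. For \<open>l < 0\<close> the ratio is worst near the top of the arc, where \<open>eis\<close> is small
  but \<open>cos b\<close> is large, and \<open>m \<ge> 5 |l| + 16\<close> suffices.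
\<close>

lemma main_term_dominates:
  assumes lm: "large_order l m" and b: "\<bar>b\<bar> \<le> pi / 4 + 1 / 10"
    and t: "turning l m \<bar>b\<bar> \<le> turning l m (pi / 4) + pi / 2"
    and e: "17 / 100 \<le> e" "e \<le> 1003 / 1000"
  shows "21 * exp (pi * m / 4 - l * ln e) < 2 * exp (pi * m * cos b / 2 - l * ln (arc_modulus (tan ((pi / 2 - b) / 2))))"
proof -
  define h where "h = arc_modulus (tan ((pi / 2 - b) / 2))"
  note ap = arc_parameter[OF b, folded h_def]
  have m: "real_of_int m \<ge> 16" using lm by (auto simp: large_order_def)
  have s1: "1 - sin \<bar>b\<bar> > 0" using sin_cos_range(2)[OF b] by simp
  hence "0 < 1 / (8 * (1 - sin \<bar>b\<bar>))" by simp
  hence h0: "h > 0" using ap(2) by linarith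
  have far: "pi * m * cos b / 2 - pi * m / 4 \<ge> 3253 / 10000 * m - 1106 / 1000 * (pi / 2 - l * (\<bar>b\<bar> - pi / 4))"
    if "pi / 4 \<le> \<bar>b\<bar>"
  proof -
    have "pi * m / 2 * cos b = pi * m * cos b / 2" by simp
    thus ?thesis using turning_loss[OF lm that b t] cos_excess[OF lm] unfolding cos_abs_real by argo
  qed
  have near: "sqrt 2 / 2 \<le> cos b" if "\<bar>b\<bar> \<le> pi / 4"
    using cos_monotone_0_pi_le[of "\<bar>b\<bar>" "pi / 4"] that pi_gt_zero by (simp add: cos_45)
  have near': "pi * m * cos b / 2 - pi * m / 4 \<ge> 3253 / 10000 * m" if "\<bar>b\<bar> \<le> pi / 4"
  proof -
    have "pi * m / 2 * (sqrt 2 / 2) \<le> pi * m / 2 * cos b" using near[OF that] m by (intro mult_left_mono) auto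
    moreover have "pi * m / 2 * cos b = pi * m * cos b / 2" by simp
    ultimately show ?thesis using cos_excess[OF lm] by argo
  qed
  have "pi * m * cos b / 2 - pi * m / 4 - l * (ln h - ln e) \<ge> 236 / 100"
  proof (cases "l \<ge> 0")
    case True
    have ml: "real_of_int m \<ge> 4 * real_of_int l + 16" using lm True by (auto simp: large_order_def)
    have "ln h - ln e = ln (h / e)" using h0 e by (simp add: ln_div)
    also have "\<dots> \<le> ln (exp (125 / 100))"
    proof (subst ln_le_cancel_iff)
      have "h / e \<le> (57 / 100) / (17 / 100)" using ap(3) e h0 by (intro frac_le) auto
      also have "\<dots> \<le> exp (125 / 100)" using exp_numerals(2) by simp
      finally show "h / e \<le> exp (125 / 100)" .
    qed (use h0 e in auto)
    finally have "l * (ln h - ln e) \<le> l * (125 / 100)" using True by (intro mult_left_mono) auto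
    moreover have "pi * m * cos b / 2 - pi * m / 4 \<ge> 3253 / 10000 * m - 1106 / 1000 * (pi / 2)"
    proof (cases "\<bar>b\<bar> \<le> pi / 4")
      case True thus ?thesis using near'[OF True] pi_gt_zero by argo
    next
      case False
      have "0 \<le> l * (\<bar>b\<bar> - pi / 4)" using False \<open>l \<ge> 0\<close> by (intro mult_nonneg_nonneg) auto
      thus ?thesis using far False by argo
    qed
    moreover have "pi \<le> 31416 / 10000" using pi_approx by simp
    moreover have "real_of_int l \<ge> 0" using True by simp
    ultimately show ?thesis using ml by argo
  next
    case False
    define n where "n = real_of_int (- l)"
    have n: "n > 0" "real_of_int l = - n" using False by (simp_all add: n_def)
    have ml: "real_of_int m \<ge> 5 * n + 16" using lm False by (auto simp: large_order_def n_def)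
    have le: "ln e \<le> ln (1003 / 1000)" using e by simp
    have lh: "ln (1 / (8 * (1 - sin \<bar>b\<bar>))) \<le> ln h" using ap(2) s1 h0 by simp
    show ?thesis
    proof (cases "\<bar>b\<bar> \<le> pi / 4")
      case True
      define S where "S = sin \<bar>b\<bar>"
      have S: "0 \<le> S" "S < 1" using True pi_gt_zero s1 by (auto simp: S_def intro!: sin_ge_zero)
      have "ln (1003 / 1000) - ln (1 / (8 * (1 - S))) = ln (1003 / 1000 / (1 / (8 * (1 - S))))" using S by (subst ln_div) auto
      also have "1003 / 1000 / (1 / (8 * (1 - S))) = 8024 / 1000 * (1 - S)"
        unfolding divide_divide_eq_right by argo
      also have "ln (8024 / 1000 * (1 - S)) = ln (8024 / 1000) + ln (1 - S)" using S by (subst ln_mult) auto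
      also have "ln (1 - S) \<le> - S" using ln_le_minus_one[of "1 - S"] S by simp
      also have "ln (8024 / 1000) \<le> ln (exp (22 / 10 :: real))" using exp_numerals(4) by (subst ln_le_cancel_iff) auto
      finally have "ln e - ln h \<le> 22 / 10 - S" using le lh unfolding S_def by simp
      hence A: "n * (ln e - ln h) \<le> n * (22 / 10 - S)" using n by (intro mult_left_mono) auto
      have c: "7071 / 10000 \<le> cos b" using near[OF True] sqrt2_half by simp
      have cS: "cos b ^ 2 + S ^ 2 = 1" using sin_cos_squared_add3[of b] by (simp add: S_def abs_if power2_eq_square)
      \<comment> \<open>\<open>15707 / 2000\<close> is just below \<open>5 \<pi> / 2\<close>, the coefficient of \<open>n cos b\<close> produced by \<open>m \<ge> 5 n\<close>.\<close>
      have "614 / 100 \<le> 15707 / 2000 * cos b + S"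
      proof (cases "S \<ge> 59 / 100")
        case True thus ?thesis using c by argo
      next
        case False
        hence "S ^ 2 \<le> (59 / 100) ^ 2" using S by (intro power_mono) auto
        hence "(80 / 100) ^ 2 \<le> cos b ^ 2" using cS by (simp add: power2_eq_square)
        hence "80 / 100 \<le> cos b" by (rule power2_le_imp_le) (use c in simp)
        thus ?thesis using S by argo
      qed
      hence B: "n * (614 / 100) \<le> n * (15707 / 2000 * cos b + S)" using n by (intro mult_left_mono) auto
      have "(31415 / 10000) * ((5 * n + 16) * (cos b / 2 - 1 / 4)) \<le> pi * (m * (cos b / 2 - 1 / 4))"
        using pi_approx ml n c by (intro mult_mono) auto
      hence C: "(31415 / 10000) * ((5 * n + 16) * (cos b / 2 - 1 / 4)) \<le> pi * m * cos b / 2 - pi * m / 4" by (simp add: algebra_simps)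
      have D: "(31415 / 10000) * ((5 * n + 16) * (cos b / 2 - 1 / 4)) =
        n * (15707 / 2000 * cos b + S) + n * cos b / 4000 - n * S - 31415 / 8000 * n + 50264 / 1000 * (cos b / 2 - 1 / 4)"
        by (simp add: field_simps)
      have "0 \<le> n * cos b" using n c by simp
      moreover have "l * (ln h - ln e) = n * (ln e - ln h)" using n by (simp add: algebra_simps)
      moreover have "n * (22 / 10 - S) = 22 / 10 * n - n * S" by (simp add: algebra_simps)
      ultimately show ?thesis using A B C D n c by argo
    next
      case F: False
      have "sqrt 2 / 2 \<le> sin \<bar>b\<bar>" using sin_monotone_2pi_le[of "pi / 4" "\<bar>b\<bar>"] F b pi_gt3 by (simp add: sin_45)
      hence s: "7071 / 10000 \<le> sin \<bar>b\<bar>" using sqrt2_half by simp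
      have "ln (1003 / 1000) - ln (1 / (8 * (1 - sin \<bar>b\<bar>))) = ln (1003 / 1000 / (1 / (8 * (1 - sin \<bar>b\<bar>))))"
        using s1 by (subst ln_div) auto
      also have "\<dots> \<le> ln (exp (9 / 10))" using s s1 exp_numerals(3) by (subst ln_le_cancel_iff) auto
      finally have "ln e - ln h \<le> 9 / 10" using le lh by simp
      hence A: "n * (ln e - ln h) \<le> n * (9 / 10)" using n by (intro mult_left_mono) auto
      have "n * (\<bar>b\<bar> - pi / 4) \<le> n * (1 / 10)" using n b by (intro mult_left_mono) auto
      moreover have "l * (ln h - ln e) = n * (ln e - ln h)" "l * (\<bar>b\<bar> - pi / 4) = - (n * (\<bar>b\<bar> - pi / 4))"
        using n by (simp_all add: algebra_simps)
      moreover have "pi \<le> 31416 / 10000" using pi_approx by simp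
      moreover have "pi * m * cos b / 2 - pi * m / 4 \<ge> 3253 / 10000 * m - 1106 / 1000 * (pi / 2 - l * (\<bar>b\<bar> - pi / 4))"
        using far F by simp
      ultimately show ?thesis using A ml n(1) by argo
    qed
  qed
  hence "exp (236 / 100 + (pi * m / 4 - l * ln e)) \<le> exp (pi * m * cos b / 2 - l * ln h)"
    by (subst exp_le_cancel_iff) (simp add: algebra_simps)
  hence "exp (236 / 100) * exp (pi * m / 4 - l * ln e) \<le> exp (pi * m * cos b / 2 - l * ln h)" unfolding exp_add .
  moreover have "21 / 2 * exp (pi * m / 4 - l * ln e) < exp (236 / 100) * exp (pi * m / 4 - l * ln e)"
    using exp_numerals(1) by (intro mult_strict_right_mono) auto
  ultimately show ?thesis unfolding h_def by linarith
qed

section \<open>Counting sign changes\<close>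

lemma zeros_of_alternating:
  fixes g :: "real \<Rightarrow> real" and b :: "nat \<Rightarrow> real"
  assumes g: "continuous_on {- a..a} g" and \<sigma>: "\<sigma> ^ 2 = 1"
    and b: "\<And>i. i \<le> N \<Longrightarrow> \<bar>b i\<bar> \<le> a" "\<And>i j. i < j \<Longrightarrow> j \<le> N \<Longrightarrow> b j < b i"
    and s: "\<And>i. i \<le> N \<Longrightarrow> 0 < \<sigma> * (- 1) ^ i * g (b i)"
  obtains Z where "finite Z" "card Z = N" "Z \<subseteq> {- a..a}" "\<And>z. z \<in> Z \<Longrightarrow> g z = 0"
proof -
  have "\<exists>z. b (Suc i) < z \<and> z < b i \<and> g z = 0" if i: "i < N" for i
  proof -
    define h where "h x = \<sigma> * (- 1) ^ i * g x" for x
    have lt: "b (Suc i) < b i" using b(2)[of i "Suc i"] i by simp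
    have p: "0 < h (b i)" "h (b (Suc i)) < 0" using s[of i] s[of "Suc i"] i by (simp_all add: h_def)
    have sub: "{b (Suc i)..b i} \<subseteq> {- a..a}" using b(1)[of i] b(1)[of "Suc i"] i by (auto simp: abs_le_iff)
    have "continuous_on {b (Suc i)..b i} h"
      unfolding h_def[abs_def] by (intro continuous_intros continuous_on_subset[OF g sub])
    then obtain z where z: "b (Suc i) \<le> z" "z \<le> b i" "h z = 0"
      using IVT'[of h "b (Suc i)" 0 "b i"] p lt by auto
    moreover have "z \<noteq> b i" "z \<noteq> b (Suc i)" using p z(3) by auto
    moreover have "g z = 0" using z(3) \<sigma> by (auto simp: h_def)
    ultimately show ?thesis by (intro exI[of _ z]) auto
  qed
  then obtain z where z: "\<And>i. i < N \<Longrightarrow> b (Suc i) < z i \<and> z i < b i \<and> g (z i) = 0" by metis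
  have less: "z j < z i" if "i < j" "j < N" for i j
  proof -
    have "z j < b j" "b (Suc i) < z i" using z that by auto
    moreover have "b j \<le> b (Suc i)" using b(2)[of "Suc i" j] that by (cases "Suc i = j") auto
    ultimately show ?thesis by simp
  qed
  have inj: "inj_on z {..<N}"
    by (rule linorder_inj_onI) (use less in \<open>auto simp: neq_iff\<close>)
  show thesis
  proof (rule that[of "z ` {..<N}"])
    show "card (z ` {..<N}) = N" using card_image[OF inj] by simp
    show "z ` {..<N} \<subseteq> {- a..a}"
    proof safe
      fix i assume "i < N"
      hence "b (Suc i) < z i" "z i < b i" "\<bar>b i\<bar> \<le> a" "\<bar>b (Suc i)\<bar> \<le> a" using z b(1) by auto
      thus "z i \<in> {- a..a}" by auto
    qed
  qed (use z in auto)
qed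

text \<open>
  The nodes are the angles at which the phase is a multiple of \<open>\<pi>\<close>. They exist because the phase is odd
  and increasing and its value at the end of the range exceeds the value at \<open>\<pi>/4\<close> by at least \<open>\<pi>/2\<close>.
  Since the phase is odd, the bound on its values at the nodes also holds at \<open>|b i|\<close>, the form that
  \<open>turning_loss\<close> needs.
\<close>

lemma turning_nodes:
  assumes lm: "large_order l m" and N: "real N * (pi / 2) \<le> turning l m (pi / 4) + pi / 2"
  shows "\<exists>b. (\<forall>i\<le>N. \<bar>b i\<bar> \<le> pi / 4 + 1 / 10 \<and>
      turning l m (b i) = real N * (pi / 2) - real i * pi \<and>
      turning l m \<bar>b i\<bar> \<le> turning l m (pi / 4) + pi / 2) \<and>
    (\<forall>i j. i < j \<longrightarrow> j \<le> N \<longrightarrow> b j < b i)"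
proof -
  define a where "a = pi / 4 + 1 / 10"
  have a0: "a > 0" using pi_gt_zero by (simp add: a_def add_pos_pos)
  have m: "real_of_int m \<ge> 16" using lm by (auto simp: large_order_def)
  have odd: "turning l m (- x) = - turning l m x" for x by (simp add: turning_def)
  have cont: "continuous_on S (turning l m)" for S unfolding turning_def[abs_def] by (intro continuous_intros)
  have der: "(turning l m has_real_derivative (pi * m / 2 * cos x + l)) (at x)" for x
    unfolding turning_def[abs_def] by (auto intro!: derivative_eq_intros)
  have slope: "pi * m / 2 * cos x + l > 0" if "\<bar>x\<bar> \<le> a" for x
  proof -
    have "3 * (m / 2 * (6 / 10)) \<le> pi * (m / 2 * cos x)"
      using sin_cos_range(1)[of x] that m pi_gt3 unfolding a_def by (intro mult_mono) auto
    moreover have "- real_of_int m \<le> 2 * real_of_int l" using lm by (auto simp: large_order_def)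
    moreover have "pi * (m / 2 * cos x) = pi * m / 2 * cos x" by simp
    ultimately show ?thesis using m by argo
  qed
  have mono: "turning l m x < turning l m y" if "x < y" "\<bar>x\<bar> \<le> a" "\<bar>y\<bar> \<le> a" for x y
  proof (rule DERIV_pos_imp_increasing[OF that(1)])
    fix u assume "x \<le> u" "u \<le> y"
    hence "\<bar>u\<bar> \<le> a" using that by auto
    thus "\<exists>v. (turning l m has_real_derivative v) (at u) \<and> 0 < v" using der slope by blast
  qed
  have top: "turning l m (pi / 4) + pi / 2 \<le> turning l m a"
  proof -
    define X where "X = pi * (m * (sqrt 2 / 4))"
    have sa: "pi * m / 2 * sin a = X * (cos (1 / 10) + sin (1 / 10))"
      unfolding a_def X_def by (simp add: sin_add sin_45 cos_45 algebra_simps)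
    have X: "pi * (m * (35355 / 100000)) \<le> X" unfolding X_def using sqrt2_half m by (intro mult_left_mono) auto
    have X0: "0 \<le> X" unfolding X_def using m by simp
    have "X * (10948 / 10000) \<le> X * (cos (1 / 10) + sin (1 / 10))" using sin_cos_tenth X0 by (intro mult_left_mono) auto
    hence 1: "turning l m a \<ge> X * (10948 / 10000) + l * pi / 4 + l / 10" unfolding turning_def sa by (simp add: a_def algebra_simps)
    have 2: "turning l m (pi / 4) = X + l * pi / 4" by (simp add: turning_def X_def sin_45)
    have "pi * (m * (35355 / 100000)) * (948 / 10000) \<le> X * (948 / 10000)" using X by (intro mult_right_mono) auto
    moreover have a: "pi * (m * (35355 / 100000)) * (948 / 10000) = pi * (m * (35355 / 100000) * (948 / 10000))" by (rule mult.assoc)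
    moreover have "pi / 2 - l / 10 \<le> pi * (m * (35355 / 100000)) * (948 / 10000)"
    proof (cases "l \<ge> 0")
      case True
      have "pi * (1 / 2) \<le> pi * (m * (35355 / 100000) * (948 / 10000))" using m by (intro mult_left_mono) auto
      moreover have "0 \<le> real_of_int l" using True by simp
      ultimately show ?thesis unfolding a by argo
    next
      case False
      have "real_of_int m \<ge> - 5 * real_of_int l + 16" "real_of_int l \<le> - 1" using lm False by (auto simp: large_order_def)
      hence "1 / 2 - l / 30 \<le> m * (35355 / 100000) * (948 / 10000)" by argo
      hence "pi * (1 / 2 - l / 30) \<le> pi * (m * (35355 / 100000) * (948 / 10000))" by (rule mult_left_mono) simp
      moreover have "pi * (1 / 2 - l / 30) = pi / 2 - l * pi / 30" by (simp add: algebra_simps)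
      moreover have "l * pi \<le> real_of_int l * 3" using False pi_gt3 by (intro mult_left_mono_neg) auto
      ultimately show ?thesis unfolding a by argo
    qed
    ultimately show ?thesis using 1 2 by argo
  qed
  have "\<exists>b. \<bar>b\<bar> \<le> a \<and> turning l m b = real N * (pi / 2) - real i * pi" if "i \<le> N" for i
  proof -
    have "real i * pi \<le> real N * pi" "0 \<le> real i * pi" using that by (auto intro!: mult_right_mono)
    hence "- turning l m a \<le> real N * (pi / 2) - real i * pi" "real N * (pi / 2) - real i * pi \<le> turning l m a"
      using N top by argo+
    thus ?thesis using IVT'[of "turning l m" "- a" _ a] a0 cont by (fastforce simp: odd abs_le_iff)
  qed
  then obtain b where b: "\<And>i. i \<le> N \<Longrightarrow> \<bar>b i\<bar> \<le> a \<and> turning l m (b i) = real N * (pi / 2) - real i * pi" by metis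
  show ?thesis
  proof (intro exI[of _ b] conjI allI impI)
    fix i assume i: "i \<le> N"
    have "real i * pi \<le> real N * pi" "0 \<le> real i * pi" using i by (auto intro!: mult_right_mono)
    hence "turning l m (b i) \<le> turning l m (pi / 4) + pi / 2" "- turning l m (b i) \<le> turning l m (pi / 4) + pi / 2"
      using conjunct2[OF b[OF i]] N by argo+
    hence "\<bar>turning l m (b i)\<bar> \<le> turning l m (pi / 4) + pi / 2" by simp
    moreover have "turning l m \<bar>b i\<bar> \<le> \<bar>turning l m (b i)\<bar>" by (auto simp: abs_if odd)
    ultimately show "turning l m \<bar>b i\<bar> \<le> turning l m (pi / 4) + pi / 2" by simp
  next
    fix i j assume ij: "i < j" "j \<le> N"
    show "b j < b i"
    proof (rule ccontr)
      assume "\<not> b j < b i"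
      hence "turning l m (b i) \<le> turning l m (b j)" using mono[of "b i" "b j"] b ij by (cases "b i = b j") auto
      moreover have "real i * pi < real j * pi" using ij by simp
      ultimately show False using b[of i] b[of j] ij by simp
    qed
  qed (use b in \<open>auto simp: a_def\<close>)
qed

lemma arc_of_angle:
  assumes "\<bar>b\<bar> \<le> pi / 4 + 1 / 10"
  shows "lower_arc (tan ((pi / 2 - b) / 2)) = - 1 / 4 + 1 / 4 * exp (\<i> * of_real (pi / 2 - b))"
    and "pi / 2 - b \<in> {0<..<pi}"
proof -
  show *: "pi / 2 - b \<in> {0<..<pi}" using assms pi_gt3 by (auto simp: abs_le_iff)
  show "lower_arc (tan ((pi / 2 - b) / 2)) = - 1 / 4 + 1 / 4 * exp (\<i> * of_real (pi / 2 - b))" by (rule arc_angle(1)[OF *])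
qed

lemma seed_cnj: "norm q < 1 \<Longrightarrow> seed l m (cnj q) = cnj (seed l m q)"
  by (simp add: seed_def eis_def tri_cnj power_int_def)

text \<open>
  The residue formula at a point of the arc. The second zero of \<open>psi - x\<close> is the conjugate nome, so the
  two values of the seed add up to twice its real part. The circle error is compared with the modulus
  \<open>A\<close> of the seed.
\<close>

lemma sample_value:
  assumes lm: "large_order l m" and b: "\<bar>b\<bar> \<le> pi / 4 + 1 / 10"
    and t: "turning l m \<bar>b\<bar> \<le> turning l m (pi / 4) + pi / 2"
    and P: "r holomorphic_on ball 0 1" "r 0 = 0" "\<And>q. norm q < 1 \<Longrightarrow> q \<noteq> 0 \<Longrightarrow> seed l m q = poly P (psi q) + r q"
  defines "y \<equiv> tan ((pi / 2 - b) / 2)"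
  shows "\<exists>A>0. norm (poly P (of_real (modular_lambda y)) - of_real (2 * A * cos ((m + l) * pi / 2 - turning l m b))) < 2 * A"
proof -
  define \<theta> where "\<theta> = pi / 2 - b"
  note \<theta> = arc_of_angle(2)[OF b, folded \<theta>_def]
  note ap = arc_parameter[OF b, folded y_def]
  define q where "q = qe (lower_arc y)"
  have az: "lower_arc y = - 1 / 4 + 1 / 4 * cis \<theta>"
    unfolding cis_conv_exp using arc_of_angle(1)[OF b] by (simp add: y_def \<theta>_def)
  have Ima: "Im (lower_arc y) = cos b / 4" unfolding az by (simp add: \<theta>_def sin_diff)
  have Rea: "Re (lower_arc y) = (cos \<theta> - 1) / 4" unfolding az by simp
  have c6: "6 / 10 \<le> cos b" by (rule sin_cos_range(1)[OF b])
  have "pi * (1 / 8) < pi * Im (lower_arc y)" using Ima c6 by (intro mult_strict_left_mono) auto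
  hence nq: "norm q < rad" by (simp add: q_def norm_qe rad_def)
  have q1: "norm q < 1" using norm_qe_less_1[OF arc_uhp[OF ap(1)]] by (simp add: q_def)
  \<comment> \<open>The real part of the point lies strictly between \<open>-1/2\<close> and \<open>0\<close>.\<close>
  have nonreal: "q \<noteq> cnj q"
  proof -
    have "Im q = norm q * sin (2 * pi * Re (lower_arc y))" by (simp add: q_def qe_def Im_exp mult.commute mult.left_commute)
    moreover have "sin (2 * pi * Re (lower_arc y)) < 0"
    proof -
      have "cos \<theta> < 1" "- 1 < cos \<theta>" using \<theta> cos_monotone_0_pi[of 0 \<theta>] cos_monotone_0_pi[of \<theta> pi] by auto
      hence "pi * 0 < pi * ((1 - cos \<theta>) / 2)" "pi * ((1 - cos \<theta>) / 2) < pi * 1" by (intro mult_strict_left_mono; simp)+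
      hence "0 < sin (pi * ((1 - cos \<theta>) / 2))" by (intro sin_gt_zero) auto
      moreover have "2 * pi * Re (lower_arc y) = - (pi * ((1 - cos \<theta>) / 2))" unfolding Rea by (simp add: field_simps)
      ultimately show ?thesis by simp
    qed
    ultimately have "Im q \<noteq> 0" by (simp add: q_def)
    thus ?thesis by (simp add: complex_eq_iff)
  qed
  have ps: "psi q = of_real (modular_lambda y)" unfolding q_def by (rule psi_arc[OF ap(1)])
  have psc: "psi (cnj q) = of_real (modular_lambda y)"
  proof -
    have "psi (cnj q) = cnj (psi q)" using q1 by (simp add: psi_def eis_def theta3_cnj tri_cnj)
    thus ?thesis unfolding ps by simp
  qed
  \<comment> \<open>The bound for \<open>|eis|\<close> on the circle from the side that bounds \<open>|eis|^(-l)\<close> above.\<close>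
  define e where "e = (if l \<ge> 0 then 17 / 100 else 1003 / 1000 :: real)"
  define A where "A = exp (pi * m * cos b / 2 - l * ln (arc_modulus y))"
  define B where "B = 21 * exp (pi * m / 4 - l * ln e)"
  have B: "B < 2 * A" unfolding A_def B_def y_def by (rule main_term_dominates[OF lm b t]) (simp_all add: e_def)
  have circle: "norm (seed l m w * (theta3 w ^ 4 * theta3 (- w) ^ 4 / pencil (of_real (modular_lambda y)) w)) \<le> B" if w: "norm w = rad" for w
  proof -
    have "norm (theta3 w ^ 4 * theta3 (- w) ^ 4 / pencil (of_real (modular_lambda y)) w) \<le> 21"
      using kernel_bound[OF w ap(4,5)] pencil_nonzero[OF w ap(4,5)] by (simp add: norm_divide divide_le_eq)
    moreover have "norm (seed l m w) \<le> exp (pi * m / 4 - l * ln e)"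
    proof -
      note ec = eis_circle[OF w]
      have en: "norm (eis w) > 0" using ec(1) by linarith
      have "l * ln e \<le> l * ln (norm (eis w))"
      proof (cases "l \<ge> 0")
        case True
        hence "ln e \<le> ln (norm (eis w))" using ec(1) en by (simp add: e_def)
        thus ?thesis using True by (intro mult_left_mono) auto
      next
        case False
        hence "ln (norm (eis w)) \<le> ln e" using ec(2) en by (simp add: e_def)
        thus ?thesis using False by (intro mult_left_mono_neg) auto
      qed
      moreover have "norm (seed l m w) = exp (pi * m / 4 - l * ln (norm (eis w)))"
      proof -
        have "norm (seed l m w) = rad powi (- m) * norm (eis w) powi (- l)" using w by (simp add: seed_def norm_mult norm_power_int)
        also have "rad powi (- m) = exp (pi * m / 4)" using pos_powi[OF rad_pos(1), of "- m"] by (simp add: rad_def mult.commute)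
        also have "norm (eis w) powi (- l) = exp (- l * ln (norm (eis w)))" using pos_powi[OF en, of "- l"] by simp
        finally show ?thesis by (simp flip: exp_add)
      qed
      ultimately show ?thesis by simp
    qed
    ultimately show ?thesis unfolding norm_mult[of "seed l m w"] B_def
      by (subst mult.commute) (intro mult_mono; simp)
  qed
  have "norm (poly P (of_real (modular_lambda y)) - (seed l m q + seed l m (cnj q))) \<le> B"
  proof (rule seed_residue_formula[where \<rho> = rad and r = r and s = "seed l m",
      OF rad_pos P(1,2) P(3) pencil_nonzero[OF _ ap(4,5)] pencil_zero_count[OF ap(4,5)] nonreal ps psc nq _ _ _ _ circle])
  qed (use nq in \<open>auto simp: q_def B_def\<close>)
  moreover have "seed l m q + seed l m (cnj q) = of_real (2 * A * cos ((m + l) * pi / 2 - turning l m b))"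
  proof -
    have "tan (\<theta> / 2) = y" by (simp add: y_def \<theta>_def)
    hence "seed l m q = of_real (exp (pi * m * sin \<theta> / 2 - l * ln (arc_modulus y))) *
        exp (\<i> * of_real (pi * m / 2 - pi * m / 2 * cos \<theta> + l * \<theta>))"
      using seed_arc[OF \<theta>, of l m] by (simp add: q_def)
    also have "sin \<theta> = cos b" by (simp add: \<theta>_def sin_diff)
    also have "pi * m / 2 - pi * m / 2 * cos \<theta> + l * \<theta> = (m + l) * pi / 2 - turning l m b"
      by (simp add: \<theta>_def turning_def cos_diff algebra_simps add_divide_distrib)
    finally have "Re (seed l m q) = A * cos ((m + l) * pi / 2 - turning l m b)"
      unfolding A_def by (simp add: Re_exp mult.assoc)
    thus ?thesis unfolding seed_cnj[OF q1] complex_add_cnj by simp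
  qed
  ultimately show ?thesis using B by (intro exI[of _ A]) (simp add: A_def)
qed


lemma psi_qe_holomorphic: "(\<lambda>z. psi (qe z)) holomorphic_on upper_half_plane"
  unfolding psi_def
  by (intro holomorphic_intros theta3_qe_holomorphic eis_qe_holomorphic) (simp add: eis_nonzero norm_qe_less_1)

lemma zeros_count_ge_card:
  assumes f: "f holomorphic_on U" "open U" "connected U" and w: "w \<in> U" "f w \<noteq> 0"
    and S: "S \<subseteq> U" "finite {z. z \<in> S \<and> f z = 0}" and T: "T \<subseteq> {z. z \<in> S \<and> f z = 0}"
  shows "int (card T) \<le> zeros_count f S"
proof -
  have "1 \<le> zorder f z" if "z \<in> S" "f z = 0" for z
  proof -
    have zU: "z \<in> U" using that S by auto
    have "\<forall>\<^sub>F u in at z. f u \<noteq> 0 \<and> u \<in> U" by (rule non_zero_neighbour_alt[OF f zU w])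
    hence "\<forall>\<^sub>F u in at z. f u \<noteq> 0" by (rule eventually_mono) simp
    hence "\<exists>\<^sub>F u in at z. f u \<noteq> 0" by (intro eventually_frequently) auto
    thus ?thesis using zorder_pos_iff[OF f(1,2) zU] that by simp
  qed
  hence "(\<Sum>z | z \<in> S \<and> f z = 0. 1) \<le> zeros_count f S" unfolding zeros_count_def by (intro sum_mono) auto
  moreover have "card T \<le> card {z. z \<in> S \<and> f z = 0}" by (rule card_mono[OF S(2) T])
  ultimately show ?thesis by simp
qed

text \<open>
  Finiteness matters because \<open>zeros_count\<close> is \<open>0\<close> by convention for infinitely many zeros. It holds since
  \<open>psi\<close> is injective on the arc and maps zeros of the form to roots of the polynomial.
\<close>

lemma finite_zeros_lower_boundary:
  assumes f: "\<And>z. z \<in> upper_half_plane \<Longrightarrow> f z = eis (qe z) powi l * poly P (psi (qe z))" and P: "P \<noteq> 0"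
  shows "finite {z. z \<in> lower_boundary4 \<and> f z = 0}"
proof -
  define Y where "Y = {y. 0 < y \<and> poly P (of_real (modular_lambda y)) = 0}"
  have "inj_on (\<lambda>y. complex_of_real (modular_lambda y)) Y" by (rule inj_onI) (use modular_lambda_inj in \<open>auto simp: Y_def\<close>)
  moreover have "(\<lambda>y. complex_of_real (modular_lambda y)) ` Y \<subseteq> {x. poly P x = 0}" by (auto simp: Y_def)
  ultimately have "finite Y" using poly_roots_finite[OF P] finite_subset finite_image_iff by metis
  moreover have "{z. z \<in> lower_boundary4 \<and> f z = 0} \<subseteq> lower_arc ` Y"
  proof safe
    fix z assume z: "z \<in> lower_boundary4" "f z = 0"
    from z(1) obtain \<theta> where \<theta>: "\<theta> \<in> {0..pi}" "z = - 1 / 4 + 1 / 4 * exp (\<i> * of_real \<theta>)" "z \<in> upper_half_plane"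
      by (auto simp: lower_boundary4_def)
    have "sin \<theta> > 0" using \<theta>(2,3) by (simp add: upper_half_plane_def Im_exp)
    hence "\<theta> \<noteq> 0" "\<theta> \<noteq> pi" by auto
    hence \<theta>': "\<theta> \<in> {0<..<pi}" using \<theta>(1) by auto
    define y where "y = tan (\<theta> / 2)"
    have y: "y > 0" "z = lower_arc y" using arc_angle(1,3)[OF \<theta>'] \<theta>(2) by (simp_all add: y_def)
    have "eis (qe z) \<noteq> 0" using eis_nonzero[of "qe z"] norm_qe_less_1[OF \<theta>(3)] by simp
    hence "poly P (psi (qe z)) = 0" using z(2) f[OF \<theta>(3)] by simp
    hence "poly P (of_real (modular_lambda y)) = 0" using psi_arc[OF y(1)] y(2) by simp
    thus "z \<in> lower_arc ` Y" using y by (auto simp: Y_def)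
  qed
  ultimately show ?thesis using finite_subset by blast
qed

text \<open>
  The parity condition makes the phase a multiple of \<open>\<pi>\<close> at all \<open>N + 1\<close> nodes, which are placed
  symmetrically about the top of the arc. At the nodes the polynomial has alternating signs, and the zeros
  between them are carried to the arc. The same nonzero values show that neither the polynomial nor the form
  vanishes identically.
\<close>

theorem basis_form_zeros_on_arc:
  assumes lm: "large_order l m" and bf: "basis_form4 l m f"
    and N: "even (int N - m - l)" "real N \<le> sqrt 2 / 2 * m + l / 2 + 1"
  shows "int N \<le> zeros_count f lower_boundary4"
proof -
  have "m \<ge> - l" using lm by (auto simp: large_order_def)
  then obtain P r where P: "\<And>x. poly P (of_real x) \<in> \<real>" "r holomorphic_on ball 0 1" "r 0 = 0"
    "\<And>q. norm q < 1 \<Longrightarrow> q \<noteq> 0 \<Longrightarrow> seed l m q = poly P (psi q) + r q"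
    "\<And>z. z \<in> upper_half_plane \<Longrightarrow> f z = eis (qe z) powi l * poly P (psi (qe z))"
    using basis_form_polynomial[OF bf] by blast
  define a where "a = pi / 4 + 1 / 10"
  define y where "y b = tan ((pi / 2 - b) / 2)" for b
  define g where "g b = Re (poly P (of_real (modular_lambda (y b))))" for b
  have "turning l m (pi / 4) = pi / 2 * (sqrt 2 / 2 * m + l / 2)" by (simp add: turning_def sin_45 algebra_simps)
  moreover have "pi / 2 * real N \<le> pi / 2 * (sqrt 2 / 2 * m + l / 2 + 1)" using N(2) by (intro mult_left_mono) auto
  ultimately have "real N * (pi / 2) \<le> turning l m (pi / 4) + pi / 2" by (simp add: algebra_simps)
  from turning_nodes[OF lm this] obtain b where nodes: "(\<forall>i\<le>N. \<bar>b i\<bar> \<le> pi / 4 + 1 / 10 \<and>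
      turning l m (b i) = real N * (pi / 2) - real i * pi \<and>
      turning l m \<bar>b i\<bar> \<le> turning l m (pi / 4) + pi / 2)"
    "(\<forall>i j. i < j \<longrightarrow> j \<le> N \<longrightarrow> b j < b i)" by blast
  have b: "\<bar>b i\<bar> \<le> pi / 4 + 1 / 10" "turning l m (b i) = real N * (pi / 2) - real i * pi"
    "turning l m \<bar>b i\<bar> \<le> turning l m (pi / 4) + pi / 2" if "i \<le> N" for i
    using nodes(1) that by blast+
  have decreasing: "b j < b i" if "i < j" "j \<le> N" for i j using nodes(2) that by blast
  obtain j where j: "int N - m - l = 2 * j" using N(1) by (rule evenE)
  define \<sigma> where "\<sigma> = cos (of_int j * pi)"
  have sj: "sin (of_int j * pi) = 0" unfolding sin_times_pi_eq_0 by simp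
  have \<sigma>: "\<sigma> ^ 2 = 1" using sin_cos_squared_add[of "of_int j * pi"] by (simp add: sj \<sigma>_def)
  have sign: "0 < \<sigma> * (- 1) ^ i * g (b i)" if i: "i \<le> N" for i
  proof -
    have "\<exists>A>0. norm (poly P (of_real (modular_lambda (y (b i)))) -
        of_real (2 * A * cos ((of_int m + of_int l) * pi / 2 - turning l m (b i)))) < 2 * A"
      unfolding y_def by (rule sample_value[OF lm b(1)[OF i] b(3)[OF i] P(2,3)]) (rule P(4))
    then obtain A where A: "A > 0" "norm (poly P (of_real (modular_lambda (y (b i)))) -
        of_real (2 * A * cos ((of_int m + of_int l) * pi / 2 - turning l m (b i)))) < 2 * A" by blast
    have ml: "real_of_int m + real_of_int l = real N - 2 * real_of_int j" using j by linarith
    have "(of_int m + of_int l) * pi / 2 - turning l m (b i) = real i * pi - of_int j * pi" unfolding b(2)[OF i] ml by (simp add: field_simps)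
    hence "cos ((of_int m + of_int l) * pi / 2 - turning l m (b i)) = \<sigma> * (- 1) ^ i" by (simp add: cos_diff sj \<sigma>_def)
    hence "\<bar>Re (poly P (of_real (modular_lambda (y (b i)))) - of_real (2 * A * (\<sigma> * (- 1) ^ i)))\<bar> < 2 * A"
      using A(2) abs_Re_le_cmod order_le_less_trans by metis
    hence l: "\<bar>g (b i) - 2 * A * (\<sigma> * (- 1) ^ i)\<bar> < 2 * A" by (simp add: g_def)
    have "\<sigma> * (- 1) ^ i = 1 \<or> \<sigma> * (- 1) ^ i = - 1"
    proof -
      have "(\<sigma> * (- 1) ^ i) ^ 2 = 1" using \<sigma> by (simp add: power_mult_distrib flip: power_mult)
      thus ?thesis by (simp add: power2_eq_1_iff)
    qed
    thus ?thesis using l A(1) by (elim disjE) (simp_all add: abs_if split: if_splits)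
  qed
  have lower_arc: "lower_arc (y x) = - 1 / 4 + 1 / 4 * exp (\<i> * of_real (pi / 2 - x))" "pi / 2 - x \<in> {0<..<pi}" "y x > 0"
    if "x \<in> {- a..a}" for x
    using arc_of_angle[of x] arc_parameter(1)[of x] that by (auto simp: a_def y_def abs_le_iff)
  have cont: "continuous_on {- a..a} g"
  proof -
    define \<gamma> where "\<gamma> x = - 1 / 4 + 1 / 4 * exp (\<i> * complex_of_real (pi / 2 - x))" for x
    have "continuous_on {- a..a} \<gamma>" unfolding \<gamma>_def[abs_def] by (intro continuous_intros)
    moreover have "\<gamma> ` {- a..a} \<subseteq> upper_half_plane"
    proof (rule image_subsetI)
      fix x assume x: "x \<in> {- a..a}"
      show "\<gamma> x \<in> upper_half_plane" using arc_uhp[OF lower_arc(3)[OF x]] unfolding lower_arc(1)[OF x] \<gamma>_def .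
    qed
    ultimately have c: "continuous_on {- a..a} (\<lambda>x. psi (qe (\<gamma> x)))"
      by (rule continuous_on_compose2[OF holomorphic_on_imp_continuous_on[OF psi_qe_holomorphic]])
    have "continuous_on {- a..a} (\<lambda>x. Re (poly P (psi (qe (\<gamma> x)))))" by (intro continuous_intros c)
    moreover have "Re (poly P (psi (qe (\<gamma> x)))) = g x" if "x \<in> {- a..a}" for x
      using psi_arc[OF lower_arc(3)[OF that]] lower_arc(1)[OF that] by (simp add: \<gamma>_def g_def)
    ultimately show ?thesis by (rule continuous_on_eq)
  qed
  obtain Z where Z: "finite Z" "card Z = N" "Z \<subseteq> {- a..a}" "\<And>x. x \<in> Z \<Longrightarrow> g x = 0"
    by (rule zeros_of_alternating[OF cont \<sigma> _ decreasing sign]) (use b(1) in \<open>auto simp: a_def\<close>)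
  have f_arc: "f (lower_arc (y x)) = eis (qe (lower_arc (y x))) powi l * of_real (g x)" if "x \<in> {- a..a}" for x
  proof -
    have "poly P (of_real (modular_lambda (y x))) = of_real (g x)" using P(1) by (simp add: g_def)
    thus ?thesis using P(5)[OF arc_uhp] psi_arc lower_arc(3)[OF that] by simp
  qed
  have b0: "b 0 \<in> {- a..a}" "g (b 0) \<noteq> 0" using b(1)[of 0] sign[of 0] by (auto simp: a_def abs_le_iff)
  have "eis (qe (lower_arc (y (b 0)))) \<noteq> 0" using eis_nonzero norm_qe_less_1[OF arc_uhp[OF lower_arc(3)[OF b0(1)]]] by simp
  hence nz: "f (lower_arc (y (b 0))) \<noteq> 0" using f_arc[OF b0(1)] b0(2) by simp
  have P0: "P \<noteq> 0" using b0(2) by (auto simp: g_def)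
  have fin: "finite {z. z \<in> lower_boundary4 \<and> f z = 0}"
    by (rule finite_zeros_lower_boundary[where P = P and l = l, OF _ P0]) (rule P(5))
  have inj: "inj_on (\<lambda>x. lower_arc (y x)) {- a..a}"
  proof (rule inj_onI)
    fix u v assume uv: "u \<in> {- a..a}" "v \<in> {- a..a}" and e: "lower_arc (y u) = lower_arc (y v)"
    have "cis (pi / 2 - u) = cis (pi / 2 - v)"
      using e unfolding lower_arc(1)[OF uv(1)] lower_arc(1)[OF uv(2)] cis_conv_exp[symmetric] by simp
    hence "Re (cis (pi / 2 - u)) = Re (cis (pi / 2 - v))" by (rule arg_cong)
    hence c: "cos (pi / 2 - u) = cos (pi / 2 - v)" unfolding cis.sel .
    have "pi / 2 - u = pi / 2 - v"
      by (rule cos_inj_pi[OF _ _ _ _ c]) (use lower_arc(2)[OF uv(1)] lower_arc(2)[OF uv(2)] in \<open>auto\<close>)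
    thus "u = v" by simp
  qed
  have "int (card ((\<lambda>x. lower_arc (y x)) ` Z)) \<le> zeros_count f lower_boundary4"
  proof (rule zeros_count_ge_card[where f = f and U = upper_half_plane and w = "lower_arc (y (b 0))" and S = lower_boundary4,
      OF _ open_uhp connected_uhp _ nz _ fin])
    show "f holomorphic_on upper_half_plane"
      using bf by (simp add: basis_form4_def sharp_forms4_def weakly_holomorphic_forms4_def)
    show "lower_arc (y (b 0)) \<in> upper_half_plane" using arc_uhp lower_arc(3) b0 by blast
    show "lower_boundary4 \<subseteq> upper_half_plane" by (auto simp: lower_boundary4_def)
    show "(\<lambda>x. lower_arc (y x)) ` Z \<subseteq> {z. z \<in> lower_boundary4 \<and> f z = 0}"
    proof (rule image_subsetI, intro CollectI conjI)
      fix x assume x: "x \<in> Z"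
      hence xa: "x \<in> {- a..a}" using Z(3) by auto
      show "f (lower_arc (y x)) = 0" using f_arc[OF xa] Z(4)[OF x] by simp
      have "pi / 2 - x \<in> {0..pi}" using lower_arc(2)[OF xa] by auto
      thus "lower_arc (y x) \<in> lower_boundary4"
        using arc_uhp[OF lower_arc(3)[OF xa]] lower_arc(1)[OF xa] unfolding lower_boundary4_def by blast
    qed
  qed
  thus ?thesis using card_image[OF inj_on_subset[OF inj Z(3)]] Z(2) by simp
qed

theorem theorem1:
  fixes k l m :: int and f :: "complex \<Rightarrow> complex"
  assumes "k = 2 * l"
    and "m \<ge> - l"
    and "basis_form4 l m f"
    and "(l \<ge> 0 \<and> m \<ge> 4 * l + 16) \<or> (l < 0 \<and> m \<ge> 5 * \<bar>l\<bar> + 16)"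
  shows "zeros_count f lower_boundary4 \<ge> \<lfloor>sqrt 2 / 2 * real_of_int m + real_of_int k / 4\<rfloor>"
proof -
  have lm: "large_order l m" using assms(4) by (simp add: large_order_def)
  define L where "L = sqrt 2 / 2 * real_of_int m + real_of_int l / 2"
  \<comment> \<open>Of two consecutive integers one has the parity of \<open>m + l\<close>; the range of angles has room for the
    larger one.\<close>
  define N where "N = (if even (\<lfloor>L\<rfloor> - m - l) then \<lfloor>L\<rfloor> else \<lfloor>L\<rfloor> + 1)"
  have m: "real_of_int m \<ge> 16" "- real_of_int m \<le> 2 * real_of_int l" using lm by (auto simp: large_order_def)
  have "70710 / 100000 * real_of_int m \<le> sqrt 2 / 2 * real_of_int m" using sqrt2_half m by (intro mult_right_mono) auto
  hence "L \<ge> 0" using m unfolding L_def by argo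
  hence N0: "0 \<le> N" "\<lfloor>L\<rfloor> \<le> N" by (simp_all add: N_def)
  have "even (N - m - l)"
  proof (cases "even (\<lfloor>L\<rfloor> - m - l)")
    case False
    hence "N - m - l = (\<lfloor>L\<rfloor> - m - l) + 1" by (simp add: N_def)
    thus ?thesis using False by (simp only: even_add odd_one simp_thms)
  qed (simp add: N_def)
  hence "even (int (nat N) - m - l)" using N0 by simp
  moreover have "real (nat N) \<le> sqrt 2 / 2 * m + l / 2 + 1"
  proof -
    have "N \<le> \<lfloor>L\<rfloor> + 1" by (simp add: N_def)
    hence "real_of_int N \<le> real_of_int \<lfloor>L\<rfloor> + 1" by linarith
    also have "\<dots> \<le> L + 1" by simp
    finally show ?thesis using N0 by (simp add: L_def)
  qed
  ultimately have "int (nat N) \<le> zeros_count f lower_boundary4"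
    by (rule basis_form_zeros_on_arc[OF lm assms(3)])
  hence "\<lfloor>L\<rfloor> \<le> zeros_count f lower_boundary4" using N0 by simp
  thus ?thesis unfolding L_def assms(1) by simp
qed

end
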